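(* Let $A_{\pm}=A_{\pm}^{(0)}+A_{\pm}^{(1)}\varepsilon$, $B_-=B_-^{(0)}+B_-^{(1)}\varepsilon$, $Z_0=z_0^{(0)}+z_0^{(1)}\varepsilon$, $K=\kappa^{(0)}+\kappa^{(1)}\varepsilon$, $g_2=g_2^{(0)}+g_2^{(1)}\varepsilon$, $g_3=g_3^{(0)}+g_3^{(1)}\varepsilon$ be dual numbers in $\mathbb{D}$, let $\sigma(\cdot)=\sigma(\cdot\,;g_2,g_3)$, and suppose $A_+,A_-,B_-,\sigma(K)\in\mathbb{D}^*$. Put $\mu=-\sigma(K)^{-4}$ and $B_+=-\mu^{-1}B_-$. Then the sequence $$X_n=A_{\pm}\,B_{\pm}^{\lfloor n/2\rfloor}\,\mu^{\lfloor n/2\rfloor^2}\,\sigma(nK+Z_0),\qquad n\in\mathbb{Z}$$ (subscript $+$ for $n$ even, subscript $-$ for $n$ odd) satisfies the dual Somos-5 recurrence $$X_nX_{n+5}=\alpha X_{n+1}X_{n+4}+\beta X_{n+2}X_{n+3},\qquad n\in\mathbb{Z},$$ with coefficients $$\alpha=\alpha^{(0)}+\alpha^{(1)}\varepsilon=\frac{\sigma(3K)}{\sigma(K)^9},\qquad \beta=\beta^{(0)}+\beta^{(1)}\varepsilon=-\frac{\sigma(4K)}{\sigma(2K)\,\sigma(K)^{12}}.$$ Moreover, in terms of even and odd components, $$X_n=x_n+x_n\left(\frac{A_{\pm}^{(1)}}{A_{\pm}^{(0)}}+\left\lfloor\frac n2\right\rfloor\frac{B_{\pm}^{(1)}}{B_{\pm}^{(0)}}+z_0^{(1)}\,\zeta\big(z_0^{(0)}+n\kappa^{(0)}\big)+\Big(\kappa^{(1)}\partial_{\kappa^{(0)}}+g_2^{(1)}\partial_{g_2^{(0)}}+g_3^{(1)}\partial_{g_3^{(0)}}\Big)\log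 x_n\right)\varepsilon,$$ where $\zeta(z)=\zeta(z;g_2^{(0)},g_3^{(0)})$ is the Weierstrass zeta function and $$x_n=A_{\pm}^{(0)}\big(B_{\pm}^{(0)}\big)^{\lfloor n/2\rfloor}\big(\mu^{(0)}\big)^{\lfloor n/2\rfloor^2}\sigma\big(n\kappa^{(0)}+z_0^{(0)};g_2^{(0)},g_3^{(0)}\big),\qquad \mu^{(0)}=-\sigma\big(\kappa^{(0)};g_2^{(0)},g_3^{(0)}\big)^{-4},$$ is the same expression with all parameters replaced by their even components.
   Context: $\mathbb{D}=\{x+y\varepsilon : x,y\in\mathbb{C},\ \varepsilon^2=0\}=\mathbb{C}[\varepsilon]/\langle\varepsilon^2\rangle$ is the commutative ring of dual numbers; $x$ and $y$ are called the even and odd components, and $\mathbb{D}^*=\{x+y\varepsilon: x\neq 0\}$ is its group of units. A function $\Phi$ holomorphic in several complex variables is extended to dual arguments by $\Phi(x_1+y_1\varepsilon,\dots,x_m+y_m\varepsilon)=\Phi(x_1,\dots,x_m)+\varepsilon\sum_k y_k\,\partial_k\Phi(x_1,\dots,x_m)$. The Weierstrass sigma function $\sigma(z;g_2,g_3)$ of the curve $\mathrm{y}^2=4\mathrm{x}^3-g_2\mathrm{x}-g_3$ is an entire function of $(z,g_2,g_3)$, and is extended to $\mathbb{D}$ in this way; $\zeta=\sigma'/\sigma$. The quotient $\sigma(4K)/\sigma(2K)$ means the value at $(K,g_2,g_3)$ of the entire function $\sigma(4z;g_2,g_3)/\sigma(2z;g_2,g_3)$, which is the ordinary quotient when $\sigma(2K)\in\mathbb{D}^*$.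 The components of $B_+$ are $B_+=B_+^{(0)}+B_+^{(1)}\varepsilon$. In the last formula, the partial derivatives with respect to $\kappa^{(0)},g_2^{(0)},g_3^{(0)}$ act on $x_n$ regarded as a function of the independent quantities $A_\pm^{(0)},B_\pm^{(0)},z_0^{(0)},\kappa^{(0)},g_2^{(0)},g_3^{(0)}$ (so $B_+^{(0)}$ and $B_-^{(0)}$ are held fixed, while $\mu^{(0)}$ varies with $\kappa^{(0)},g_2^{(0)},g_3^{(0)}$). If $x_n=0$, then $x_n\,\partial\log x_n$ is read as $\partial x_n$, and $x_n\zeta(z_0^{(0)}+n\kappa^{(0)})$ is read as $\partial x_n/\partial z_0^{(0)}$. *)

theory Defs
  imports "HOL-Complex_Analysis.Complex_Analysis"
begin

section \<open>Dual numbers\<close>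

text \<open>\<open>Dual x y\<close> stands for \<open>x + y \<epsilon>\<close> with \<open>\<epsilon>\<^sup>2 = 0\<close>; \<open>ev\<close> and \<open>od\<close> are its even
  and odd components.\<close>

datatype dual_num = Dual (ev: complex) (od: complex)

lemma dual_num_eq_iff: "u = v \<longleftrightarrow> ev u = ev v \<and> od u = od v"
  by (cases u; cases v) simp

instantiation dual_num :: comm_ring_1
begin

definition "0 = Dual 0 0"
definition "1 = Dual 1 0"
definition "u + v = Dual (ev u + ev v) (od u + od v)"
definition "u - v = Dual (ev u - ev v) (od u - od v)"
definition "- u = Dual (- ev u) (- od u)"
definition "u * v = Dual (ev u * ev v) (ev u * od v + od u * ev v)"

instance
  by standard
    (simp_all add: zero_dual_num_def one_dual_num_def plus_dual_num_def minus_dual_num_def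
      uminus_dual_num_def times_dual_num_def algebra_simps dual_num_eq_iff)

end

text \<open>The values of \<open>inverse\<close> and \<open>divide\<close> are meaningful only for units (as denominators).\<close>

instantiation dual_num :: inverse
begin

definition "inverse u = Dual (inverse (ev u)) (- od u / (ev u)\<^sup>2)"
definition "u div v = u * inverse (v :: dual_num)"

instance ..

end

definition dual_units :: "dual_num set" where
  "dual_units = {u. ev u \<noteq> 0}"

lemma dual_units_right_inverse:
  assumes "u \<in> dual_units"
  shows "u * inverse u = 1"
  using assms
  by (simp add: dual_units_def times_dual_num_def inverse_dual_num_def one_dual_num_def
      field_simps power2_eq_square)

lemma dual_units_iff_dvd_1: "u \<in> dual_units \<longleftrightarrow> u dvd 1"
proof
  assume "u \<in> dual_units"
  then show "u dvd 1"
    using dual_units_right_inverse by (metis dvdI)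
next
  assume "u dvd 1"
  then obtain v where "u * v = 1" by (metis dvdE)
  then have "ev u * ev v = 1"
    by (simp add: times_dual_num_def one_dual_num_def)
  then show "u \<in> dual_units" by (auto simp: dual_units_def)
qed

text \<open>Extension of a holomorphic function of three complex variables to dual arguments.\<close>

definition dual_ext ::
  "(complex \<Rightarrow> complex \<Rightarrow> complex \<Rightarrow> complex) \<Rightarrow> dual_num \<Rightarrow> dual_num \<Rightarrow> dual_num \<Rightarrow> dual_num" where
  "dual_ext \<Phi> u v w = Dual (\<Phi> (ev u) (ev v) (ev w))
     (od u * deriv (\<lambda>t. \<Phi> t (ev v) (ev w)) (ev u)
      + od v * deriv (\<lambda>t. \<Phi> (ev u) t (ev w)) (ev v)
      + od w * deriv (\<lambda>t. \<Phi> (ev u) (ev v) t) (ev w))"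


section \<open>Weierstrass functions of a possibly singular cubic\<close>

definition logderiv :: "(complex \<Rightarrow> complex) \<Rightarrow> complex \<Rightarrow> complex" where
  "logderiv f z = deriv f z / f z"

text \<open>\<open>f\<close> is the sigma function of \<open>y\<^sup>2 = 4 x\<^sup>3 - g2 x - g3\<close> if it is entire and odd with
  \<open>f(z) = z + O(z\<^sup>3)\<close>, and \<open>P = -(log f)''\<close> (the \<open>\<wp>\<close>-function) parametrises the curve by \<open>x = P\<close>, \<open>y = P'\<close>.
  No lattice is mentioned, since the discriminant \<open>g2\<^sup>3 - 27 g3\<^sup>2\<close> is allowed to vanish.

  Such an \<open>f\<close> is unique: \<open>P\<close> is even with principal part \<open>z\<^sup>-\<^sup>2\<close> at the origin, so the
  differential equation determines its Laurent series, hence \<open>f\<close> up to a factor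
  \<open>exp (a z + b)\<close>, and the normalisation forces that factor to be 1.\<close>

definition is_weierstrass_sigma ::
  "complex \<Rightarrow> complex \<Rightarrow> (complex \<Rightarrow> complex) \<Rightarrow> bool" where
  "is_weierstrass_sigma g2 g3 f \<longleftrightarrow>
     f holomorphic_on UNIV \<and> (\<forall>z. f (- z) = - f z) \<and> deriv f 0 = 1 \<and>
     (let P = (\<lambda>z. - deriv (logderiv f) z)
      in \<forall>z. f z \<noteq> 0 \<longrightarrow> (deriv P z)\<^sup>2 = 4 * P z ^ 3 - g2 * P z - g3)"

definition weierstrass_sigma :: "complex \<Rightarrow> complex \<Rightarrow> complex \<Rightarrow> complex" where
  "weierstrass_sigma z g2 g3 = (THE f. is_weierstrass_sigma g2 g3 f) z"

definition weierstrass_zeta :: "complex \<Rightarrow> complex \<Rightarrow> complex \<Rightarrow> complex" where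
  "weierstrass_zeta z g2 g3 = logderiv (\<lambda>w. weierstrass_sigma w g2 g3) z"

text \<open>The entire function \<open>\<sigma>(4z) / \<sigma>(2z)\<close>; its singularities at the zeros of \<open>\<sigma>(2z)\<close> are
  removable.\<close>

definition sigma_quotient :: "complex \<Rightarrow> complex \<Rightarrow> complex \<Rightarrow> complex" where
  "sigma_quotient z g2 g3 =
     remove_sings (\<lambda>w. weierstrass_sigma (4 * w) g2 g3 / weierstrass_sigma (2 * w) g2 g3) z"

definition dual_sigma :: "dual_num \<Rightarrow> dual_num \<Rightarrow> dual_num \<Rightarrow> dual_num" where
  "dual_sigma = dual_ext weierstrass_sigma"

definition dual_sigma_quotient :: "dual_num \<Rightarrow> dual_num \<Rightarrow> dual_num \<Rightarrow> dual_num" where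
  "dual_sigma_quotient = dual_ext sigma_quotient"


section \<open>The sequences\<close>

text \<open>The choice of subscript \<open>\<plusminus>\<close>: \<open>+\<close> for even and \<open>-\<close> for odd index.\<close>

definition pm :: "'a \<Rightarrow> 'a \<Rightarrow> int \<Rightarrow> 'a" where
  "pm p m n = (if even n then p else m)"

definition dual_mu :: "dual_num \<Rightarrow> dual_num \<Rightarrow> dual_num \<Rightarrow> dual_num" where
  "dual_mu K g2 g3 = - (dual_sigma K g2 g3 powi (-4))"

text \<open>For integers, \<open>n div 2\<close> is the floor of \<open>n/2\<close>.\<close>

definition dual_X ::
  "dual_num \<Rightarrow> dual_num \<Rightarrow> dual_num \<Rightarrow> dual_num \<Rightarrow> dual_num \<Rightarrow> dual_num \<Rightarrow> dual_num \<Rightarrow> dual_num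
   \<Rightarrow> int \<Rightarrow> dual_num" where
  "dual_X Ap Am Bp Bm Z0 K g2 g3 n =
     pm Ap Am n * pm Bp Bm n powi (n div 2) * dual_mu K g2 g3 powi ((n div 2)\<^sup>2)
     * dual_sigma (of_int n * K + Z0) g2 g3"

definition mu :: "complex \<Rightarrow> complex \<Rightarrow> complex \<Rightarrow> complex" where
  "mu \<kappa> g2 g3 = - (weierstrass_sigma \<kappa> g2 g3 powi (-4))"

text \<open>\<open>Bp\<close> and \<open>Bm\<close> are independent arguments here, whereas \<open>\<mu>\<close> is a function of
  \<open>\<kappa>, g2, g3\<close>; this fixes the meaning of the partial derivatives of \<open>x\<^sub>n\<close>.\<close>

definition even_x ::
  "complex \<Rightarrow> complex \<Rightarrow> complex \<Rightarrow> complex \<Rightarrow> complex \<Rightarrow> complex \<Rightarrow> complex \<Rightarrow> complex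
   \<Rightarrow> int \<Rightarrow> complex" where
  "even_x Ap Am Bp Bm z0 \<kappa> g2 g3 n =
     pm Ap Am n * pm Bp Bm n powi (n div 2) * mu \<kappa> g2 g3 powi ((n div 2)\<^sup>2)
     * weierstrass_sigma (of_int n * \<kappa> + z0) g2 g3"

end

theory Submission
  imports Defs "HOL-Real_Asymp.Real_Asymp"
begin

text \<open>No lattice is available, since the discriminant may vanish; instead \<open>\<sigma>\<close> is built from
  its differential equation. The Laurent coefficients of \<open>\<wp>\<close> are polynomials in \<open>g2, g3\<close> with
  geometric bounds, so they give \<open>\<sigma>\<close> near \<open>z = 0\<close> as a holomorphic function of \<open>(z, g2, g3)\<close>.
  Together with \<open>\<phi> = \<sigma>\<^sup>2 \<wp>\<close> and \<open>q = \<sigma>\<^sup>3 \<wp>'\<close> it obeys a polynomial duplication law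
  \<open>(\<sigma>, \<phi>, q)(2 z) = sigma_dup (\<sigma>, \<phi>, q)(z)\<close>, and iterating this law extends \<open>\<sigma>\<close> to all of
  \<open>\<complex>\<^sup>3\<close>.

  The differential equation makes \<open>log (\<sigma>(a)\<^sup>2 \<phi>(b) - \<phi>(a) \<sigma>(b)\<^sup>2)\<close> a solution of the wave
  equation in \<open>(a, b)\<close>, which forces it to be the sum of \<open>log \<sigma>(a + b)\<close> and \<open>log \<sigma>(a - b)\<close>. The Somos-5 relation
  between complex numbers is then a Pluecker relation. Dual numbers are first-order jets of
  holomorphic curves, so every identity between holomorphic functions passes to them.\<close>

section \<open>Complex differentiability in three variables\<close>

text \<open>\<open>dual_ext\<close> is written with partial derivatives, whose mere existence at a
  point gives no chain rule along a curve. \<open>cdiff\<close> therefore asks for a complex-linear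
  Frechet derivative, and the local construction has to supply it jointly in
  \<open>(z, g2, g3)\<close>. Unlike \<wp> and its derivative, the components
  \<open>\<sigma>\<close>, \<open>\<sigma>\<^sup>2 \<wp>\<close>,
  \<open>\<sigma>\<^sup>3 \<wp>'\<close> have no poles, so duplication can be iterated without
  meeting a denominator. The iterates agree by a uniqueness theorem for odd normalised solutions,
  which also evaluates the definite description in \<open>weierstrass_sigma\<close>. The price is
  that identities arrive multiplied by functions with zeros, such as \<open>q\<close>,
  \<open>f\<close> or \<open>\<sigma>(2 k)\<close>. The identity theorem cancels such a factor once
  it is nonzero somewhere; for \<open>q\<close> the point 0 serves, as \<open>q 0 = -2\<close> is
  the leading coefficient of \<open>\<wp>'\<close>. In the Somos relation this covers
  \<open>\<sigma>(2 k) = 0\<close>, where \<beta> is not an ordinary quotient.\<close>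

definition cdiff :: "(complex \<times> complex \<times> complex \<Rightarrow> complex) \<Rightarrow> complex \<times> complex \<times> complex \<Rightarrow> bool" where
  "cdiff F p \<longleftrightarrow> (\<exists>a b c. (F has_derivative (\<lambda>v. a * fst v + b * fst (snd v) + c * snd (snd v))) (at p))"

lemma cdiff_const: "cdiff (\<lambda>p. k) p"
  unfolding cdiff_def by (rule exI[of _ 0])+ simp

lemma cdiff_fst: "cdiff (\<lambda>p. fst p) p"
  unfolding cdiff_def by (rule exI[of _ 1], (rule exI[of _ 0])+) (auto intro!: derivative_eq_intros)

lemma cdiff_fst_snd: "cdiff (\<lambda>p. fst (snd p)) p"
  unfolding cdiff_def
  by (rule exI[of _ 0], rule exI[of _ 1], rule exI[of _ 0]) (auto intro!: derivative_eq_intros)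

lemma cdiff_snd_snd: "cdiff (\<lambda>p. snd (snd p)) p"
  unfolding cdiff_def
  by (rule exI[of _ 0], rule exI[of _ 0], rule exI[of _ 1]) (auto intro!: derivative_eq_intros)

lemma cdiff_add:
  assumes "cdiff F p" "cdiff G p"
  shows "cdiff (\<lambda>p. F p + G p) p"
proof -
  obtain a b c a' b' c' where
    "(F has_derivative (\<lambda>v. a * fst v + b * fst (snd v) + c * snd (snd v))) (at p)"
    "(G has_derivative (\<lambda>v. a' * fst v + b' * fst (snd v) + c' * snd (snd v))) (at p)"
    using assms unfolding cdiff_def by blast
  from has_derivative_add[OF this] show ?thesis
    unfolding cdiff_def
    by (intro exI[of _ "a + a'"] exI[of _ "b + b'"] exI[of _ "c + c'"]) (simp add: algebra_simps)
qed

lemma cdiff_mult: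
  assumes "cdiff F p" "cdiff G p"
  shows "cdiff (\<lambda>p. F p * G p) p"
proof -
  obtain a b c a' b' c' where
    "(F has_derivative (\<lambda>v. a * fst v + b * fst (snd v) + c * snd (snd v))) (at p)"
    "(G has_derivative (\<lambda>v. a' * fst v + b' * fst (snd v) + c' * snd (snd v))) (at p)"
    using assms unfolding cdiff_def by blast
  from has_derivative_mult[OF this] show ?thesis
    unfolding cdiff_def
    by (intro exI[of _ "F p * a' + a * G p"] exI[of _ "F p * b' + b * G p"] exI[of _ "F p * c' + c * G p"])
       (simp add: algebra_simps)
qed

lemma cdiff_uminus: "cdiff F p \<Longrightarrow> cdiff (\<lambda>p. - F p) p"
  using cdiff_mult[OF cdiff_const[of "-1"]] by fastforce

lemma cdiff_diff: "cdiff F p \<Longrightarrow> cdiff G p \<Longrightarrow> cdiff (\<lambda>p. F p - G p) p"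
  using cdiff_add[OF _ cdiff_uminus] by fastforce

lemma cdiff_power: "cdiff F p \<Longrightarrow> cdiff (\<lambda>p. F p ^ n) p"
  by (induction n) (auto intro: cdiff_const cdiff_mult)

lemma cdiff_compose1:
  assumes "(g has_field_derivative g') (at (F p))" "cdiff F p"
  shows "cdiff (\<lambda>p. g (F p)) p"
proof -
  obtain a b c where
    "(F has_derivative (\<lambda>v. a * fst v + b * fst (snd v) + c * snd (snd v))) (at p)"
    using assms(2) unfolding cdiff_def by blast
  from has_derivative_compose[OF this assms(1)[unfolded has_field_derivative_def]] show ?thesis
    unfolding cdiff_def
    by (intro exI[of _ "g' * a"] exI[of _ "g' * b"] exI[of _ "g' * c"]) (simp add: algebra_simps)
qed

lemma cdiff_compose:
  assumes F: "cdiff F (G p, H p, K p)" and "cdiff G p" "cdiff H p" "cdiff K p"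
  shows "cdiff (\<lambda>p. F (G p, H p, K p)) p"
proof -
  obtain a b c where
    F: "(F has_derivative (\<lambda>v. a * fst v + b * fst (snd v) + c * snd (snd v))) (at (G p, H p, K p))"
    using F unfolding cdiff_def by blast
  obtain a1 b1 c1 a2 b2 c2 a3 b3 c3 where
    G: "(G has_derivative (\<lambda>v. a1 * fst v + b1 * fst (snd v) + c1 * snd (snd v))) (at p)" and
    H: "(H has_derivative (\<lambda>v. a2 * fst v + b2 * fst (snd v) + c2 * snd (snd v))) (at p)" and
    K: "(K has_derivative (\<lambda>v. a3 * fst v + b3 * fst (snd v) + c3 * snd (snd v))) (at p)"
    using assms unfolding cdiff_def by blast
  from has_derivative_compose[OF has_derivative_Pair[OF G has_derivative_Pair[OF H K]] F]
  show ?thesis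
    unfolding cdiff_def
    by (intro exI[of _ "a * a1 + b * a2 + c * a3"] exI[of _ "a * b1 + b * b2 + c * b3"]
          exI[of _ "a * c1 + b * c2 + c * c3"]) (simp add: algebra_simps)
qed

lemma cdiff_transform:
  assumes "cdiff F p" "eventually (\<lambda>q. F q = G q) (nhds p)"
  shows "cdiff G p"
proof -
  obtain a b c where
    F: "(F has_derivative (\<lambda>v. a * fst v + b * fst (snd v) + c * snd (snd v))) (at p)"
    using assms(1) unfolding cdiff_def by blast
  have "(G has_derivative (\<lambda>v. a * fst v + b * fst (snd v) + c * snd (snd v))) (at p)"
    by (rule has_derivative_transform_eventually[OF F])
       (use assms(2) in \<open>auto simp: eventually_at_filter elim: eventually_mono dest: eventually_nhds_x_imp_x\<close>)
  then show ?thesis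
    unfolding cdiff_def by blast
qed

text \<open>The chain rule is applied four times: along the given curve, and along the three
  coordinate lines through its point, which identifies the coefficients of the derivative with the
  partial derivatives used in \<open>dual_ext\<close>.\<close>

lemma cdiff_chain:
  assumes F: "cdiff F (x t, y t, z t)"
    and x: "(x has_field_derivative x') (at t)"
    and y: "(y has_field_derivative y') (at t)"
    and z: "(z has_field_derivative z') (at t)"
  shows "((\<lambda>s. F (x s, y s, z s)) has_field_derivative
      (x' * deriv (\<lambda>s. F (s, y t, z t)) (x t) + y' * deriv (\<lambda>s. F (x t, s, z t)) (y t)
        + z' * deriv (\<lambda>s. F (x t, y t, s)) (z t))) (at t)"
proof -
  obtain a b c where
    F: "(F has_derivative (\<lambda>v. a * fst v + b * fst (snd v) + c * snd (snd v))) (at (x t, y t, z t))"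
    using F unfolding cdiff_def by blast
  have chain: "((\<lambda>s. F (x s, y s, z s)) has_field_derivative (a * x' + b * y' + c * z')) (at t)"
    if "(F has_derivative (\<lambda>v. a * fst v + b * fst (snd v) + c * snd (snd v))) (at (x t, y t, z t))"
      "(x has_field_derivative x') (at t)" "(y has_field_derivative y') (at t)"
      "(z has_field_derivative z') (at t)"
    for x y z x' y' z' t
    using has_derivative_compose[OF has_derivative_Pair[OF that(2)[unfolded has_field_derivative_def]
          has_derivative_Pair[OF that(3,4)[unfolded has_field_derivative_def]]] that(1)]
    unfolding has_field_derivative_def by (rule has_derivative_eq_rhs) (auto simp: algebra_simps)
  have "deriv (\<lambda>s. F (s, y t, z t)) (x t) = a"
    by (rule DERIV_imp_deriv, rule DERIV_cong,
        rule chain[where x = "\<lambda>s. s" and y = "\<lambda>_. y t" and z = "\<lambda>_. z t" and t = "x t"])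
       (use F in \<open>auto intro!: derivative_eq_intros\<close>)
  moreover have "deriv (\<lambda>s. F (x t, s, z t)) (y t) = b"
    by (rule DERIV_imp_deriv, rule DERIV_cong,
        rule chain[where x = "\<lambda>_. x t" and y = "\<lambda>s. s" and z = "\<lambda>_. z t" and t = "y t"])
       (use F in \<open>auto intro!: derivative_eq_intros\<close>)
  moreover have "deriv (\<lambda>s. F (x t, y t, s)) (z t) = c"
    by (rule DERIV_imp_deriv, rule DERIV_cong,
        rule chain[where x = "\<lambda>_. x t" and y = "\<lambda>_. y t" and z = "\<lambda>s. s" and t = "z t"])
       (use F in \<open>auto intro!: derivative_eq_intros\<close>)
  ultimately show ?thesis
    using chain[OF F x y z] by (simp add: mult.commute)
qed

lemma cdiff_power_int:
  assumes "cdiff F p" "F p \<noteq> 0"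
  shows "cdiff (\<lambda>p. F p powi n) p"
  using cdiff_compose1[OF DERIV_power_int[OF DERIV_ident disjI2[OF assms(2)]] assms(1), of n] .

lemma cdiff_partials:
  assumes "cdiff F (x, y, z)"
  shows "((\<lambda>s. F (s, y, z)) has_field_derivative deriv (\<lambda>s. F (s, y, z)) x) (at x)"
    "((\<lambda>s. F (x, s, z)) has_field_derivative deriv (\<lambda>s. F (x, s, z)) y) (at y)"
    "((\<lambda>s. F (x, y, s)) has_field_derivative deriv (\<lambda>s. F (x, y, s)) z) (at z)"
proof -
  have "((\<lambda>s. F (s, y, z)) has_field_derivative 1 * deriv (\<lambda>s. F (s, y, z)) x
      + 0 * deriv (\<lambda>s. F (x, s, z)) y + 0 * deriv (\<lambda>s. F (x, y, s)) z) (at x)"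
    by (rule cdiff_chain) (use assms in auto)
  then show "((\<lambda>s. F (s, y, z)) has_field_derivative deriv (\<lambda>s. F (s, y, z)) x) (at x)" by simp
  have "((\<lambda>s. F (x, s, z)) has_field_derivative 0 * deriv (\<lambda>s. F (s, y, z)) x
      + 1 * deriv (\<lambda>s. F (x, s, z)) y + 0 * deriv (\<lambda>s. F (x, y, s)) z) (at y)"
    by (rule cdiff_chain) (use assms in auto)
  then show "((\<lambda>s. F (x, s, z)) has_field_derivative deriv (\<lambda>s. F (x, s, z)) y) (at y)" by simp
  have "((\<lambda>s. F (x, y, s)) has_field_derivative 0 * deriv (\<lambda>s. F (s, y, z)) x
      + 0 * deriv (\<lambda>s. F (x, s, z)) y + 1 * deriv (\<lambda>s. F (x, y, s)) z) (at z)"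
    by (rule cdiff_chain) (use assms in auto)
  then show "((\<lambda>s. F (x, y, s)) has_field_derivative deriv (\<lambda>s. F (x, y, s)) z) (at z)" by simp
qed

section \<open>Laurent coefficients of the Weierstrass function\<close>

text \<open>\<open>z\<^sup>2 \<wp>(z) = (\<Sum>k. wp_coeff g2 g3 k * z^(2 * k))\<close>; the recursion is \<open>\<wp>'' = 6 \<wp>\<^sup>2 - g2 / 2\<close>.\<close>

fun wp_coeff :: "complex \<Rightarrow> complex \<Rightarrow> nat \<Rightarrow> complex" where
  "wp_coeff g2 g3 k =
     (if k = 0 then 1 else if k = 1 then 0 else if k = 2 then g2 / 20 else if k = 3 then g3 / 28
      else 3 / ((2 * of_nat k + 1) * (of_nat k - 3))
        * (\<Sum>m = 2..k - 2. wp_coeff g2 g3 m * wp_coeff g2 g3 (k - m)))"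

declare wp_coeff.simps [simp del]

lemma wp_coeff_small:
  "wp_coeff g2 g3 0 = 1" "wp_coeff g2 g3 (Suc 0) = 0" "wp_coeff g2 g3 2 = g2 / 20"
  "wp_coeff g2 g3 3 = g3 / 28"
  by (simp_all add: wp_coeff.simps)

lemma wp_coeff_rec:
  "4 \<le> k \<Longrightarrow> wp_coeff g2 g3 k = 3 / ((2 * of_nat k + 1) * (of_nat k - 3))
        * (\<Sum>m = 2..k - 2. wp_coeff g2 g3 m * wp_coeff g2 g3 (k - m))"
  by (subst wp_coeff.simps) simp

lemma norm_rec_factor:
  assumes "4 \<le> k"
  shows "norm (3 / ((2 * of_nat k + 1) * (of_nat k - 3)) :: complex)
    = 3 / ((2 * real k + 1) * (real k - 3))"
proof -
  have "3 / ((2 * of_nat k + 1) * (of_nat k - 3)) = (of_real (3 / ((2 * real k + 1) * (real k - 3))) :: complex)"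
    by simp
  also have "norm \<dots> = 3 / ((2 * real k + 1) * (real k - 3))"
    using assms by (subst norm_of_real) auto
  finally show ?thesis .
qed

text \<open>The sum has \<open>k - 3\<close> terms, which cancels the factor \<open>k - 3\<close> of
  the denominator, and \<open>3 / (2 * k + 1) \<le> 1 / 3\<close> for \<open>k \<ge> 4\<close>. The
  spare factor absorbs the 2 that the product rule produces when the coefficients are
  differentiated.\<close>

lemma norm_rec_sum:
  assumes "4 \<le> k" "\<And>m. m \<in> {2..k-2} \<Longrightarrow> norm (s m :: complex) \<le> B"
  shows "norm (3 / ((2 * of_nat k + 1) * (of_nat k - 3)) * (\<Sum>m = 2..k - 2. s m)) \<le> B / 3"
proof -
  have B: "0 \<le> B"
    using assms(2)[of 2] assms(1) order_trans[OF norm_ge_zero[of "s 2"]] by simp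
  have "norm (\<Sum>m = 2..k - 2. s m) \<le> of_nat (card {2..k-2}) * B"
    by (rule sum_norm_bound) (use assms in auto)
  also have "real (card {2..k-2}) = real k - 3"
    using assms(1) by (simp add: of_nat_diff)
  finally have *: "norm (\<Sum>m = 2..k - 2. s m) \<le> (real k - 3) * B" .
  have "norm (3 / ((2 * of_nat k + 1) * (of_nat k - 3)) * (\<Sum>m = 2..k - 2. s m))
      \<le> 3 / ((2 * real k + 1) * (real k - 3)) * ((real k - 3) * B)"
    unfolding norm_mult norm_rec_factor[OF assms(1)]
    by (rule mult_left_mono[OF *]) (use assms(1) in auto)
  also have "\<dots> = 3 / (2 * real k + 1) * B"
  proof -
    have *: "3 / (b * a) * (a * B) = 3 / b * B" if "a \<noteq> 0" "b \<noteq> 0" for a b :: real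
      using that by simp
    show ?thesis by (rule *) (use assms(1) in auto)
  qed
  also have "\<dots> \<le> 1 / 3 * B"
    by (rule mult_right_mono[OF _ B]) (use assms(1) in \<open>auto simp: field_simps\<close>)
  finally show ?thesis by simp
qed

text \<open>The bound is multiplicative along the recursion, since
  \<open>M ^ m * M ^ (k - m) = M ^ k\<close>. Leaving \<open>M\<close> free makes it uniform on
  bounded sets of \<open>(g2, g3)\<close>.\<close>

lemma wp_coeff_bound:
  assumes M: "1 + norm g2 + norm g3 \<le> M"
  shows "norm (wp_coeff g2 g3 k) \<le> M ^ k"
proof (induction k rule: less_induct)
  case (less k)
  have M1: "1 \<le> M" "norm g2 \<le> M" "norm g3 \<le> M" using M norm_ge_zero[of g2] norm_ge_zero[of g3] by linarith+
  have MM: "M \<le> M ^ 2" "M \<le> M ^ 3"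
    using power_increasing[of 1 2 M] power_increasing[of 1 3 M] M1 by auto
  consider "k = 0" | "k = 1" | "k = 2" | "k = 3" | "4 \<le> k" by linarith
  then show ?case
  proof cases
    case 5
    have "norm (wp_coeff g2 g3 m * wp_coeff g2 g3 (k - m)) \<le> M ^ k" if m: "m \<in> {2..k-2}" for m
    proof -
      have "norm (wp_coeff g2 g3 m * wp_coeff g2 g3 (k - m)) \<le> M ^ m * M ^ (k - m)"
        unfolding norm_mult by (rule mult_mono) (use less m 5 M1 in auto)
      also have "\<dots> = M ^ (m + (k - m))" by (simp only: power_add)
      also have "m + (k - m) = k" using m 5 by auto
      finally show ?thesis .
    qed
    from norm_rec_sum[OF 5 this]
    have "norm (wp_coeff g2 g3 k) \<le> M ^ k / 3" by (simp add: wp_coeff_rec[OF 5])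
    also have "\<dots> \<le> M ^ k" using M1 by simp
    finally show ?thesis .
  qed (use M1 MM norm_ge_zero[of g2] norm_ge_zero[of g3] in
      \<open>auto simp: wp_coeff_small norm_divide simp del: norm_ge_zero\<close>)
qed

text \<open>Differentiating the recursion gives two products per summand, each at most
  \<open>M ^ k\<close>; with \<open>norm_rec_sum\<close> the total is at most
  \<open>2 / 3 * M ^ k\<close>, so the induction closes with the same geometric growth. The
  derivatives are chosen before \<open>M\<close>, hence do not depend on it.\<close>

lemma wp_coeff_derivative:
  "\<exists>d2 d3. ((\<lambda>(g2, g3). wp_coeff g2 g3 k) has_derivative (\<lambda>v. d2 * fst v + d3 * snd v)) (at (g2, g3))
     \<and> (\<forall>M. 1 + norm g2 + norm g3 \<le> M \<longrightarrow> norm d2 \<le> M ^ k \<and> norm d3 \<le> M ^ k)"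
proof (induction k rule: less_induct)
  case (less k)
  consider "k = 0" | "k = 1" | "k = 2" | "k = 3" | "4 \<le> k" by linarith
  then show ?case
  proof cases
    case 1
    then show ?thesis
      by (intro exI[of _ 0]) (auto simp: wp_coeff_small case_prod_beta)
  next
    case 2
    have "0 \<le> M" if "1 + norm g2 + norm g3 \<le> M" for M
      using that norm_ge_zero[of g2] norm_ge_zero[of g3] by linarith
    with 2 show ?thesis
      by (intro exI[of _ 0]) (auto simp: wp_coeff_small case_prod_beta)
  next
    case 3
    have "1 / 20 \<le> M ^ 2" "0 \<le> M ^ 2" if "1 + norm g2 + norm g3 \<le> M" for M
    proof -
      have "1 \<le> M" using that norm_ge_zero[of g2] norm_ge_zero[of g3] by linarith
      then have "1 \<le> M ^ 2" by simp
      then show "1 / 20 \<le> M ^ 2" "0 \<le> M ^ 2" by auto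
    qed
    then show ?thesis using 3
      by (intro exI[of _ "1/20"] exI[of _ 0])
        (auto simp: wp_coeff_small case_prod_beta norm_divide intro!: derivative_eq_intros)
  next
    case 4
    have "1 / 28 \<le> M ^ 3" "0 \<le> M ^ 3" if "1 + norm g2 + norm g3 \<le> M" for M
    proof -
      have "1 \<le> M" using that norm_ge_zero[of g2] norm_ge_zero[of g3] by linarith
      then have 1: "1 \<le> M ^ 3" by simp
      show "1 / 28 \<le> M ^ 3" "0 \<le> M ^ 3"
        by (rule order_trans[OF _ 1], simp)+
    qed
    then show ?thesis using 4
      by (intro exI[of _ 0] exI[of _ "1/28"])
        (auto simp: wp_coeff_small case_prod_beta norm_divide intro!: derivative_eq_intros)
  next
    case 5
    define r :: complex where "r = 3 / ((2 * of_nat k + 1) * (of_nat k - 3))"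
    define Q where "Q m d2 d3 \<longleftrightarrow>
        ((\<lambda>(g2, g3). wp_coeff g2 g3 m) has_derivative (\<lambda>v. d2 * fst v + d3 * snd v)) (at (g2, g3))
        \<and> (\<forall>M. 1 + norm g2 + norm g3 \<le> M \<longrightarrow> norm d2 \<le> M ^ m \<and> norm d3 \<le> M ^ m)" for m d2 d3
    have "\<forall>m. \<exists>d2 d3. m < k \<longrightarrow> Q m d2 d3"
      using less unfolding Q_def by blast
    then obtain a b where ab: "\<And>m. m < k \<Longrightarrow> Q m (a m) (b m)"
      by metis
    note der = ab[unfolded Q_def, THEN conjunct1] and bd = ab[unfolded Q_def, THEN conjunct2, rule_format]
    let ?c = "wp_coeff g2 g3"
    define d where "d e = r * (\<Sum>m = 2..k - 2. ?c m * e (k - m) + e m * ?c (k - m))" for e :: "nat \<Rightarrow> complex"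
    have eq: "(\<lambda>(g2, g3). wp_coeff g2 g3 k) = (\<lambda>p. r * (\<Sum>m = 2..k - 2.
        (case p of (g2, g3) \<Rightarrow> wp_coeff g2 g3 m) * (case p of (g2, g3) \<Rightarrow> wp_coeff g2 g3 (k - m))))"
      by (auto simp: wp_coeff_rec[OF 5] r_def)
    have "((\<lambda>p. (case p of (g2, g3) \<Rightarrow> wp_coeff g2 g3 m) * (case p of (g2, g3) \<Rightarrow> wp_coeff g2 g3 (k - m)))
        has_derivative (\<lambda>v. ?c m * (a (k - m) * fst v + b (k - m) * snd v)
            + (a m * fst v + b m * snd v) * ?c (k - m))) (at (g2, g3))" if m: "m \<in> {2..k - 2}" for m
    proof -
      have mk: "m < k" "k - m < k" using m 5 by auto
      from has_derivative_mult[OF der[OF mk(1)] der[OF mk(2)]] show ?thesis by simp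
    qed
    then have "((\<lambda>(g2, g3). wp_coeff g2 g3 k) has_derivative
        (\<lambda>v. r * (\<Sum>m = 2..k - 2. ?c m * (a (k - m) * fst v + b (k - m) * snd v)
            + (a m * fst v + b m * snd v) * ?c (k - m)))) (at (g2, g3))"
      unfolding eq by (intro has_derivative_mult_right has_derivative_sum)
    also have "(\<lambda>v. r * (\<Sum>m = 2..k - 2. ?c m * (a (k - m) * fst v + b (k - m) * snd v)
            + (a m * fst v + b m * snd v) * ?c (k - m))) = (\<lambda>v. d a * fst v + d b * snd v)"
      unfolding d_def sum_distrib_left sum_distrib_right sum.distrib[symmetric]
      by (intro ext sum.cong refl) (simp add: algebra_simps)
    finally have 1: "((\<lambda>(g2, g3). wp_coeff g2 g3 k) has_derivative (\<lambda>v. d a * fst v + d b * snd v)) (at (g2, g3))" .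
    have 2: "norm (d e) \<le> M ^ k"
      if M: "1 + norm g2 + norm g3 \<le> M" and e: "\<And>m. m < k \<Longrightarrow> norm (e m) \<le> M ^ m" for M e
    proof -
      have M1: "1 \<le> M" using M norm_ge_zero[of g2] norm_ge_zero[of g3] by linarith
      have "norm (?c m * e (k - m) + e m * ?c (k - m)) \<le> 2 * M ^ k" if m: "m \<in> {2..k-2}" for m
      proof -
        have mk: "m < k" "k - m < k" using m 5 by auto
        have "norm (?c m * e (k - m) + e m * ?c (k - m)) \<le> M ^ m * M ^ (k - m) + M ^ m * M ^ (k - m)"
          by (rule order_trans[OF norm_triangle_ineq], unfold norm_mult, intro add_mono mult_mono)
             (use e[OF mk(1)] e[OF mk(2)] M1 wp_coeff_bound[OF M] in auto)
        moreover have "M ^ m * M ^ (k - m) = M ^ k" using mk by (metis power_add le_add_diff_inverse less_imp_le)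
        ultimately show ?thesis by simp
      qed
      from norm_rec_sum[OF 5 this] have "norm (d e) \<le> 2 * M ^ k / 3" by (simp add: d_def r_def)
      also have "\<dots> \<le> M ^ k" using M1 by simp
      finally show ?thesis .
    qed
    show ?thesis using 1 2 bd by blast
  qed
qed

text \<open>Termwise differentiation needs the derivatives to converge uniformly as linear maps.
  Each of the three coefficient series does so by the Weierstrass test, and each contributes
  \<open>e / 3\<close> to the error.\<close>

lemma cdiff_series:
  assumes S: "open S" "convex S" "p \<in> S"
    and der: "\<And>k x. x \<in> S \<Longrightarrow> (f k has_derivative
        (\<lambda>v. a k x * fst v + b k x * fst (snd v) + c k x * snd (snd v))) (at x)"
    and bd: "\<And>k x. x \<in> S \<Longrightarrow> norm (a k x) \<le> B k" "\<And>k x. x \<in> S \<Longrightarrow> norm (b k x) \<le> B k"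
      "\<And>k x. x \<in> S \<Longrightarrow> norm (c k x) \<le> B k"
    and sB: "summable B" and sf: "\<And>x. x \<in> S \<Longrightarrow> summable (\<lambda>k. f k x)"
  shows "cdiff (\<lambda>x. \<Sum>k. f k x) p"
proof -
  define g' where "g' x v = (\<Sum>k. a k x) * fst v + (\<Sum>k. b k x) * fst (snd v) + (\<Sum>k. c k x) * snd (snd v)"
    for x v :: "complex \<times> complex \<times> complex"
  have ul: "uniform_limit S (\<lambda>n x. \<Sum>i<n. a i x) (\<lambda>x. \<Sum>i. a i x) sequentially"
    "uniform_limit S (\<lambda>n x. \<Sum>i<n. b i x) (\<lambda>x. \<Sum>i. b i x) sequentially"
    "uniform_limit S (\<lambda>n x. \<Sum>i<n. c i x) (\<lambda>x. \<Sum>i. c i x) sequentially"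
    by (rule Weierstrass_m_test[OF _ sB]; use bd in blast)+
  have "\<forall>\<^sub>F n in sequentially. \<forall>x\<in>S. \<forall>h. norm ((\<Sum>i<n. a i x * fst h + b i x * fst (snd h) + c i x * snd (snd h)) - g' x h) \<le> e * norm h"
    if e: "e > 0" for e
  proof -
    have "e / 3 > 0" using e by simp
    from uniform_limitD[OF ul(1) this] uniform_limitD[OF ul(2) this] uniform_limitD[OF ul(3) this]
    show ?thesis
    proof eventually_elim
      case (elim n)
      show ?case
      proof (intro ballI allI)
        fix x h :: "complex \<times> complex \<times> complex" assume x: "x \<in> S"
        let ?A = "(\<Sum>i<n. a i x) - (\<Sum>i. a i x)" and ?B = "(\<Sum>i<n. b i x) - (\<Sum>i. b i x)"
          and ?C = "(\<Sum>i<n. c i x) - (\<Sum>i. c i x)"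
        have h: "norm (fst h) \<le> norm h" "norm (fst (snd h)) \<le> norm h" "norm (snd (snd h)) \<le> norm h"
          using norm_fst_le[of "fst h" "snd h"] norm_snd_le[of "snd h" "fst h"]
            norm_fst_le[of "fst (snd h)" "snd (snd h)"] norm_snd_le[of "snd (snd h)" "fst (snd h)"]
          by auto
        have "(\<Sum>i<n. a i x * fst h + b i x * fst (snd h) + c i x * snd (snd h)) - g' x h
          = ?A * fst h + ?B * fst (snd h) + ?C * snd (snd h)"
          by (simp add: g'_def sum.distrib sum_distrib_right[symmetric] left_diff_distrib)
        also have "norm \<dots> \<le> norm (?A * fst h) + norm (?B * fst (snd h)) + norm (?C * snd (snd h))"
          by (intro order_trans[OF norm_triangle_ineq] add_mono norm_triangle_ineq order_refl)
        also have "\<dots> \<le> (e / 3) * norm h + (e / 3) * norm h + (e / 3) * norm h"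
          unfolding norm_mult using elim x h e by (intro add_mono mult_mono) (auto simp: dist_norm intro: less_imp_le)
        finally show "norm ((\<Sum>i<n. a i x * fst h + b i x * fst (snd h) + c i x * snd (snd h)) - g' x h) \<le> e * norm h"
          by simp
      qed
    qed
  qed
  from has_derivative_series[OF S(2) has_derivative_at_withinI[OF der] this S(3) summable_sums[OF sf[OF S(3)]]]
  obtain g where "\<forall>x\<in>S. (\<lambda>n. f n x) sums g x \<and> (g has_derivative g' x) (at x within S)"
    by (rule exE)
  then have g: "\<And>x. x \<in> S \<Longrightarrow> (\<lambda>n. f n x) sums g x" "(g has_derivative g' p) (at p within S)"
    using S(3) by simp_all
  have "(g has_derivative g' p) (at p)" using g(2) by (simp only: at_within_open[OF S(3,1)])
  then have "cdiff g p" unfolding cdiff_def g'_def[abs_def] by blast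
  then show ?thesis
    using eventually_mono[OF eventually_nhds_in_open[OF S(1,3)] sums_unique[OF g(1)]]
    by (rule cdiff_transform)
qed

text \<open>The variable \<open>w\<close> stands for \<open>z ^ 2\<close>. The weight
  \<open>r\<close> is left open so that one convergence proof, for weights of size at most
  \<open>2 * (k + 1)\<close>, serves three different series.\<close>

definition wp_series :: "(nat \<Rightarrow> complex) \<Rightarrow> complex \<times> complex \<times> complex \<Rightarrow> complex" where
  "wp_series r = (\<lambda>(w, g2, g3). \<Sum>k. r k * wp_coeff g2 g3 k * w ^ k)"

text \<open>One majorant for the terms and all their partial derivatives: \<open>2 * (k + 1)\<close>
  bounds the weight, differentiating \<open>w ^ k\<close> brings another factor \<open>k\<close>,
  and the drop of the exponent to \<open>k - 1\<close> costs a factor \<open>2 * N\<close>. The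
  constant 8 is generous, and 3/4 is just a ratio between 1/2 and 1.\<close>

lemma summable_majorant: "summable (\<lambda>k. 8 * N * (real k + 1) ^ 2 * (1 / 2) ^ k)"
proof (rule summable_comparison_test_bigo)
  show "summable (\<lambda>k. norm ((3 / 4 :: real) ^ k))" by simp
  show "(\<lambda>k. 8 * N * (real k + 1) ^ 2 * (1 / 2) ^ k) \<in> O(\<lambda>k. (3 / 4) ^ k)" by real_asymp
qed

lemma wp_series_summable:
  assumes r: "\<And>k. norm (r k) \<le> 2 * (real k + 1)" and w: "norm w * (1 + norm g2 + norm g3) < 1 / 2"
  shows "summable (\<lambda>k. r k * wp_coeff g2 g3 k * w ^ k)"
proof (rule summable_comparison_test'[OF summable_majorant[of 1]])
  fix k
  let ?M = "1 + norm g2 + norm g3"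
  have M: "0 \<le> ?M" by (simp add: add_nonneg_nonneg)
  have "norm (r k * wp_coeff g2 g3 k * w ^ k) \<le> 2 * (real k + 1) * ?M ^ k * norm w ^ k"
    unfolding norm_mult norm_power using M
    by (intro mult_mono r wp_coeff_bound) auto
  also have "\<dots> = 2 * (real k + 1) * (norm w * ?M) ^ k" by (simp add: power_mult_distrib)
  also have "\<dots> \<le> 2 * (real k + 1) * (1 / 2) ^ k"
    by (intro mult_left_mono power_mono) (use w M in auto)
  also have "\<dots> \<le> 8 * 1 * (real k + 1) ^ 2 * (1 / 2) ^ k"
    by (intro mult_right_mono) (auto simp: power2_eq_square algebra_simps)
  finally show "norm (r k * wp_coeff g2 g3 k * w ^ k) \<le> 8 * 1 * (real k + 1) ^ 2 * (1 / 2) ^ k" .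
qed

lemma cdiff_wp_series:
  assumes r: "\<And>k. norm (r k) \<le> 2 * (real k + 1)" and w: "norm w * (1 + norm g2 + norm g3) < 1 / 2"
  shows "cdiff (wp_series r) (w, g2, g3)"
proof -
  \<comment> \<open>The convergence condition is open: it survives enlarging the norms of all three
    variables by a small \<open>e\<close>. The term \<open>2 * e\<close> accounts for
    \<open>g2\<close> and \<open>g3\<close> together.\<close>
  have "((\<lambda>e. (norm w + e) * (1 + norm g2 + norm g3 + 2 * e)) \<longlongrightarrow> (norm w + 0) * (1 + norm g2 + norm g3 + 2 * 0)) (at_right 0)"
    by (intro tendsto_intros)
  then have "\<forall>\<^sub>F e in at_right 0. (norm w + e) * (1 + norm g2 + norm g3 + 2 * e) < 1 / 2"
    using w by (intro order_tendstoD(2)[where a = "1/2"]) auto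
  from eventually_happens'[OF _ eventually_conj[OF eventually_at_right_less this]]
  have "\<exists>e>0. (norm w + e) * (1 + norm g2 + norm g3 + 2 * e) < 1 / 2"
    by (simp add: trivial_limit_at_right_real)
  then obtain e where e: "e > 0" "(norm w + e) * (1 + norm g2 + norm g3 + 2 * e) < 1 / 2" by blast
  define \<rho> N where "\<rho> = norm w + e" and "N = 1 + norm g2 + norm g3 + 2 * e"
  have pos: "0 < \<rho>" "1 \<le> N" and \<rho>N: "\<rho> * N < 1 / 2"
    using e by (auto simp: \<rho>_def N_def add_nonneg_pos)
  define S where "S = ball w e \<times> ball g2 e \<times> ball g3 e"
  have S: "open S" "convex S" "(w, g2, g3) \<in> S"
    using e by (auto simp: S_def intro!: open_Times convex_Times)
  have inS: "norm x \<le> \<rho>" "1 + norm y + norm z \<le> N" if "(x, y, z) \<in> S" for x y z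
    using that norm_triangle_sub[of x w] norm_triangle_sub[of y g2] norm_triangle_sub[of z g3]
    by (auto simp: S_def \<rho>_def N_def dist_norm norm_minus_commute)
  define Q where "Q k y z d2 d3 \<longleftrightarrow>
      ((\<lambda>(g2, g3). wp_coeff g2 g3 k) has_derivative (\<lambda>v. d2 * fst v + d3 * snd v)) (at (y, z))
      \<and> (\<forall>M. 1 + norm y + norm z \<le> M \<longrightarrow> norm d2 \<le> M ^ k \<and> norm d3 \<le> M ^ k)" for k y z d2 d3
  have "\<forall>k y z. \<exists>d2 d3. Q k y z d2 d3"
    using wp_coeff_derivative unfolding Q_def by blast
  then obtain d2 d3 where d23: "\<And>k y z. Q k y z (d2 k y z) (d3 k y z)"
    by metis
  note dd = d23[unfolded Q_def, THEN conjunct1] and dM = d23[unfolded Q_def, THEN conjunct2, rule_format]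
  define a b c where "a k = (\<lambda>(x, y, z). r k * (of_nat k * wp_coeff y z k * x ^ (k - 1)))"
    and "b k = (\<lambda>(x, y, z). r k * (x ^ k * d2 k y z))"
    and "c k = (\<lambda>(x, y, z). r k * (x ^ k * d3 k y z))" for k
  let ?f = "\<lambda>k (w, g2, g3). r k * wp_coeff g2 g3 k * w ^ k"
  have der: "(?f k has_derivative (\<lambda>v. a k p * fst v + b k p * fst (snd v) + c k p * snd (snd v))) (at p)" for k p
  proof -
    obtain x y z where p: "p = (x, y, z)" using prod_cases3 by blast
    have "((\<lambda>p. r k * (case snd p of (g2, g3) \<Rightarrow> wp_coeff g2 g3 k) * fst p ^ k) has_derivative
        (\<lambda>v. a k p * fst v + b k p * fst (snd v) + c k p * snd (snd v))) (at p)"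
      unfolding p a_def b_def c_def prod.case
      by (rule has_derivative_eq_rhs,
          rule has_derivative_mult[OF has_derivative_mult_right[OF has_derivative_compose[of snd]]
              has_derivative_power[OF has_derivative_fst[OF has_derivative_ident]]],
          rule has_derivative_snd[OF has_derivative_ident], unfold snd_conv, rule dd)
         (auto simp: fun_eq_iff algebra_simps)
    then show ?thesis by (simp add: case_prod_beta')
  qed
  let ?B = "\<lambda>k. 8 * N * (real k + 1) ^ 2 * (1 / 2) ^ k"
  have bd0: "2 * (real k + 1) * (N ^ k * \<rho> ^ k) \<le> ?B k" for k
  proof -
    have 1: "(\<rho> * N) ^ k \<le> (1 / 2) ^ k" using pos \<rho>N by (intro power_mono) auto
    have 2: "2 * (real k + 1) \<le> 8 * N * (real k + 1) ^ 2"
    proof -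
      have "2 * (real k + 1) \<le> 8 * 1 * (real k + 1) ^ 2" by (auto simp: power2_eq_square algebra_simps)
      also have "\<dots> \<le> 8 * N * (real k + 1) ^ 2" using pos by (intro mult_right_mono mult_left_mono) auto
      finally show ?thesis .
    qed
    have "2 * (real k + 1) * (\<rho> * N) ^ k \<le> ?B k"
      by (rule mult_mono[OF 2 1]) (use pos in auto)
    then show ?thesis by (simp add: power_mult_distrib mult_ac)
  qed
  have bdb: "norm (b k p) \<le> ?B k" "norm (c k p) \<le> ?B k" if "p \<in> S" for k p
  proof -
    obtain x y z where p: "p = (x, y, z)" using prod_cases3 by blast
    note i = inS[OF that[unfolded p]]
    have "norm (r k * (x ^ k * d)) \<le> ?B k" if "norm d \<le> N ^ k" for d
    proof -
      have "norm (r k * (x ^ k * d)) \<le> 2 * (real k + 1) * (\<rho> ^ k * N ^ k)"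
        unfolding norm_mult norm_power using pos i that by (intro mult_mono r power_mono) auto
      then show ?thesis using bd0[of k] by (simp add: mult.commute)
    qed
    then show "norm (b k p) \<le> ?B k" "norm (c k p) \<le> ?B k"
      using dM[OF i(2)] by (auto simp: b_def c_def p)
  qed
  \<comment> \<open>Here the powers of \<open>\<rho>\<close> and \<open>N\<close> are out of step by
    one, because \<open>w ^ k\<close> has been differentiated:
    \<open>N ^ k * \<rho> ^ j = N * (\<rho> * N) ^ j\<close> for \<open>k = Suc j\<close>.\<close>
  have bda: "norm (a k p) \<le> ?B k" if "p \<in> S" for k p
  proof (cases k)
    case 0
    then show ?thesis using pos by (auto simp: a_def case_prod_beta)
  next
    case (Suc j)
    obtain x y z where p: "p = (x, y, z)" using prod_cases3 by blast
    note i = inS[OF that[unfolded p]]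
    have "norm (a k p) \<le> 2 * (real k + 1) * (real k * N ^ k * \<rho> ^ j)"
    proof -
      have j: "k - 1 = j" by (simp add: Suc)
      have "norm (r k) * (real k * norm (wp_coeff y z k) * norm x ^ j) \<le> 2 * (real k + 1) * (real k * N ^ k * \<rho> ^ j)"
        using pos i by (intro mult_mono r power_mono wp_coeff_bound) auto
      then show ?thesis
        unfolding a_def p prod.case norm_mult norm_power norm_of_nat j .
    qed
    also have "\<dots> = 2 * (real k + 1) * real k * N * (\<rho> * N) ^ j"
      by (simp add: Suc power_mult_distrib)
    also have "\<dots> \<le> 2 * (real k + 1) * real k * N * (1 / 2) ^ j"
      using pos \<rho>N by (intro mult_left_mono power_mono) auto
    also have "\<dots> = 4 * (real k + 1) * real k * N * (1 / 2) ^ k"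
      by (simp add: Suc)
    also have "\<dots> \<le> ?B k"
      using pos by (intro mult_right_mono) (auto simp: power2_eq_square algebra_simps)
    finally show ?thesis .
  qed
  have sum: "summable (\<lambda>k. ?f k p)" if "p \<in> S" for p
  proof -
    obtain x y z where p: "p = (x, y, z)" using prod_cases3 by blast
    note i = inS[OF that[unfolded p]]
    have "norm x * (1 + norm y + norm z) \<le> \<rho> * N"
      using i pos by (intro mult_mono) auto
    then show ?thesis using wp_series_summable[OF r, of x y z] \<rho>N by (simp add: p)
  qed
  have "cdiff (\<lambda>p. \<Sum>k. ?f k p) (w, g2, g3)"
    by (rule cdiff_series[where B = ?B and a = a and b = b and c = c, OF S der bda bdb summable_majorant sum])
  then show ?thesis by (simp add: wp_series_def case_prod_beta')
qed

section \<open>The differential equation and its duplication law\<close>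

text \<open>Here \<open>\<phi> = f\<^sup>2 \<wp>\<close> and \<open>q = f\<^sup>3 \<wp>'\<close> with \<open>\<wp> = - (log f)''\<close>, so the last equation is
  \<open>\<wp>'\<^sup>2 = 4 \<wp>\<^sup>3 - g2 \<wp> - g3\<close> cleared of denominators.\<close>

definition sigma_triple ::
  "complex \<Rightarrow> complex \<Rightarrow> complex set \<Rightarrow> (complex \<Rightarrow> complex) \<Rightarrow> (complex \<Rightarrow> complex) \<Rightarrow> (complex \<Rightarrow> complex) \<Rightarrow> bool" where
  "sigma_triple g2 g3 S f \<phi> q \<longleftrightarrow> f holomorphic_on S \<and> \<phi> holomorphic_on S \<and> q holomorphic_on S \<and>
     (\<forall>z\<in>S. \<phi> z = (deriv f z)\<^sup>2 - f z * deriv (deriv f) z \<and>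
        q z = f z * deriv \<phi> z - 2 * deriv f z * \<phi> z \<and>
        (q z)\<^sup>2 = 4 * \<phi> z ^ 3 - g2 * \<phi> z * f z ^ 4 - g3 * f z ^ 6)"

lemma sigma_tripleI:
  assumes "open S"
    and "\<And>z. z \<in> S \<Longrightarrow> (f has_field_derivative f1 z) (at z)"
    and "\<And>z. z \<in> S \<Longrightarrow> (f1 has_field_derivative f2 z) (at z)"
    and "\<And>z. z \<in> S \<Longrightarrow> (\<phi> has_field_derivative \<phi>1 z) (at z)"
    and "q holomorphic_on S"
    and "\<And>z. z \<in> S \<Longrightarrow> \<phi> z = (f1 z)\<^sup>2 - f z * f2 z"
    and "\<And>z. z \<in> S \<Longrightarrow> q z = f z * \<phi>1 z - 2 * f1 z * \<phi> z"
    and "\<And>z. z \<in> S \<Longrightarrow> (q z)\<^sup>2 = 4 * \<phi> z ^ 3 - g2 * \<phi> z * f z ^ 4 - g3 * f z ^ 6"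
  shows "sigma_triple g2 g3 S f \<phi> q"
proof -
  have d: "deriv f z = f1 z" "deriv \<phi> z = \<phi>1 z" if "z \<in> S" for z
    using assms that by (auto intro: DERIV_imp_deriv)
  have "deriv (deriv f) z = f2 z" if "z \<in> S" for z
    by (rule DERIV_imp_deriv, rule has_field_derivative_transform_within_open[OF assms(3)])
       (use assms d that in auto)
  moreover have "f holomorphic_on S" "\<phi> holomorphic_on S"
    using assms(1-4) by (auto simp: holomorphic_on_open)
  ultimately show ?thesis
    using assms(5-8) d unfolding sigma_triple_def by simp
qed

lemma sigma_triple_derivs:
  assumes "sigma_triple g2 g3 S f \<phi> q" "open S" "z \<in> S"
  shows "(f has_field_derivative deriv f z) (at z)"
    "(deriv f has_field_derivative deriv (deriv f) z) (at z)"
    "(\<phi> has_field_derivative deriv \<phi> z) (at z)"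
    "(q has_field_derivative deriv q z) (at z)"
  using assms unfolding sigma_triple_def
  by (auto intro!: holomorphic_derivI[of _ S] holomorphic_deriv)

lemma sigma_triple_eqs:
  assumes "sigma_triple g2 g3 S f \<phi> q" "z \<in> S"
  shows "f z * deriv (deriv f) z = (deriv f z)\<^sup>2 - \<phi> z"
    "f z * deriv \<phi> z = q z + 2 * deriv f z * \<phi> z"
    "(q z)\<^sup>2 = 4 * \<phi> z ^ 3 - g2 * \<phi> z * f z ^ 4 - g3 * f z ^ 6"
  using assms unfolding sigma_triple_def by auto

lemma sigma_triple_subset:
  "sigma_triple g2 g3 S f \<phi> q \<Longrightarrow> T \<subseteq> S \<Longrightarrow> sigma_triple g2 g3 T f \<phi> q"
  unfolding sigma_triple_def by (auto intro: holomorphic_on_subset)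

text \<open>Holomorphic functions on a connected open set form an integral domain: \<open>g\<close>
  vanishes on the nonempty open set where \<open>f\<close> does not, hence everywhere. This clears
  factors that have zeros.\<close>

lemma holomorphic_mult_eq_0:
  assumes "f holomorphic_on S" "g holomorphic_on S" "open S" "connected S"
    and "\<And>z. z \<in> S \<Longrightarrow> f z * g z = 0" and "a \<in> S" "f a \<noteq> 0" and "z \<in> S"
  shows "g z = 0"
proof -
  let ?U = "{x \<in> S. f x \<noteq> 0}"
  have "continuous_on S f" using assms(1) by (rule holomorphic_on_imp_continuous_on)
  from continuous_open_preimage[OF this assms(3), of "- {0}"]
  have "open (S \<inter> f -` (- {0}))" by (simp add: open_Compl)
  moreover have "S \<inter> f -` (- {0}) = ?U" by blast
  ultimately have U: "open ?U" by simp
  have ne: "?U \<noteq> {}" and sub: "?U \<subseteq> S" using assms(6,7) by blast+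
  have "g x = 0" if "x \<in> ?U" for x using assms(5)[of x] that by simp
  from analytic_continuation_open[OF U assms(3) ne assms(4) sub assms(2) _ this assms(8)]
  show ?thesis by simp
qed

text \<open>This is \<open>\<wp>'' = 6 \<wp>\<^sup>2 - g2 / 2\<close> cleared of denominators.
  Differentiating the cubic yields it only up to a factor \<open>2 * q\<close>; the assumption that
  \<open>q\<close> is somewhere nonzero allows its cancellation and excludes constant \<wp>, for
  which the second-order equation can fail.\<close>

lemma sigma_triple_deriv_q:
  assumes T: "sigma_triple g2 g3 S f \<phi> q" and S: "open S" "connected S"
    and a: "a \<in> S" "q a \<noteq> 0" and z: "z \<in> S"
  shows "f z * deriv q z = 3 * deriv f z * q z + 6 * \<phi> z ^ 2 - g2 / 2 * f z ^ 4"
proof -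
  have hol: "f holomorphic_on S" "\<phi> holomorphic_on S" "q holomorphic_on S"
    using T unfolding sigma_triple_def by auto
  have "f z * deriv q z - (3 * deriv f z * q z + 6 * \<phi> z ^ 2 - g2 / 2 * f z ^ 4) = 0"
  proof (rule holomorphic_mult_eq_0[OF hol(3) _ S _ a z])
    show "(\<lambda>z. f z * deriv q z - (3 * deriv f z * q z + 6 * \<phi> z ^ 2 - g2 / 2 * f z ^ 4)) holomorphic_on S"
      using hol S by (intro holomorphic_intros holomorphic_deriv) auto
    fix z assume z: "z \<in> S"
    note d = sigma_triple_derivs[OF T S(1) z]
    note e = sigma_triple_eqs[OF T z]
    have "((\<lambda>z. (q z)\<^sup>2 - (4 * \<phi> z ^ 3 - g2 * \<phi> z * f z ^ 4 - g3 * f z ^ 6)) has_field_derivative 0) (at z)"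
      by (rule has_field_derivative_transform_within_open[where f = "\<lambda>_. 0" and S = S])
         (use S z sigma_triple_eqs(3)[OF T] in auto)
    moreover have "((\<lambda>z. (q z)\<^sup>2 - (4 * \<phi> z ^ 3 - g2 * \<phi> z * f z ^ 4 - g3 * f z ^ 6)) has_field_derivative
       (2 * q z * deriv q z - (12 * \<phi> z ^ 2 * deriv \<phi> z - g2 * (deriv \<phi> z * f z ^ 4 + 4 * \<phi> z * f z ^ 3 * deriv f z)
          - 6 * g3 * f z ^ 5 * deriv f z))) (at z)"
      by (rule derivative_eq_intros d refl | simp add: algebra_simps)+
    ultimately have "2 * q z * deriv q z = 12 * \<phi> z ^ 2 * deriv \<phi> z
        - g2 * (deriv \<phi> z * f z ^ 4 + 4 * \<phi> z * f z ^ 3 * deriv f z) - 6 * g3 * f z ^ 5 * deriv f z"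
      using DERIV_unique by fastforce
    with e show "q z * (f z * deriv q z - (3 * deriv f z * q z + 6 * \<phi> z ^ 2 - g2 / 2 * f z ^ 4)) = 0"
      by algebra
  qed
  then show ?thesis by simp
qed

text \<open>The duplication formula \<open>\<sigma>(2 z) = - \<sigma>(z)\<^sup>4 \<wp>'(z)\<close> and its consequences for \<open>\<phi>\<close> and \<open>q\<close>;
  \<open>H\<close> is \<open>\<sigma>\<^sup>4 \<wp>''\<close>.\<close>

definition sigma_dup :: "complex \<Rightarrow> complex \<times> complex \<times> complex \<Rightarrow> complex \<times> complex \<times> complex" where
  "sigma_dup g2 = (\<lambda>(s, p, q). let H = 6 * p ^ 2 - g2 / 2 * s ^ 4; \<Phi> = H ^ 2 / 4 - 2 * p * q ^ 2
     in (- s * q, \<Phi>, H * \<Phi> - p * H * q ^ 2 + q ^ 4))"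

text \<open>The products \<open>g2 * s ^ 4\<close> and \<open>g3 * s ^ 6\<close> are polynomials in
  \<open>p\<close>, \<open>H\<close> and \<open>y = q ^ 2\<close>. After this elimination, only a
  polynomial identity remains, which holds once \<open>H ^ 2\<close> is replaced by
  \<open>4 * p' + 8 * p * y\<close>.\<close>

lemma sigma_dup_cubic:
  fixes s p q g2 g3 :: complex
  assumes "q ^ 2 = 4 * p ^ 3 - g2 * p * s ^ 4 - g3 * s ^ 6" "(s', p', q') = sigma_dup g2 (s, p, q)"
  shows "q' ^ 2 = 4 * p' ^ 3 - g2 * p' * s' ^ 4 - g3 * s' ^ 6"
proof -
  define H where "H = 6 * p ^ 2 - g2 / 2 * s ^ 4"
  define y where "y = q ^ 2"
  have G2: "g2 * s ^ 4 = 12 * p ^ 2 - 2 * H" by (simp add: H_def)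
  have G3: "g3 * s ^ 6 = 2 * p * H - 8 * p ^ 3 - y"
    using assms(1) G2 unfolding y_def by algebra
  have p': "p' = H ^ 2 / 4 - 2 * p * y" and q': "q' = H * p' - p * H * y + y ^ 2" and s': "s' = - s * q"
    using assms(2) by (simp_all add: sigma_dup_def Let_def H_def y_def power2_eq_square numeral_eq_Suc)
  have 1: "g2 * p' * s' ^ 4 = p' * y ^ 2 * (12 * p ^ 2 - 2 * H)"
    unfolding s' G2[symmetric] y_def by algebra
  have 2: "g3 * s' ^ 6 = y ^ 3 * (2 * p * H - 8 * p ^ 3 - y)"
    using G3 unfolding s' y_def by algebra
  have "q' ^ 2 = H ^ 2 * (p' - p * y) ^ 2 + 2 * H * (p' - p * y) * y ^ 2 + y ^ 4"
    unfolding q' by algebra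
  also have "H ^ 2 = 4 * p' + 8 * p * y" by (simp add: p')
  finally show ?thesis unfolding 1 2 by algebra
qed

text \<open>The new first component \<open>- f * q\<close> carries a factor \<open>f\<close>, so in
  the equations to be proved the higher derivatives occur multiplied by \<open>f\<close>. The
  products of \<open>f\<close> with \<open>deriv (deriv f)\<close>, \<open>deriv \<phi>\<close> and
  \<open>deriv q\<close> are polynomials in \<open>f\<close>, \<open>deriv f\<close>,
  \<open>\<phi>\<close>, \<open>q\<close>, which reduces the claim to algebra.\<close>

lemma sigma_triple_dup:
  assumes T: "sigma_triple g2 g3 S f \<phi> q" and S: "open S" "connected S"
    and a: "a \<in> S" "q a \<noteq> 0"
    and D: "\<And>z. (f' z, \<phi>' z, q' z) = sigma_dup g2 (f (z / 2), \<phi> (z / 2), q (z / 2))"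
  shows "sigma_triple g2 g3 {z. z / 2 \<in> S} f' \<phi>' q'"
proof -
  define H where "H z = 6 * \<phi> z ^ 2 - g2 / 2 * f z ^ 4" for z
  define \<Phi> where "\<Phi> z = H z ^ 2 / 4 - 2 * \<phi> z * q z ^ 2" for z
  have f': "f' = (\<lambda>z. - f (z / 2) * q (z / 2))" and \<phi>': "\<phi>' = (\<lambda>z. \<Phi> (z / 2))"
    and q': "q' = (\<lambda>z. H (z / 2) * \<Phi> (z / 2) - \<phi> (z / 2) * H (z / 2) * q (z / 2) ^ 2 + q (z / 2) ^ 4)"
    using D by (auto simp: sigma_dup_def Let_def H_def \<Phi>_def)
  define H1 where "H1 z = 12 * \<phi> z * deriv \<phi> z - 2 * g2 * f z ^ 3 * deriv f z" for z
  \<comment> \<open>Values at \<open>z / 2\<close> of the first and second derivative of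
    \<open>f'\<close>; the halves come from the inner function \<open>z / 2\<close>. In
    \<open>f1\<close> the product \<open>f * deriv q\<close> has been replaced by
    \<open>3 * deriv f * q + H\<close>.\<close>
  define f1 where "f1 z = - (4 * deriv f z * q z + H z) / 2" for z
  define f2 where "f2 z = - (4 * (deriv (deriv f) z * q z + deriv f z * deriv q z) + H1 z) / 4" for z
  define \<Phi>1 where "\<Phi>1 z = (H z * H1 z / 2 - 2 * deriv \<phi> z * q z ^ 2 - 4 * \<phi> z * q z * deriv q z) / 2" for z
  have op: "open {z. z / 2 \<in> S}"
    using open_vimage[OF S(1), of "\<lambda>z. z / 2"] by (simp add: vimage_def continuous_on_divide)
  have half: "((\<lambda>z. g (z / 2)) has_field_derivative g') (at z)"
    if "(g has_field_derivative 2 * g') (at (z / 2))" for g :: "complex \<Rightarrow> complex" and g' z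
  proof -
    have "((\<lambda>z. z / 2 :: complex) has_field_derivative 1 / 2) (at z)"
      by (auto intro!: derivative_eq_intros)
    from DERIV_chain2[where f = g, OF that this] show ?thesis by simp
  qed
  have hol: "f holomorphic_on S" "\<phi> holomorphic_on S" "q holomorphic_on S"
    using T unfolding sigma_triple_def by auto
  show ?thesis
  proof (rule sigma_tripleI[OF op, where ?f1.0 = "\<lambda>z. f1 (z / 2)" and ?f2.0 = "\<lambda>z. f2 (z / 2)" and ?\<phi>1.0 = "\<lambda>z. \<Phi>1 (z / 2)"])
    have "(\<lambda>z. H z * \<Phi> z - \<phi> z * H z * q z ^ 2 + q z ^ 4) holomorphic_on S"
      unfolding H_def \<Phi>_def using hol by (intro holomorphic_intros) auto
    moreover have "(\<lambda>z. z / 2) holomorphic_on {z. z / 2 \<in> S}"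
      by (intro holomorphic_intros) auto
    ultimately have "((\<lambda>z. H z * \<Phi> z - \<phi> z * H z * q z ^ 2 + q z ^ 4) \<circ> (\<lambda>z. z / 2)) holomorphic_on {z. z / 2 \<in> S}"
      by (intro holomorphic_on_compose_gen) auto
    then show "q' holomorphic_on {z. z / 2 \<in> S}"
      unfolding q' o_def .
  next
    fix z assume "z \<in> {z. z / 2 \<in> S}"
    then have z: "z / 2 \<in> S" by simp
    define w where "w = z / 2"
    note d = sigma_triple_derivs[OF T S(1) z, folded w_def]
    note e = sigma_triple_eqs[OF T z, folded w_def] sigma_triple_deriv_q[OF T S a z, folded w_def]
    have dH: "(H has_field_derivative H1 w) (at w)"
      unfolding H_def[abs_def] H1_def by (rule derivative_eq_intros d refl | simp add: algebra_simps)+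
    have fH1: "f w * H1 w = 12 * \<phi> w * q w + 4 * deriv f w * H w"
      using e(2) unfolding H1_def H_def by algebra
    have hq: "f w * deriv q w = 3 * deriv f w * q w + H w"
      using e(4) unfolding H_def by algebra
    show "(f' has_field_derivative f1 (z / 2)) (at z)"
    proof -
      have "((\<lambda>z. - f z * q z) has_field_derivative - (deriv f w * q w + f w * deriv q w)) (at w)"
        by (rule derivative_eq_intros d refl | simp add: algebra_simps)+
      also have "- (deriv f w * q w + f w * deriv q w) = 2 * f1 (z / 2)"
        unfolding hq f1_def w_def[symmetric] by (simp add: algebra_simps)
      finally show ?thesis unfolding f' w_def by (rule half)
    qed
    show "((\<lambda>z. f1 (z / 2)) has_field_derivative f2 (z / 2)) (at z)"
      by (rule half, unfold f1_def[abs_def], fold w_def)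
         (rule derivative_eq_intros d dH refl | simp add: f2_def algebra_simps)+
    show "(\<phi>' has_field_derivative \<Phi>1 (z / 2)) (at z)"
      unfolding \<phi>' by (rule half, unfold \<Phi>_def[abs_def], fold w_def)
         (rule derivative_eq_intros d dH refl | simp add: \<Phi>1_def algebra_simps)+
    have ff2: "4 * (f w * f2 w) = - (16 * deriv f w ^ 2 * q w + 8 * \<phi> w * q w + 8 * deriv f w * H w)"
      using e(1) hq fH1 unfolding f2_def by algebra
    have f\<Phi>1: "f w * \<Phi>1 w = 4 * deriv f w * \<Phi> w + q w * (\<phi> w * H w - q w ^ 2)"
    proof -
      have "f w * \<Phi>1 w = (H w * (f w * H1 w) / 2 - 2 * (f w * deriv \<phi> w) * q w ^ 2
          - 4 * \<phi> w * q w * (f w * deriv q w)) / 2"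
        by (simp add: \<Phi>1_def algebra_simps)
      also have "\<dots> = 4 * deriv f w * \<Phi> w + q w * (\<phi> w * H w - q w ^ 2)"
        unfolding e(2) hq fH1 \<Phi>_def by (simp add: field_simps power2_eq_square)
      finally show ?thesis .
    qed
    show "\<phi>' z = (f1 (z / 2))\<^sup>2 - f' z * f2 (z / 2)"
      using ff2 unfolding \<phi>' f' w_def[symmetric] \<Phi>_def f1_def by algebra
    show "q' z = f' z * \<Phi>1 (z / 2) - 2 * f1 (z / 2) * \<phi>' z"
      using f\<Phi>1 unfolding \<phi>' f' q' w_def[symmetric] f1_def by algebra
    show "(q' z)\<^sup>2 = 4 * \<phi>' z ^ 3 - g2 * \<phi>' z * f' z ^ 4 - g3 * f' z ^ 6"
      using sigma_dup_cubic[OF sigma_triple_eqs(3)[OF T z] D] .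
  qed
qed

section \<open>Uniqueness of odd normalised solutions, and gluing of solutions\<close>

text \<open>The equation is the one for \<open>h(z) = z\<^sup>2 \<wp>(z)\<close>. If two solutions differed by \<open>z^n g(z)\<close> with
  \<open>g 0 \<noteq> 0\<close>, comparing lowest-order terms would give \<open>- 4 (n - 2) = 12\<close>, that is \<open>n = - 1\<close>.\<close>

lemma wp_ode_unique:
  fixes h k :: "complex \<Rightarrow> complex"
  assumes r: "r > 0" and hol: "h holomorphic_on ball 0 r" "k holomorphic_on ball 0 r"
    and 0: "h 0 = 1" "k 0 = 1"
    and ode: "\<And>z. z \<in> ball 0 r \<Longrightarrow> (z * deriv h z - 2 * h z)\<^sup>2 = 4 * h z ^ 3 - g2 * h z * z ^ 4 - g3 * z ^ 6"
      "\<And>z. z \<in> ball 0 r \<Longrightarrow> (z * deriv k z - 2 * k z)\<^sup>2 = 4 * k z ^ 3 - g2 * k z * z ^ 4 - g3 * z ^ 6"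
    and z: "z \<in> ball 0 r"
  shows "h z = k z"
proof (rule ccontr)
  assume ne: "h z \<noteq> k z"
  define d where "d z = h z - k z" for z
  have hold: "d holomorphic_on ball 0 r" unfolding d_def using hol by (intro holomorphic_intros)
  have d0: "d 0 = 0" by (simp add: d_def 0)
  have nc: "\<not> d constant_on ball 0 r"
  proof
    assume "d constant_on ball 0 r"
    then obtain c where c: "\<And>z. z \<in> ball 0 r \<Longrightarrow> d z = c" unfolding constant_on_def by blast
    have "d z = d 0" using c[of z] c[of 0] z r by simp
    with d0 ne show False by (simp add: d_def)
  qed
  have c0: "(0::complex) \<in> ball 0 r" using r by simp
  obtain g \<rho> n where n: "0 < n" "0 < \<rho>" "ball (0 :: complex) \<rho> \<subseteq> ball 0 r" "g holomorphic_on ball 0 \<rho>"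
      and fac: "\<And>w. w \<in> ball 0 \<rho> \<Longrightarrow> d w = (w - 0) ^ n * g w"
      and gnz: "\<And>w. w \<in> ball 0 \<rho> \<Longrightarrow> g w \<noteq> 0"
    by (rule holomorphic_factor_zero_nonconstant[OF hold open_ball connected_ball c0 d0 nc]) (rule that)
  \<comment> \<open>The difference of the two equations divided by \<open>w ^ n\<close>, using
    \<open>h - k = w ^ n * g\<close> and \<open>w * (h' - k') = w ^ n * (n * g + w * g')\<close>.
    Its value at 0 is \<open>- 4 * (n - 2) * g 0 - 12 * g 0\<close>.\<close>
  let ?L = "\<lambda>w. ((of_nat n - 2) * g w + w * deriv g w) * (w * (deriv h w + deriv k w) - 2 * (h w + k w))
      - g w * (4 * (h w ^ 2 + h w * k w + k w ^ 2) - g2 * w ^ 4)"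
  have hol': "h holomorphic_on ball 0 \<rho>" "k holomorphic_on ball 0 \<rho>"
    using hol n(3) by (auto intro: holomorphic_on_subset)
  have "?L 0 = 0"
  proof (rule holomorphic_mult_eq_0[where f = "\<lambda>w. w ^ n" and g = ?L and z = 0 and S = "ball 0 \<rho>" and a = "of_real (\<rho> / 2)"])
    show "?L holomorphic_on ball 0 \<rho>"
      using n(4) hol' by (intro holomorphic_intros holomorphic_deriv) auto
    fix w :: complex assume w: "w \<in> ball 0 \<rho>"
    then have w': "w \<in> ball 0 r" using n(3) by blast
    have dh: "(h has_field_derivative deriv h w) (at w)" "(k has_field_derivative deriv k w) (at w)"
      "(g has_field_derivative deriv g w) (at w)"
      using hol n w w' by (auto intro!: holomorphic_derivI[of _ "ball 0 r"] holomorphic_derivI[of _ "ball 0 \<rho>"])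
    have 1: "(d has_field_derivative deriv h w - deriv k w) (at w)"
      unfolding d_def by (rule derivative_intros dh)+
    have "((\<lambda>w. w ^ n * g w) has_field_derivative of_nat n * w ^ (n - 1) * g w + w ^ n * deriv g w) (at w)"
      by (auto intro!: derivative_eq_intros dh simp: algebra_simps)
    then have "(d has_field_derivative of_nat n * w ^ (n - 1) * g w + w ^ n * deriv g w) (at w)"
      by (rule has_field_derivative_transform_within_open[of _ _ _ "ball 0 \<rho>"]) (use w fac in auto)
    with 1 have "deriv h w - deriv k w = of_nat n * w ^ (n - 1) * g w + w ^ n * deriv g w"
      by (rule DERIV_unique)
    then have "w * (deriv h w - deriv k w) = of_nat n * (w * w ^ (n - 1)) * g w + w ^ n * (w * deriv g w)"
      by (simp add: algebra_simps)
    also have "w * w ^ (n - 1) = w ^ n" using n(1) by (cases n) auto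
    finally have wd: "w * (deriv h w - deriv k w) = w ^ n * (of_nat n * g w + w * deriv g w)"
      by (simp add: algebra_simps)
    have hk: "h w - k w = w ^ n * g w" using fac[OF w] by (simp add: d_def)
    have hk': "h w = k w + w ^ n * g w" using hk by (simp add: algebra_simps)
    have "w ^ n * ?L w = (w * (deriv h w - deriv k w) - 2 * (h w - k w)) * (w * (deriv h w + deriv k w) - 2 * (h w + k w))
      - (h w - k w) * (4 * (h w ^ 2 + h w * k w + k w ^ 2) - g2 * w ^ 4)"
      unfolding wd hk by (simp add: algebra_simps)
    also have "\<dots> = ((w * deriv h w - 2 * h w)\<^sup>2 - (4 * h w ^ 3 - g2 * h w * w ^ 4))
       - ((w * deriv k w - 2 * k w)\<^sup>2 - (4 * k w ^ 3 - g2 * k w * w ^ 4))"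
      by algebra
    also have "\<dots> = 0" unfolding ode(1)[OF w'] ode(2)[OF w'] by simp
    finally show "w ^ n * ?L w = 0" .
  qed (use n in \<open>auto intro!: holomorphic_intros\<close>)
  note L0 = this
  have "?L 0 = - 4 * (of_nat (Suc n) * g 0)" by (simp add: 0 algebra_simps)
  from trans[OF this[symmetric] L0] have "of_nat (Suc n) * g 0 = 0"
    unfolding mult_eq_0_iff[of "- 4"] by simp
  then have "g 0 = 0" unfolding mult_eq_0_iff of_nat_eq_0_iff by simp
  with gnz[of 0] n(2) show False by simp
qed

lemma sigma_triple_at_0:
  assumes "sigma_triple g2 g3 S f \<phi> q" "0 \<in> S" "f 0 = 0" "deriv f 0 = 1"
  shows "\<phi> 0 = 1" "q 0 = -2"
  using assms unfolding sigma_triple_def by auto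

text \<open>Both solutions have the same \<wp> near 0 by \<open>wp_ode_unique\<close>, so their
  logarithmic derivatives differ by a constant. Oddness makes this constant 0, hence the quotient of
  the solutions is constant, and the normalisation at 0 makes it 1. Analytic continuation reaches
  the whole ball.\<close>

lemma sigma_triple_unique:
  assumes T: "sigma_triple g2 g3 (ball 0 r) f \<phi> q" "sigma_triple g2 g3 (ball 0 r) f' \<phi>' q'"
    and r: "r > 0" and 1: "deriv f 0 = 1" "deriv f' 0 = 1"
    and odd: "\<And>z. z \<in> ball 0 r \<Longrightarrow> f (- z) = - f z" "\<And>z. z \<in> ball 0 r \<Longrightarrow> f' (- z) = - f' z"
    and z: "z \<in> ball 0 r"
  shows "f z = f' z"
proof -
  have f0: "f 0 = 0" "f' 0 = 0" using odd[of 0] r by auto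
  \<comment> \<open>The function \<open>g z / z\<close> with its singularity at 0 removed, in the
    shape of \<open>pole_lemma\<close>. Then \<open>\<phi> / (quo f)\<^sup>2\<close> is
    \<open>z\<^sup>2 \<wp>(z)\<close>, holomorphic at 0 with value 1.\<close>
  define quo where "quo g = (\<lambda>z. if z = 0 then deriv g 0 else (g z - g 0) / (z - 0))" for g :: "complex \<Rightarrow> complex"
  have hol: "f holomorphic_on ball 0 r" "f' holomorphic_on ball 0 r"
    "\<phi> holomorphic_on ball 0 r" "\<phi>' holomorphic_on ball 0 r"
    using T unfolding sigma_triple_def by auto
  have holq: "quo f holomorphic_on ball 0 r" "quo f' holomorphic_on ball 0 r"
    unfolding quo_def using hol r by (auto intro!: pole_lemma)
  have "isCont (quo f) 0" "isCont (quo f') 0"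
    using holq r by (auto intro!: continuous_on_interior[of "ball 0 r"] holomorphic_on_imp_continuous_on)
  then have "(quo f \<longlongrightarrow> quo f 0) (nhds 0)" "(quo f' \<longlongrightarrow> quo f' 0) (nhds 0)"
    unfolding isCont_def tendsto_at_iff_tendsto_nhds .
  moreover have "quo f 0 \<noteq> 0" "quo f' 0 \<noteq> 0" using 1 by (auto simp: quo_def)
  ultimately have "\<forall>\<^sub>F z in nhds 0. quo f z \<noteq> 0" "\<forall>\<^sub>F z in nhds 0. quo f' z \<noteq> 0"
    by (auto intro: tendsto_imp_eventually_ne)
  then have "\<forall>\<^sub>F z in nhds 0. quo f z \<noteq> 0 \<and> quo f' z \<noteq> 0 \<and> z \<in> ball 0 r"
    using r by (intro eventually_conj eventually_nhds_in_open) auto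
  then obtain e where e: "e > 0" and ball_e: "\<And>z. z \<in> ball 0 e \<Longrightarrow> quo f z \<noteq> 0 \<and> quo f' z \<noteq> 0 \<and> z \<in> ball 0 r"
    unfolding eventually_nhds_metric by (auto simp: dist_commute)
  have sub: "ball (0 :: complex) e \<subseteq> ball 0 r" using ball_e by blast
  have ode: "((\<lambda>z. g z / quo s z ^ 2) holomorphic_on ball 0 e) \<and>
      (\<forall>z\<in>ball 0 e. (z * deriv (\<lambda>z. g z / quo s z ^ 2) z - 2 * (g z / quo s z ^ 2))\<^sup>2
        = 4 * (g z / quo s z ^ 2) ^ 3 - g2 * (g z / quo s z ^ 2) * z ^ 4 - g3 * z ^ 6)"
    if t: "sigma_triple g2 g3 (ball 0 r) s g p" and s: "s 0 = 0" "deriv s 0 = 1"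
      and qh: "quo s holomorphic_on ball 0 r" and nz: "\<And>z. z \<in> ball 0 e \<Longrightarrow> quo s z \<noteq> 0" for s g p
  proof (intro conjI ballI)
    have "g holomorphic_on ball 0 e" "quo s holomorphic_on ball 0 e"
      using t qh sub unfolding sigma_triple_def by (auto intro: holomorphic_on_subset)
    then show "(\<lambda>z. g z / quo s z ^ 2) holomorphic_on ball 0 e"
      using nz by (auto intro!: holomorphic_intros)
    fix z :: complex assume z: "z \<in> ball 0 e"
    show "(z * deriv (\<lambda>z. g z / quo s z ^ 2) z - 2 * (g z / quo s z ^ 2))\<^sup>2
        = 4 * (g z / quo s z ^ 2) ^ 3 - g2 * (g z / quo s z ^ 2) * z ^ 4 - g3 * z ^ 6"
    proof (cases "z = 0")
      case True
      then show ?thesis using sigma_triple_at_0(1)[OF t _ s] r s by (simp add: quo_def)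
    next
      case False
      have z': "z \<in> ball 0 r" using z sub by blast
      note d = sigma_triple_derivs[OF t open_ball z']
      have sz: "s z \<noteq> 0" using nz[OF z] False s by (simp add: quo_def)
      have "((\<lambda>z. z ^ 2 * g z / s z ^ 2) has_field_derivative
          ((2 * z * g z + z ^ 2 * deriv g z) * s z ^ 2 - z ^ 2 * g z * (2 * s z * deriv s z)) / (s z ^ 2 * s z ^ 2)) (at z)"
        by (rule derivative_eq_intros d refl | use sz in \<open>simp add: algebra_simps\<close>)+
      then have "((\<lambda>z. g z / quo s z ^ 2) has_field_derivative
          ((2 * z * g z + z ^ 2 * deriv g z) * s z ^ 2 - z ^ 2 * g z * (2 * s z * deriv s z)) / (s z ^ 2 * s z ^ 2)) (at z)"
        by (rule has_field_derivative_transform_within_open[of _ _ _ "- {0}"])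
           (use False s in \<open>auto simp: quo_def field_simps\<close>)
      then have D: "deriv (\<lambda>z. g z / quo s z ^ 2) z =
          ((2 * z * g z + z ^ 2 * deriv g z) * s z ^ 2 - z ^ 2 * g z * (2 * s z * deriv s z)) / (s z ^ 2 * s z ^ 2)"
        by (rule DERIV_imp_deriv)
      have q: "g z / quo s z ^ 2 = z ^ 2 * g z / s z ^ 2"
        using False s by (simp add: quo_def field_simps)
      have p: "p z = s z * deriv g z - 2 * deriv s z * g z" and cub: "p z ^ 2 = 4 * g z ^ 3 - g2 * g z * s z ^ 4 - g3 * s z ^ 6"
        using sigma_triple_eqs(2,3)[OF t z'] by simp_all
      have "z * deriv (\<lambda>z. g z / quo s z ^ 2) z - 2 * (g z / quo s z ^ 2) = z ^ 3 * p z / s z ^ 3"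
        unfolding D q p using sz by (simp add: field_simps power2_eq_square power3_eq_cube)
      then have "(z * deriv (\<lambda>z. g z / quo s z ^ 2) z - 2 * (g z / quo s z ^ 2)) ^ 2 = z ^ 6 * p z ^ 2 / s z ^ 6"
        by (simp add: power_mult_distrib power_divide flip: power_mult)
      also have "\<dots> = 4 * (z ^ 2 * g z / s z ^ 2) ^ 3 - g2 * (z ^ 2 * g z / s z ^ 2) * z ^ 4 - g3 * z ^ 6"
        unfolding cub using sz by (simp add: field_simps flip: power_mult power_add)
      finally show ?thesis unfolding q .
    qed
  qed
  have quo0: "quo f 0 = 1" "quo f' 0 = 1" using 1 by (auto simp: quo_def)
  have \<phi>0: "\<phi> 0 = 1" "\<phi>' 0 = 1"
    using sigma_triple_at_0(1)[OF T(1) _ f0(1) 1(1)] sigma_triple_at_0(1)[OF T(2) _ f0(2) 1(2)] r by auto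
  note o1 = ode[OF T(1) f0(1) 1(1) holq(1)] and o2 = ode[OF T(2) f0(2) 1(2) holq(2)]
  have P: "\<phi> z / quo f z ^ 2 = \<phi>' z / quo f' z ^ 2" if "z \<in> ball 0 e" for z
    by (rule wp_ode_unique[OF e, where h = "\<lambda>z. \<phi> z / quo f z ^ 2" and k = "\<lambda>z. \<phi>' z / quo f' z ^ 2"])
       (use o1 o2 ball_e that quo0 \<phi>0 in auto)
  \<comment> \<open>Division by \<open>f\<close> and \<open>f'\<close> forces the origin out; the
    punctured ball is still connected, so a zero derivative still means a constant.\<close>
  let ?S = "ball (0 :: complex) e - {0}"
  have S: "open ?S" "connected ?S" by (auto intro: connected_punctured_ball)
  have nz: "f z \<noteq> 0" "f' z \<noteq> 0" if "z \<in> ?S" for z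
    using ball_e[of z] that f0 by (auto simp: quo_def)
  have P': "\<phi> z / f z ^ 2 = \<phi>' z / f' z ^ 2" if "z \<in> ?S" for z
  proof -
    have "z \<noteq> 0" "\<phi> z * z\<^sup>2 / (f z)\<^sup>2 = \<phi>' z * z\<^sup>2 / (f' z)\<^sup>2"
      using P[of z] that f0 by (auto simp: quo_def power_divide)
    then have "z\<^sup>2 * (\<phi> z / f z ^ 2) = z\<^sup>2 * (\<phi>' z / f' z ^ 2)" by (simp add: mult.commute)
    then show ?thesis by (rule mult_left_cancel[THEN iffD1, rotated]) (simp add: \<open>z \<noteq> 0\<close>)
  qed
  define L where "L z = deriv f z / f z - deriv f' z / f' z" for z
  have "(L has_field_derivative 0) (at z)" if z: "z \<in> ?S" for z
  proof -
    have z': "z \<in> ball 0 r" using z sub by auto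
    note d = sigma_triple_derivs[OF T(1) open_ball z'] sigma_triple_derivs[OF T(2) open_ball z']
    note q = sigma_triple_eqs(1)[OF T(1) z'] sigma_triple_eqs(1)[OF T(2) z']
    have "(L has_field_derivative (deriv (deriv f) z * f z - deriv f z * deriv f z) / (f z * f z)
        - (deriv (deriv f') z * f' z - deriv f' z * deriv f' z) / (f' z * f' z)) (at z)"
      unfolding L_def by (intro derivative_intros d nz[OF z])
    also have "(deriv (deriv f) z * f z - deriv f z * deriv f z) / (f z * f z) = - (\<phi> z / f z ^ 2)"
      using q(1) by (simp add: power2_eq_square mult.commute)
    also have "(deriv (deriv f') z * f' z - deriv f' z * deriv f' z) / (f' z * f' z) = - (\<phi>' z / f' z ^ 2)"
      using q(2) by (simp add: power2_eq_square mult.commute)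
    finally show ?thesis using P'[OF z] by simp
  qed
  then have "L constant_on ?S" by (intro has_field_derivative_0_imp_constant_on S)
  then obtain c where c: "\<And>z. z \<in> ?S \<Longrightarrow> L z = c" unfolding constant_on_def by blast
  have deven: "deriv s (- z) = deriv s z"
    if s: "s holomorphic_on ball 0 r" and "\<And>z. z \<in> ball 0 r \<Longrightarrow> s (- z) = - s z" and z: "z \<in> ball 0 r"
    for s :: "complex \<Rightarrow> complex" and z
  proof -
    have "(s has_field_derivative deriv s (- z)) (at (- z))"
      using s z by (intro holomorphic_derivI[of _ "ball 0 r"]) auto
    then have "((\<lambda>z. - s (- z)) has_field_derivative deriv s (- z)) (at z)"
      by (auto intro!: derivative_eq_intros DERIV_chain2[where f = s and g = uminus])
    then have "(s has_field_derivative deriv s (- z)) (at z)"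
      by (rule has_field_derivative_transform_within_open[of _ _ _ "ball 0 r"]) (use that in auto)
    then show ?thesis by (metis DERIV_imp_deriv)
  qed
  \<comment> \<open>\<open>L\<close> is constant and odd.\<close>
  have L0: "L z = 0" if z: "z \<in> ?S" for z
  proof -
    have z': "z \<in> ball 0 r" using z sub by auto
    have "L (- z) = - L z"
      unfolding L_def using deven[OF hol(1) odd(1) z'] deven[OF hol(2) odd(2) z'] odd[OF z'] by simp
    moreover have "L (- z) = c" "L z = c" using z by (auto intro!: c)
    ultimately show ?thesis by simp
  qed
  have "((\<lambda>z. f z / f' z) has_field_derivative 0) (at z)" if z: "z \<in> ?S" for z
  proof -
    have z': "z \<in> ball 0 r" using z sub by auto
    note d = sigma_triple_derivs[OF T(1) open_ball z'] sigma_triple_derivs[OF T(2) open_ball z']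
    have "((\<lambda>z. f z / f' z) has_field_derivative (deriv f z * f' z - f z * deriv f' z) / (f' z * f' z)) (at z)"
      by (intro derivative_intros d nz[OF z])
    also have "deriv f z * f' z - f z * deriv f' z = 0"
      using L0[OF z] nz[OF z] by (simp add: L_def field_simps)
    finally show ?thesis by simp
  qed
  then have "(\<lambda>z. f z / f' z) constant_on ?S" by (intro has_field_derivative_0_imp_constant_on S)
  then obtain c where c: "\<And>z. z \<in> ?S \<Longrightarrow> f z / f' z = c" unfolding constant_on_def by blast
  have fc: "f z = c * f' z" if "z \<in> ball 0 e" for z
    using c[of z] nz[of z] that f0 by (cases "z = 0") (auto simp: field_simps)
  have d': "(f' has_field_derivative 1) (at 0)"
    using sigma_triple_derivs(1)[OF T(2) open_ball, of 0] r 1 by simp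
  have "((\<lambda>z. c * f' z) has_field_derivative c) (at 0)"
    by (rule derivative_eq_intros d' refl | simp)+
  then have "(f has_field_derivative c) (at 0)"
    by (rule has_field_derivative_transform_within_open[of _ _ _ "ball 0 e"]) (use e fc in auto)
  then have "c = 1" using 1 by (metis DERIV_imp_deriv)
  with fc have eq: "f z = f' z" if "z \<in> ball 0 e" for z using that by simp
  show ?thesis
    by (rule analytic_continuation_open[OF open_ball open_ball _ connected_ball sub hol(1,2) eq z])
       (use e in auto)
qed

lemma sigma_triple_determined:
  assumes "sigma_triple g2 g3 S f \<phi> q" "sigma_triple g2 g3 S f' \<phi>' q'" "open S"
    and eq: "\<And>z. z \<in> S \<Longrightarrow> f z = f' z" and z: "z \<in> S"
  shows "\<phi> z = \<phi>' z" "q z = q' z"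
proof -
  have cong: "deriv g z = deriv g' z" if "\<And>z. z \<in> S \<Longrightarrow> g z = g' z" "z \<in> S" for g g' z
    using eventually_mono[OF eventually_nhds_in_open[OF assms(3) that(2)] that(1)]
    by (intro deriv_cong_ev refl) auto
  have d: "deriv f z = deriv f' z" if "z \<in> S" for z by (rule cong[OF eq that])
  have d2: "deriv (deriv f) z = deriv (deriv f') z" if "z \<in> S" for z by (rule cong[OF d that])
  have p: "\<phi> z = \<phi>' z" if "z \<in> S" for z
    using assms(1,2) d d2 eq that unfolding sigma_triple_def by simp
  show "\<phi> z = \<phi>' z" by (rule p[OF z])
  have "q z = f z * deriv \<phi> z - 2 * deriv f z * \<phi> z" "q' z = f' z * deriv \<phi>' z - 2 * deriv f' z * \<phi>' z"
    using assms(1,2) z unfolding sigma_triple_def by blast+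
  then show "q z = q' z" using d[OF z] eq[OF z] p[OF z] cong[OF p z] by simp
qed

lemma sigma_triple_cong:
  assumes T: "sigma_triple g2 g3 S f \<phi> q" and S: "open S"
    and eq: "\<And>z. z \<in> S \<Longrightarrow> (f' z, \<phi>' z, q' z) = (f z, \<phi> z, q z)"
  shows "sigma_triple g2 g3 S f' \<phi>' q'"
proof (rule sigma_tripleI[OF S, where ?f1.0 = "deriv f" and ?f2.0 = "deriv (deriv f)" and ?\<phi>1.0 = "deriv \<phi>"])
  have "q holomorphic_on S" using T unfolding sigma_triple_def by blast
  then show "q' holomorphic_on S" using eq by (subst holomorphic_cong[of S S q' q]) auto
  fix z assume z: "z \<in> S"
  note d = sigma_triple_derivs[OF T S z]
  show "(f' has_field_derivative deriv f z) (at z)"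
    by (rule has_field_derivative_transform_within_open[OF d(1) S z]) (use eq in auto)
  show "(\<phi>' has_field_derivative deriv \<phi> z) (at z)"
    by (rule has_field_derivative_transform_within_open[OF d(3) S z]) (use eq in auto)
  show "(deriv f has_field_derivative deriv (deriv f) z) (at z)" by (rule d(2))
qed (use T eq in \<open>auto simp: sigma_triple_def\<close>)

lemma sigma_triple_UN:
  assumes "\<And>n. sigma_triple g2 g3 (S n) f \<phi> q" "\<And>n. open (S n)"
  shows "sigma_triple g2 g3 (\<Union>n. S n) f \<phi> q"
proof (unfold sigma_triple_def, intro conjI)
  show "f holomorphic_on (\<Union>n. S n)" "\<phi> holomorphic_on (\<Union>n. S n)" "q holomorphic_on (\<Union>n. S n)"
    by (rule holomorphic_on_UN_open; use assms in \<open>simp add: sigma_triple_def\<close>)+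
qed (use assms(1) in \<open>unfold sigma_triple_def, blast\<close>)

section \<open>The sigma function near the origin\<close>

definition wp_domain :: "complex \<Rightarrow> complex \<Rightarrow> complex set" where
  "wp_domain g2 g3 = {w. norm w * (1 + norm g2 + norm g3) < 1 / 2}"

text \<open>The same series in formal form: differential equations become identities between
  coefficients and pass to functions through \<open>eval_fps\<close>.\<close>

definition wp_fps :: "(nat \<Rightarrow> complex) \<Rightarrow> complex \<Rightarrow> complex \<Rightarrow> complex fps" where
  "wp_fps r g2 g3 = Abs_fps (\<lambda>k. r k * wp_coeff g2 g3 k)"

lemma wp_series_eval: "wp_series r (w, g2, g3) = eval_fps (wp_fps r g2 g3) w"
  by (simp add: wp_series_def eval_fps_def wp_fps_def)

lemma wp_fps_conv_radius:
  assumes r: "\<And>k. norm (r k) \<le> 2 * (real k + 1)" and w: "w \<in> wp_domain g2 g3"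
  shows "ereal (norm w) < fps_conv_radius (wp_fps r g2 g3)"
proof -
  define M where "M = 1 + norm g2 + norm g3"
  have M: "M > 0" by (simp add: M_def add_pos_nonneg)
  have "norm w < 1 / (2 * M)"
    using w[unfolded wp_domain_def mem_Collect_eq, folded M_def] M by (simp add: field_simps)
  then obtain s where s: "norm w < s" "s < 1 / (2 * M)" using dense by blast
  then have s0: "0 < s" using norm_ge_zero[of w] by linarith
  have "s * M < 1 / 2" using s(2) M by (simp add: field_simps)
  then have "summable (\<lambda>k. r k * wp_coeff g2 g3 k * of_real s ^ k)"
    using s0 by (intro wp_series_summable r) (simp add: M_def[symmetric])
  from conv_radius_geI[OF this] have "ereal s \<le> fps_conv_radius (wp_fps r g2 g3)"
    using s0 by (simp add: fps_conv_radius_def wp_fps_def)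
  with s(1) show ?thesis
    by (metis ereal_less(3) less_ereal.simps(1) order_less_le_trans)
qed

lemma nth_wp_fps: "fps_nth (wp_fps r g2 g3) n = r n * wp_coeff g2 g3 n"
  by (simp add: wp_fps_def)

text \<open>With \<open>w = z\<^sup>2\<close>, these weights turn the series into \<open>z\<^sup>2 \<wp>(z)\<close>, \<open>z\<^sup>3 \<wp>'(z)\<close> and
  \<open>- log (\<sigma>(z) / z)\<close>.  The weight \<open>wp_u 0\<close> is \<open>0\<close> because of \<open>1 / 0 = 0\<close>.\<close>

definition wp_c :: "nat \<Rightarrow> complex" where "wp_c k = 1"
definition wp_t :: "nat \<Rightarrow> complex" where "wp_t k = 2 * of_nat k - 2"
definition wp_u :: "nat \<Rightarrow> complex" where "wp_u k = 1 / (2 * of_nat k * (2 * of_nat k - 1))"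

lemma wp_weights_bound:
  "norm (wp_c k) \<le> 2 * (real k + 1)" "norm (wp_t k) \<le> 2 * (real k + 1)" "norm (wp_u k) \<le> 2 * (real k + 1)"
proof -
  show "norm (wp_c k) \<le> 2 * (real k + 1)" by (simp add: wp_c_def)
  have "norm (wp_t k) \<le> norm (2 * of_nat k :: complex) + norm (2 :: complex)"
    unfolding wp_t_def by (rule norm_triangle_ineq4)
  then show "norm (wp_t k) \<le> 2 * (real k + 1)" by (simp add: norm_mult)
  show "norm (wp_u k) \<le> 2 * (real k + 1)"
  proof (cases "k = 0")
    case False
    then have k: "real k \<ge> 1" by simp
    have "wp_u k = of_real (1 / (2 * real k * (2 * real k - 1)))" by (simp add: wp_u_def)
    then have "norm (wp_u k) = 1 / (2 * real k * (2 * real k - 1))"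
      using k by (simp only: norm_of_real) simp
    also have "\<dots> \<le> 1 / 1"
    proof (rule divide_left_mono)
      have "1 * 1 \<le> 2 * real k * (2 * real k - 1)" using k by (intro mult_mono) auto
      then show "1 \<le> 2 * real k * (2 * real k - 1)" by simp
      then show "0 < 2 * real k * (2 * real k - 1) * 1" by simp
    qed auto
    finally show ?thesis using k by simp
  qed (simp add: wp_u_def)
qed

lemma nth_X_deriv: "fps_nth (fps_X * fps_deriv f) n = of_nat n * fps_nth (f :: complex fps) n"
  by (cases n) auto

lemma nth_numeral_mult: "fps_nth (numeral k * f) n = numeral k * fps_nth (f :: complex fps) n"
  by (simp add: numeral_fps_const)

text \<open>The full Cauchy product exceeds the sum of the recursion by \<open>2 * c n\<close>,
  since the coefficient of index 1 vanishes. Moving this term across explains the recursion's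
  denominator: \<open>(2 n - 3) (2 n - 2) - 12 = 2 (2 n + 1) (n - 3)\<close>. It vanishes at
  \<open>n = 3\<close>, so the second-order equation leaves that coefficient free;
  \<open>n = 2\<close> gives \<open>g2 / 20\<close>.\<close>

lemma wp_coeff_convolution:
  "(2 * of_nat n - 3) * (2 * of_nat n - 2) * wp_coeff g2 g3 n
     = 6 * (\<Sum>i = 0..n. wp_coeff g2 g3 i * wp_coeff g2 g3 (n - i)) - (if n = 2 then g2 / 2 else 0)"
proof -
  let ?c = "wp_coeff g2 g3"
  consider "n = 0" | "n = 1" | "n = 2" | "n = 3" | "4 \<le> n" by linarith
  then show ?thesis
  proof cases
    case 5
    have split: "{0..n} = insert 0 (insert 1 (insert (n - 1) (insert n {2..n-2})))" using 5 by auto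
    have "(\<Sum>i = 0..n. ?c i * ?c (n - i)) = 2 * ?c n + (\<Sum>i = 2..n - 2. ?c i * ?c (n - i))"
      unfolding split using 5 by (subst sum.insert; (auto simp: wp_coeff_small)[1])+
    moreover have "?c n * ((2 * of_nat n + 1) * (of_nat n - 3)) = 3 * (\<Sum>i = 2..n - 2. ?c i * ?c (n - i))"
    proof -
      have "(2 * of_nat n + 1 :: complex) = of_nat (2 * n + 1)" by simp
      then have "(2 * of_nat n + 1 :: complex) \<noteq> 0" by (metis of_nat_eq_0_iff Suc_eq_plus1 nat.distinct(2))
      moreover have "(of_nat n - 3 :: complex) \<noteq> 0"
      proof
        assume "(of_nat n - 3 :: complex) = 0"
        then have "(of_nat n :: complex) = of_nat 3" by simp
        then show False using 5 by (simp only: of_nat_eq_iff)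
      qed
      ultimately show ?thesis by (subst wp_coeff_rec[OF 5]) simp
    qed
    ultimately have "(2 * of_nat n - 3) * (2 * of_nat n - 2) * ?c n = 6 * (\<Sum>i = 0..n. ?c i * ?c (n - i))"
      by algebra
    then show ?thesis using 5 by simp
  qed (simp_all add: wp_coeff_small numeral_eq_Suc atLeast0_atMost_Suc wp_coeff.simps)
qed

section \<open>Differential equations of the series in \<open>w = z ^ 2\<close>\<close>

context
  fixes g2 g3 :: complex
begin

private abbreviation "C \<equiv> wp_fps wp_c g2 g3"
private abbreviation "T \<equiv> wp_fps wp_t g2 g3"
private abbreviation "U \<equiv> wp_fps wp_u g2 g3"

text \<open>For \<open>w = z ^ 2\<close> the operator \<open>z d/dz\<close> becomes
  \<open>2 w d/dw\<close>. Applied to \<open>z\<^sup>2 \<wp>\<close> it gives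
  \<open>z\<^sup>3 \<wp>' + 2 z\<^sup>2 \<wp>\<close>.\<close>

lemma wp_fps_T: "2 * (fps_X * fps_deriv C) = T + 2 * C"
  by (rule fps_ext) (simp add: numeral_fps_const nth_X_deriv nth_wp_fps wp_c_def wp_t_def algebra_simps)

text \<open>Twice the equation \<open>z (z\<^sup>3 \<wp>')' = 3 z\<^sup>3 \<wp>' + z\<^sup>4
  \<wp>''\<close> with \<open>\<wp>'' = 6 \<wp>\<^sup>2 - g2 / 2\<close> inserted.\<close>

lemma wp_fps_ode: "4 * (fps_X * fps_deriv T) = 6 * T + 12 * C ^ 2 - fps_const g2 * fps_X ^ 2"
proof (rule fps_ext)
  fix n
  have "fps_nth (C ^ 2) n = (\<Sum>i = 0..n. wp_coeff g2 g3 i * wp_coeff g2 g3 (n - i))"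
    by (simp add: power2_eq_square fps_mult_nth nth_wp_fps wp_c_def)
  then have "2 * ((2 * of_nat n - 3) * (2 * of_nat n - 2) * wp_coeff g2 g3 n)
      = 12 * fps_nth (C ^ 2) n - (if n = 2 then g2 else 0)"
    unfolding wp_coeff_convolution by (simp add: algebra_simps)
  moreover have "fps_nth (6 * T + 12 * C ^ 2 - fps_const g2 * fps_X ^ 2) n
      = 6 * ((2 * of_nat n - 2) * wp_coeff g2 g3 n) + 12 * fps_nth (C ^ 2) n - (if n = 2 then g2 else 0)"
    by (simp only: fps_add_nth fps_sub_nth nth_numeral_mult nth_wp_fps wp_t_def fps_mult_left_const_nth fps_X_power_nth) simp
  moreover have "fps_nth (4 * (fps_X * fps_deriv T)) n = 4 * (of_nat n * ((2 * of_nat n - 2) * wp_coeff g2 g3 n))"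
    by (simp only: nth_numeral_mult nth_X_deriv nth_wp_fps wp_t_def)
  ultimately show "fps_nth (4 * (fps_X * fps_deriv T)) n = fps_nth (6 * T + 12 * C ^ 2 - fps_const g2 * fps_X ^ 2) n"
    by algebra
qed

text \<open>With \<open>log \<sigma> = log z - U\<close>, the equation
  \<open>\<wp> = - (log \<sigma>)''\<close> says that \<open>z\<^sup>2 d\<^sup>2/dz\<^sup>2\<close>
  takes \<open>U\<close> to \<open>C - 1\<close>. In terms of \<open>D = z d/dz\<close> that
  operator is \<open>D\<^sup>2 - D\<close>.\<close>

lemma wp_fps_U:
  "2 * (fps_X * fps_deriv (2 * (fps_X * fps_deriv U))) = 2 * (fps_X * fps_deriv U) + C - 1"
proof (rule fps_ext)
  fix n
  have "4 * of_nat n * of_nat n * wp_u n = 2 * of_nat n * wp_u n + wp_c n" if "n \<noteq> 0"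
  proof -
    have "(of_nat n :: complex) \<noteq> 0" using that by simp
    moreover have "2 * of_nat n - 1 \<noteq> (0 :: complex)"
    proof
      assume "2 * of_nat n - 1 = (0 :: complex)"
      then have "(of_nat (2 * n) :: complex) = of_nat 1" by simp
      then show False unfolding of_nat_eq_iff by presburger
    qed
    ultimately show ?thesis by (simp add: wp_u_def wp_c_def field_simps)
  qed
  then have "4 * of_nat n * of_nat n * wp_u n * wp_coeff g2 g3 n
      = 2 * of_nat n * wp_u n * wp_coeff g2 g3 n + wp_c n * wp_coeff g2 g3 n" if "n \<noteq> 0"
    using that by (simp add: distrib_right)
  then show "fps_nth (2 * (fps_X * fps_deriv (2 * (fps_X * fps_deriv U)))) n
      = fps_nth (2 * (fps_X * fps_deriv U) + C - 1) n"
    by (cases "n = 0")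
       (simp_all add: numeral_fps_const nth_X_deriv nth_wp_fps wp_coeff_small wp_c_def mult_ac del: fps_deriv_mult)
qed

text \<open>By the second-order equation the defect \<open>Y\<close> of the cubic satisfies
  \<open>4 * w * Y' = 12 * Y\<close>, so it is a multiple of \<open>w ^ 3\<close>. Its coefficient
  there, \<open>28 * c 3 - g3\<close> up to sign, vanishes by the choice
  \<open>c 3 = g3 / 28\<close>.\<close>

lemma wp_fps_cubic:
  "T ^ 2 = 4 * C ^ 3 - fps_const g2 * fps_X ^ 2 * C - fps_const g3 * fps_X ^ 3"
proof -
  define Y where "Y = T ^ 2 - 4 * C ^ 3 + fps_const g2 * fps_X ^ 2 * C + fps_const g3 * fps_X ^ 3"
  define G2 G3 where "G2 = fps_const g2" and "G3 = fps_const g3"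
  have dG: "fps_deriv G2 = 0" "fps_deriv G3 = 0" by (simp_all add: G2_def G3_def)
  have Y': "fps_deriv Y = 2 * T * fps_deriv T - 12 * C ^ 2 * fps_deriv C
      + G2 * (2 * fps_X * C + fps_X ^ 2 * fps_deriv C) + 3 * G3 * fps_X ^ 2"
    unfolding Y_def G2_def[symmetric] G3_def[symmetric]
    by (simp add: dG power2_eq_square power3_eq_cube algebra_simps)
  have "4 * (fps_X * fps_deriv Y) = 12 * Y"
    using wp_fps_T wp_fps_ode unfolding Y' unfolding Y_def G2_def[symmetric] G3_def[symmetric] by algebra
  then have "fps_nth (4 * (fps_X * fps_deriv Y)) n = fps_nth (12 * Y) n" for n by simp
  then have n: "4 * of_nat n * fps_nth Y n = 12 * fps_nth Y n" for n
    by (simp only: nth_numeral_mult nth_X_deriv mult.assoc)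
  have "fps_nth Y n = 0" for n
  proof (cases "n = 3")
    case True
    show ?thesis unfolding True Y_def
      by (simp add: power2_eq_square power3_eq_cube fps_mult_nth numeral_fps_const
          nth_wp_fps wp_c_def wp_t_def numeral_eq_Suc wp_coeff.simps[of g2 g3 "Suc (Suc (Suc 0))"] wp_coeff_small algebra_simps)
  next
    case False
    then have "(of_nat n :: complex) \<noteq> of_nat 3" by (simp only: of_nat_eq_iff not_False_eq_True)
    then show ?thesis using n[of n] by simp
  qed
  then have "Y = 0" by (intro fps_ext) simp
  then show ?thesis unfolding Y_def by (simp add: algebra_simps)
qed

lemma wp_eval:
  assumes w: "w \<in> wp_domain g2 g3"
  shows "2 * w * eval_fps (fps_deriv C) w = eval_fps T w + 2 * eval_fps C w"
    "4 * w * eval_fps (fps_deriv T) w = 6 * eval_fps T w + 12 * eval_fps C w ^ 2 - g2 * w ^ 2"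
    "2 * w * (2 * eval_fps (fps_deriv U) w + 2 * w * eval_fps (fps_deriv (fps_deriv U)) w)
       = 2 * w * eval_fps (fps_deriv U) w + eval_fps C w - 1"
    "eval_fps T w ^ 2 = 4 * eval_fps C w ^ 3 - g2 * w ^ 2 * eval_fps C w - g3 * w ^ 3"
    "(eval_fps C has_field_derivative eval_fps (fps_deriv C) w) (at w)"
    "(eval_fps T has_field_derivative eval_fps (fps_deriv T) w) (at w)"
    "(eval_fps U has_field_derivative eval_fps (fps_deriv U) w) (at w)"
    "(eval_fps (fps_deriv U) has_field_derivative eval_fps (fps_deriv (fps_deriv U)) w) (at w)"
proof -
  define ok :: "complex fps \<Rightarrow> bool" where "ok f \<longleftrightarrow> ereal (norm w) < fps_conv_radius f" for f
  have okd: "ok (fps_deriv f)" if "ok f" for f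
    using that fps_conv_radius_deriv[of f] unfolding ok_def by (rule less_le_trans)
  have okm: "ok (f * g)" if "ok f" "ok g" for f g
    using that fps_conv_radius_mult[of f g] unfolding ok_def by (metis less_le_trans min_less_iff_conj)
  have oka: "ok (f + g)" if "ok f" "ok g" for f g
    using that fps_conv_radius_add[of f g] unfolding ok_def by (metis less_le_trans min_less_iff_conj)
  have oks: "ok (f - g)" if "ok f" "ok g" for f g
    using that fps_conv_radius_diff[of f g] unfolding ok_def by (metis less_le_trans min_less_iff_conj)
  have okp: "ok (f ^ n)" if "ok f" for f n
    using that fps_conv_radius_power[of f n] unfolding ok_def by (rule less_le_trans)
  have okc: "ok (fps_const c)" "ok fps_X" "ok (numeral k)" "ok 1" for c k by (simp_all add: ok_def)
  have okb: "ok C" "ok T" "ok U"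
    unfolding ok_def by (rule wp_fps_conv_radius[OF _ w]; rule wp_weights_bound)+
  note ok = okd okm oka oks okp okc okb
  have em: "eval_fps (f * g) w = eval_fps f w * eval_fps g w" if "ok f" "ok g" for f g
    using that unfolding ok_def by (rule eval_fps_mult)
  have ea: "eval_fps (f + g) w = eval_fps f w + eval_fps g w" if "ok f" "ok g" for f g
    using that unfolding ok_def by (rule eval_fps_add)
  have es: "eval_fps (f - g) w = eval_fps f w - eval_fps g w" if "ok f" "ok g" for f g
    using that unfolding ok_def by (rule eval_fps_diff)
  have ep: "eval_fps (f ^ n) w = eval_fps f w ^ n" if "ok f" for f n
    by (induction n) (auto simp: em ok that)
  note ev = em ea es ep eval_fps_const eval_fps_X eval_fps_numeral eval_fps_1
  show "2 * w * eval_fps (fps_deriv C) w = eval_fps T w + 2 * eval_fps C w"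
    using arg_cong[OF wp_fps_T, of "\<lambda>f. eval_fps f w"] by (simp only: ev ok mult.assoc)
  show "4 * w * eval_fps (fps_deriv T) w = 6 * eval_fps T w + 12 * eval_fps C w ^ 2 - g2 * w ^ 2"
    using arg_cong[OF wp_fps_ode, of "\<lambda>f. eval_fps f w"] by (simp only: ev ok mult.assoc)
  have "2 * fps_X * (2 * fps_deriv U + 2 * fps_X * fps_deriv (fps_deriv U)) = 2 * fps_X * fps_deriv U + C - 1"
    using wp_fps_U by (simp add: algebra_simps)
  from arg_cong[OF this, of "\<lambda>f. eval_fps f w"]
  show "2 * w * (2 * eval_fps (fps_deriv U) w + 2 * w * eval_fps (fps_deriv (fps_deriv U)) w)
       = 2 * w * eval_fps (fps_deriv U) w + eval_fps C w - 1"
    by (simp only: ev ok)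
  show "eval_fps T w ^ 2 = 4 * eval_fps C w ^ 3 - g2 * w ^ 2 * eval_fps C w - g3 * w ^ 3"
    using arg_cong[OF wp_fps_cubic, of "\<lambda>f. eval_fps f w"] by (simp only: ev ok)
  show "(eval_fps C has_field_derivative eval_fps (fps_deriv C) w) (at w)"
    "(eval_fps T has_field_derivative eval_fps (fps_deriv T) w) (at w)"
    "(eval_fps U has_field_derivative eval_fps (fps_deriv U) w) (at w)"
    "(eval_fps (fps_deriv U) has_field_derivative eval_fps (fps_deriv (fps_deriv U)) w) (at w)"
    using okb okd[OF okb(3)] unfolding ok_def by (auto intro: has_field_derivative_eval_fps)
qed

end

text \<open>Here \<open>e\<close> is \<open>\<sigma>(z) / z\<close>, so
  \<open>\<sigma>\<^sup>2 \<wp> = e\<^sup>2 (z\<^sup>2 \<wp>)\<close> and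
  \<open>\<sigma>\<^sup>3 \<wp>' = e\<^sup>3 (z\<^sup>3 \<wp>')\<close> are visibly free of
  poles.\<close>

definition sigma_local :: "complex \<Rightarrow> complex \<Rightarrow> complex \<Rightarrow> complex \<times> complex \<times> complex" where
  "sigma_local g2 g3 z = (let e = exp (- wp_series wp_u (z ^ 2, g2, g3)) in
     (z * e, e ^ 2 * wp_series wp_c (z ^ 2, g2, g3), e ^ 3 * wp_series wp_t (z ^ 2, g2, g3)))"

definition sigma_ball :: "complex \<Rightarrow> complex \<Rightarrow> complex set" where
  "sigma_ball g2 g3 = ball 0 (sqrt (1 / (2 * (1 + norm g2 + norm g3))))"

lemma sigma_ball_radius_pos: "0 < sqrt (1 / (2 * (1 + norm g2 + norm g3)))"
proof -
  have "0 < 1 + norm g2 + norm g3" by (intro add_pos_nonneg) auto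
  then show ?thesis by simp
qed

lemma mem_sigma_ball: "z \<in> sigma_ball g2 g3 \<longleftrightarrow> norm z ^ 2 * (1 + norm g2 + norm g3) < 1 / 2"
proof -
  have M: "0 < 1 + norm g2 + norm g3" by (intro add_pos_nonneg) auto
  have "z \<in> sigma_ball g2 g3 \<longleftrightarrow> norm z < sqrt (1 / (2 * (1 + norm g2 + norm g3)))"
    by (simp add: sigma_ball_def)
  also have "\<dots> \<longleftrightarrow> sqrt (norm z ^ 2) < sqrt (1 / (2 * (1 + norm g2 + norm g3)))" by simp
  also have "\<dots> \<longleftrightarrow> norm z ^ 2 < 1 / (2 * (1 + norm g2 + norm g3))" by (rule real_sqrt_less_iff)
  also have "\<dots> \<longleftrightarrow> norm z ^ 2 * (1 + norm g2 + norm g3) < 1 / 2"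
    using M by (simp add: pos_less_divide_eq algebra_simps)
  finally show ?thesis .
qed

lemma sigma_ball_half: "z \<in> sigma_ball g2 g3 \<Longrightarrow> z / 2 \<in> sigma_ball g2 g3"
  unfolding sigma_ball_def mem_ball_0
  by (rule le_less_trans[of _ "norm z"]) (simp_all add: norm_divide)

lemma power2_in_wp_domain: "z \<in> sigma_ball g2 g3 \<Longrightarrow> z ^ 2 \<in> wp_domain g2 g3"
  by (simp add: mem_sigma_ball wp_domain_def norm_power)

lemma wp_u_0: "wp_series wp_u (0, g2, g3) = 0"
  by (simp add: wp_series_eval eval_fps_at_0 nth_wp_fps wp_u_def)

lemma sigma_local_triple:
  "sigma_triple g2 g3 (sigma_ball g2 g3) (\<lambda>z. fst (sigma_local g2 g3 z))
     (\<lambda>z. fst (snd (sigma_local g2 g3 z))) (\<lambda>z. snd (snd (sigma_local g2 g3 z)))"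
  and deriv_sigma_local: "deriv (\<lambda>z. fst (sigma_local g2 g3 z)) 0 = 1"
proof -
  define C where "C = eval_fps (wp_fps wp_c g2 g3)"
  define C' where "C' = eval_fps (fps_deriv (wp_fps wp_c g2 g3))"
  define T where "T = eval_fps (wp_fps wp_t g2 g3)"
  define T' where "T' = eval_fps (fps_deriv (wp_fps wp_t g2 g3))"
  define U where "U = eval_fps (wp_fps wp_u g2 g3)"
  define U' where "U' = eval_fps (fps_deriv (wp_fps wp_u g2 g3))"
  define U'' where "U'' = eval_fps (fps_deriv (fps_deriv (wp_fps wp_u g2 g3)))"
  note defs = C_def C'_def T_def T'_def U_def U'_def U''_def
  define E where "E z = exp (- U (z ^ 2))" for z
  have L: "fst (sigma_local g2 g3 z) = z * E z" "fst (snd (sigma_local g2 g3 z)) = E z ^ 2 * C (z ^ 2)"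
    "snd (snd (sigma_local g2 g3 z)) = E z ^ 3 * T (z ^ 2)" for z
    by (simp_all add: sigma_local_def E_def defs wp_series_eval Let_def)
  \<comment> \<open>\<open>l\<close> is \<open>z\<close> times the derivative of
    \<open>U (z ^ 2)\<close>, so \<open>(z * E z)' = E z * (1 - l z)\<close>. The third identity of
    \<open>wp_eval\<close> becomes \<open>z * l' z = l z + C (z ^ 2) - 1\<close>.\<close>
  define l where "l z = 2 * z ^ 2 * U' (z ^ 2)" for z
  define l' where "l' z = 4 * z * U' (z ^ 2) + 4 * z ^ 3 * U'' (z ^ 2)" for z
  define f1 where "f1 z = E z * (1 - l z)" for z
  define f2 where "f2 z = - (2 * z * U' (z ^ 2)) * E z * (1 - l z) - E z * l' z" for z
  define p1 where "p1 z = E z ^ 2 * (2 * z * C' (z ^ 2) - 4 * z * U' (z ^ 2) * C (z ^ 2))" for z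
  have S: "open (sigma_ball g2 g3)" by (simp add: sigma_ball_def)
  have D: "((\<lambda>z. z * E z) has_field_derivative f1 z) (at z)"
    "(f1 has_field_derivative f2 z) (at z)"
    "((\<lambda>z. E z ^ 2 * C (z ^ 2)) has_field_derivative p1 z) (at z)"
    "\<exists>d. ((\<lambda>z. E z ^ 3 * T (z ^ 2)) has_field_derivative d) (at z)"
    "E z ^ 2 * C (z ^ 2) = (f1 z)\<^sup>2 - z * E z * f2 z"
    "E z ^ 3 * T (z ^ 2) = z * E z * p1 z - 2 * f1 z * (E z ^ 2 * C (z ^ 2))"
    "(E z ^ 3 * T (z ^ 2))\<^sup>2 = 4 * (E z ^ 2 * C (z ^ 2)) ^ 3 - g2 * (E z ^ 2 * C (z ^ 2)) * (z * E z) ^ 4 - g3 * (z * E z) ^ 6"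
    if z: "z \<in> sigma_ball g2 g3" for z
  proof -
    note W = wp_eval[OF power2_in_wp_domain[OF z], folded defs]
    have sq: "((\<lambda>z. z ^ 2) has_field_derivative 2 * z) (at z)"
      by (auto intro!: derivative_eq_intros)
    have c: "((\<lambda>z. F (z ^ 2)) has_field_derivative F' * (2 * z)) (at z)"
      if "(F has_field_derivative F') (at (z ^ 2))" for F F'
      using DERIV_chain2[OF that sq] .
    note d = c[OF W(5)] c[OF W(6)] c[OF W(7)] c[OF W(8)]
    have dE: "(E has_field_derivative - (2 * z * U' (z ^ 2)) * E z) (at z)"
      unfolding E_def[abs_def] by (rule derivative_eq_intros d refl | simp)+
    have dl: "(l has_field_derivative l' z) (at z)"
      unfolding l_def[abs_def] l'_def
      by (rule derivative_eq_intros d refl | simp add: algebra_simps power2_eq_square power3_eq_cube)+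
    show "((\<lambda>z. z * E z) has_field_derivative f1 z) (at z)"
      unfolding f1_def l_def
      by (rule derivative_eq_intros dE refl | simp add: algebra_simps power2_eq_square)+
    show "(f1 has_field_derivative f2 z) (at z)"
      unfolding f1_def[abs_def] f2_def by (rule derivative_eq_intros dE dl refl | simp add: algebra_simps)+
    show "((\<lambda>z. E z ^ 2 * C (z ^ 2)) has_field_derivative p1 z) (at z)"
      unfolding p1_def by (rule derivative_eq_intros dE d refl | simp add: algebra_simps power2_eq_square)+
    show "\<exists>d. ((\<lambda>z. E z ^ 3 * T (z ^ 2)) has_field_derivative d) (at z)"
      by (rule exI, (rule derivative_eq_intros dE d refl)+)
    have zl: "z * l' z = l z + C (z ^ 2) - 1"
      using W(3) unfolding l_def l'_def by algebra
    have zc: "2 * z ^ 2 * C' (z ^ 2) = T (z ^ 2) + 2 * C (z ^ 2)" by (rule W(1))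
    show "E z ^ 2 * C (z ^ 2) = (f1 z)\<^sup>2 - z * E z * f2 z"
      using zl l_def[of z] unfolding f1_def f2_def by algebra
    show "E z ^ 3 * T (z ^ 2) = z * E z * p1 z - 2 * f1 z * (E z ^ 2 * C (z ^ 2))"
      using zc l_def[of z] unfolding f1_def p1_def by algebra
    show "(E z ^ 3 * T (z ^ 2))\<^sup>2 = 4 * (E z ^ 2 * C (z ^ 2)) ^ 3 - g2 * (E z ^ 2 * C (z ^ 2)) * (z * E z) ^ 4 - g3 * (z * E z) ^ 6"
      using W(4) by algebra
  qed
  show "sigma_triple g2 g3 (sigma_ball g2 g3) (\<lambda>z. fst (sigma_local g2 g3 z))
     (\<lambda>z. fst (snd (sigma_local g2 g3 z))) (\<lambda>z. snd (snd (sigma_local g2 g3 z)))"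
    unfolding L by (rule sigma_tripleI[OF S D(1-3) _ D(5-7)]) (use D(4) S in \<open>auto simp: holomorphic_on_open\<close>)
  have "0 \<in> sigma_ball g2 g3" using sigma_ball_radius_pos by (simp add: sigma_ball_def)
  from DERIV_imp_deriv[OF D(1)[OF this]] show "deriv (\<lambda>z. fst (sigma_local g2 g3 z)) 0 = 1"
    unfolding L by (simp add: f1_def l_def E_def U_def wp_u_0 flip: wp_series_eval)
qed

section \<open>The entire sigma function\<close>

lemma sigma_local_minus: "sigma_local g2 g3 (- z) = (case sigma_local g2 g3 z of (s, p, q) \<Rightarrow> (- s, p, q))"
  by (simp add: sigma_local_def Let_def)

lemma zero_in_sigma_ball: "0 \<in> sigma_ball g2 g3"
  using sigma_ball_radius_pos by (simp add: sigma_ball_def)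

lemma open_sigma_ball: "open (sigma_ball g2 g3)"
  by (simp add: sigma_ball_def)

lemma sigma_local_0: "sigma_local g2 g3 0 = (0, 1, -2)"
  by (simp add: sigma_local_def wp_u_0 wp_series_eval eval_fps_at_0 nth_wp_fps wp_c_def wp_t_def
      wp_coeff_small wp_u_def)

lemma sigma_dup_0: "sigma_dup g2 (0, 1, -2) = (0, 1, -2)"
  by (simp add: sigma_dup_def Let_def)

text \<open>Both sides are solution triples on the ball whose first components are odd with
  derivative 1 at 0, so uniqueness identifies these, and they determine the other two
  components.\<close>

lemma sigma_local_dup:
  assumes z: "z \<in> sigma_ball g2 g3"
  shows "sigma_dup g2 (sigma_local g2 g3 (z / 2)) = sigma_local g2 g3 z"
proof -
  let ?B = "sigma_ball g2 g3"
  let ?L = "sigma_local g2 g3"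
  let ?D = "\<lambda>z. sigma_dup g2 (?L (z / 2))"
  define s where "s = (\<lambda>z. fst (?D z))"
  have B: "?B = ball 0 (sqrt (1 / (2 * (1 + norm g2 + norm g3))))" by (simp add: sigma_ball_def)
  have "sigma_triple g2 g3 {z. z / 2 \<in> ?B} s (\<lambda>z. fst (snd (?D z))) (\<lambda>z. snd (snd (?D z)))"
    unfolding s_def
    by (rule sigma_triple_dup[OF sigma_local_triple open_sigma_ball _ zero_in_sigma_ball])
       (auto simp: B sigma_local_0)
  then have D: "sigma_triple g2 g3 ?B s (\<lambda>z. fst (snd (?D z))) (\<lambda>z. snd (snd (?D z)))"
    by (rule sigma_triple_subset) (auto intro: sigma_ball_half)
  have s: "s z = - fst (?L (z / 2)) * snd (snd (?L (z / 2)))" for z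
    by (simp add: s_def sigma_dup_def Let_def case_prod_beta)
  have L0: "(fst \<circ> ?L has_field_derivative 1) (at (0 / 2))"
    using sigma_triple_derivs(1)[OF sigma_local_triple open_sigma_ball zero_in_sigma_ball, of g2 g3]
    by (simp add: deriv_sigma_local o_def)
  have h: "((\<lambda>z. z / 2 :: complex) has_field_derivative 1 / 2) (at 0)"
    by (auto intro!: derivative_eq_intros)
  have Q0: "\<exists>d. ((\<lambda>z. snd (snd (?L z))) has_field_derivative d) (at (0 / 2))"
    using sigma_triple_derivs(4)[OF sigma_local_triple open_sigma_ball zero_in_sigma_ball, of g2 g3] by auto
  then obtain d where d: "((\<lambda>z. snd (snd (?L z))) has_field_derivative d) (at (0 / 2))" ..
  \<comment> \<open>The slope of \<open>- \<sigma>(z / 2) * q (z / 2)\<close> at 0 is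
    \<open>- (1 / 2) * (- 2) = 1\<close>; the term with \<open>d\<close> drops out because
    \<open>\<sigma>\<close> vanishes at 0.\<close>
  have "(s has_field_derivative 1) (at 0)"
    unfolding s[abs_def]
    by (rule DERIV_cong, rule DERIV_mult[OF DERIV_minus[OF DERIV_chain2[OF L0[unfolded o_def] h]] DERIV_chain2[OF d h]])
       (simp add: sigma_local_0)
  then have d1: "deriv s 0 = 1" by (rule DERIV_imp_deriv)
  have odd: "s (- z) = - s z" "fst (?L (- z)) = - fst (?L z)" for z
    using sigma_local_minus[of g2 g3 z] sigma_local_minus[of g2 g3 "z / 2"] by (simp_all add: s case_prod_beta)
  have eq: "s z = fst (?L z)" if "z \<in> ?B" for z
    by (rule sigma_triple_unique[OF D[unfolded B] sigma_local_triple[of g2 g3, unfolded B]])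
       (use that sigma_ball_radius_pos d1 deriv_sigma_local odd in \<open>auto simp: B\<close>)
  from eq[OF z] sigma_triple_determined[OF D sigma_local_triple open_sigma_ball eq z]
  show ?thesis unfolding s_def by (simp add: prod_eq_iff)
qed

section \<open>Extension to the whole plane by iterated duplication\<close>

definition sigma_iter :: "nat \<Rightarrow> complex \<Rightarrow> complex \<Rightarrow> complex \<Rightarrow> complex \<times> complex \<times> complex" where
  "sigma_iter n g2 g3 z = (sigma_dup g2 ^^ n) (sigma_local g2 g3 (z / 2 ^ n))"

lemma sigma_iter_Suc: "sigma_iter (Suc n) g2 g3 z = sigma_dup g2 (sigma_iter n g2 g3 (z / 2))"
  by (simp add: sigma_iter_def)

lemma sigma_iter_0: "sigma_iter n g2 g3 0 = (0, 1, -2)"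
proof (induction n)
  case 0
  then show ?case by (simp add: sigma_iter_def sigma_local_0)
next
  case (Suc n)
  then show ?case by (simp add: sigma_iter_Suc sigma_dup_0)
qed

lemma sigma_iter_mono:
  assumes "m \<le> n" "z / 2 ^ m \<in> sigma_ball g2 g3"
  shows "sigma_iter n g2 g3 z = sigma_iter m g2 g3 z \<and> z / 2 ^ n \<in> sigma_ball g2 g3"
  using assms(1)
proof (induction n rule: dec_induct)
  case base
  show ?case using assms by simp
next
  case (step n)
  have h: "z / 2 ^ Suc n = (z / 2 ^ n) / 2" by simp
  have "sigma_iter (Suc n) g2 g3 z = sigma_iter n g2 g3 z"
    unfolding sigma_iter_def funpow_Suc_right o_apply h using sigma_local_dup step by metis
  moreover have "z / 2 ^ Suc n \<in> sigma_ball g2 g3"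
    unfolding h using step sigma_ball_half by blast
  ultimately show ?case using step by simp
qed

lemma sigma_ball_exhaust: "\<exists>n. z / 2 ^ n \<in> sigma_ball g2 g3"
proof -
  have "(\<lambda>n. z / 2 ^ n) \<longlonglongrightarrow> 0"
    using tendsto_mult_right[OF LIMSEQ_power_zero[of "1 / 2 :: complex"], of z]
    by (simp add: power_divide norm_divide)
  from eventually_happens'[OF _ topological_tendstoD[OF this open_sigma_ball zero_in_sigma_ball]]
  show ?thesis by simp
qed

text \<open>\<open>LEAST\<close> only selects one of the admissible numbers of halvings; by
  \<open>sigma_iter_mono\<close> all of them give the same value.\<close>

definition sigma_global :: "complex \<Rightarrow> complex \<Rightarrow> complex \<Rightarrow> complex \<times> complex \<times> complex" where
  "sigma_global g2 g3 z = sigma_iter (LEAST n. z / 2 ^ n \<in> sigma_ball g2 g3) g2 g3 z"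

lemma sigma_global_eq:
  assumes "z / 2 ^ n \<in> sigma_ball g2 g3"
  shows "sigma_global g2 g3 z = sigma_iter n g2 g3 z"
  unfolding sigma_global_def
  using sigma_iter_mono[OF Least_le[of "\<lambda>n. z / 2 ^ n \<in> sigma_ball g2 g3", OF assms]
      LeastI[of "\<lambda>n. z / 2 ^ n \<in> sigma_ball g2 g3", OF assms]] by simp

lemma sigma_iter_triple:
  "sigma_triple g2 g3 {z. z / 2 ^ n \<in> sigma_ball g2 g3} (\<lambda>z. fst (sigma_iter n g2 g3 z))
     (\<lambda>z. fst (snd (sigma_iter n g2 g3 z))) (\<lambda>z. snd (snd (sigma_iter n g2 g3 z)))"
proof (induction n)
  case 0
  then show ?case using sigma_local_triple[of g2 g3] by (simp add: sigma_iter_def)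
next
  case (Suc n)
  let ?S = "{z. z / 2 ^ n \<in> sigma_ball g2 g3}"
  have "?S = ball 0 (2 ^ n * sqrt (1 / (2 * (1 + norm g2 + norm g3))))"
    by (auto simp: sigma_ball_def norm_divide norm_power field_simps)
  then have S: "open ?S" "connected ?S" by simp_all
  have "sigma_triple g2 g3 {z. z / 2 \<in> ?S} (\<lambda>z. fst (sigma_iter (Suc n) g2 g3 z))
     (\<lambda>z. fst (snd (sigma_iter (Suc n) g2 g3 z))) (\<lambda>z. snd (snd (sigma_iter (Suc n) g2 g3 z)))"
    by (rule sigma_triple_dup[OF Suc.IH S, of 0])
       (auto simp: zero_in_sigma_ball sigma_iter_0 sigma_iter_Suc)
  moreover have "{z. z / 2 \<in> ?S} = {z. z / 2 ^ Suc n \<in> sigma_ball g2 g3}" by (simp add: field_simps)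
  ultimately show ?case by simp
qed

lemma sigma_global_triple:
  "sigma_triple g2 g3 UNIV (\<lambda>z. fst (sigma_global g2 g3 z))
     (\<lambda>z. fst (snd (sigma_global g2 g3 z))) (\<lambda>z. snd (snd (sigma_global g2 g3 z)))"
proof -
  have "open {z. z / 2 ^ n \<in> sigma_ball g2 g3}" for n
    using open_vimage[OF open_sigma_ball, of "\<lambda>z. z / 2 ^ n"] by (simp add: vimage_def continuous_on_divide)
  then have "sigma_triple g2 g3 (\<Union>n. {z. z / 2 ^ n \<in> sigma_ball g2 g3}) (\<lambda>z. fst (sigma_global g2 g3 z))
     (\<lambda>z. fst (snd (sigma_global g2 g3 z))) (\<lambda>z. snd (snd (sigma_global g2 g3 z)))"
    by (intro sigma_triple_UN sigma_triple_cong[OF sigma_iter_triple]) (auto simp: sigma_global_eq)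
  moreover have "(\<Union>n. {z. z / 2 ^ n \<in> sigma_ball g2 g3}) = UNIV"
    using sigma_ball_exhaust by blast
  ultimately show ?thesis by simp
qed

lemma sigma_iter_minus: "sigma_iter n g2 g3 (- z) = (case sigma_iter n g2 g3 z of (s, p, q) \<Rightarrow> (- s, p, q))"
proof (induction n arbitrary: z)
  case 0
  then show ?case by (simp add: sigma_iter_def sigma_local_minus)
next
  case (Suc n)
  then show ?case using Suc[of "z / 2"] by (simp add: sigma_iter_Suc sigma_dup_def Let_def case_prod_beta)
qed

lemma sigma_global_minus: "sigma_global g2 g3 (- z) = (case sigma_global g2 g3 z of (s, p, q) \<Rightarrow> (- s, p, q))"
proof -
  obtain n where n: "z / 2 ^ n \<in> sigma_ball g2 g3" using sigma_ball_exhaust by blast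
  then have "- z / 2 ^ n \<in> sigma_ball g2 g3" by (simp add: sigma_ball_def)
  then show ?thesis using n by (simp add: sigma_global_eq sigma_iter_minus)
qed

lemma sigma_global_at_0: "sigma_global g2 g3 0 = (0, 1, -2)"
  by (simp add: sigma_global_def sigma_iter_0)

lemma deriv_sigma_global: "deriv (\<lambda>z. fst (sigma_global g2 g3 z)) 0 = 1"
proof -
  have "deriv (\<lambda>z. fst (sigma_global g2 g3 z)) 0 = deriv (\<lambda>z. fst (sigma_local g2 g3 z)) 0"
    by (intro deriv_cong_ev eventually_mono[OF eventually_nhds_in_open[OF open_sigma_ball[of g2 g3] zero_in_sigma_ball]] refl)
       (auto simp: sigma_global_eq[where n = 0] sigma_iter_def)
  then show ?thesis by (simp add: deriv_sigma_local)
qed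

lemma sigma_global_dup: "sigma_global g2 g3 (2 * z) = sigma_dup g2 (sigma_global g2 g3 z)"
proof -
  obtain n where n: "2 * z / 2 ^ n \<in> sigma_ball g2 g3" using sigma_ball_exhaust by blast
  then have n': "2 * z / 2 ^ Suc n \<in> sigma_ball g2 g3" using sigma_ball_half[OF n] by simp
  then have "z / 2 ^ n \<in> sigma_ball g2 g3" by simp
  then show ?thesis using sigma_global_eq[OF n'] by (simp add: sigma_global_eq sigma_iter_Suc)
qed

section \<open>Joint differentiability in \<open>z\<close>, \<open>g2\<close>,
  \<open>g3\<close>\<close>

lemma sigma_dup_cdiff:
  assumes "cdiff (\<lambda>v. fst (F v)) p" "cdiff (\<lambda>v. fst (snd (F v))) p" "cdiff (\<lambda>v. snd (snd (F v))) p" "cdiff G p"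
  shows "cdiff (\<lambda>v. fst (sigma_dup (G v) (F v))) p" "cdiff (\<lambda>v. fst (snd (sigma_dup (G v) (F v)))) p"
    "cdiff (\<lambda>v. snd (snd (sigma_dup (G v) (F v)))) p"
  unfolding sigma_dup_def Let_def case_prod_beta fst_conv snd_conv divide_inverse
  by (intro cdiff_add cdiff_diff cdiff_mult cdiff_power cdiff_uminus cdiff_const assms)+

lemma sigma_local_cdiff:
  assumes "z \<in> sigma_ball g2 g3"
  shows "cdiff (\<lambda>(z, g2, g3). fst (sigma_local g2 g3 z)) (z, g2, g3)"
    "cdiff (\<lambda>(z, g2, g3). fst (snd (sigma_local g2 g3 z))) (z, g2, g3)"
    "cdiff (\<lambda>(z, g2, g3). snd (snd (sigma_local g2 g3 z))) (z, g2, g3)"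
proof -
  let ?p = "(z, g2, g3)"
  have w: "norm (z ^ 2) * (1 + norm g2 + norm g3) < 1 / 2"
    using assms by (simp add: mem_sigma_ball norm_power)
  have W: "cdiff (\<lambda>v. wp_series r ((fst v) ^ 2, fst (snd v), snd (snd v))) ?p" if "r \<in> {wp_u, wp_c, wp_t}" for r
    by (rule cdiff_compose)
       (use that in \<open>auto intro!: cdiff_wp_series cdiff_power cdiff_fst cdiff_fst_snd cdiff_snd_snd w wp_weights_bound\<close>)
  have E: "cdiff (\<lambda>v. exp (- wp_series wp_u ((fst v) ^ 2, fst (snd v), snd (snd v)))) ?p"
    by (rule cdiff_compose1[OF DERIV_exp]) (intro cdiff_uminus W, simp)
  show "cdiff (\<lambda>(z, g2, g3). fst (sigma_local g2 g3 z)) (z, g2, g3)"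
    "cdiff (\<lambda>(z, g2, g3). fst (snd (sigma_local g2 g3 z))) (z, g2, g3)"
    "cdiff (\<lambda>(z, g2, g3). snd (snd (sigma_local g2 g3 z))) (z, g2, g3)"
    unfolding sigma_local_def Let_def case_prod_beta' fst_conv snd_conv
    by (intro cdiff_mult cdiff_power cdiff_fst E W; simp)+
qed

lemma sigma_iter_cdiff:
  assumes "z / 2 ^ n \<in> sigma_ball g2 g3"
  shows "cdiff (\<lambda>(z, g2, g3). fst (sigma_iter n g2 g3 z)) (z, g2, g3) \<and>
    cdiff (\<lambda>(z, g2, g3). fst (snd (sigma_iter n g2 g3 z))) (z, g2, g3) \<and>
    cdiff (\<lambda>(z, g2, g3). snd (snd (sigma_iter n g2 g3 z))) (z, g2, g3)"
  using assms
proof (induction n arbitrary: z)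
  case 0
  then show ?case using sigma_local_cdiff[of z g2 g3] by (simp add: sigma_iter_def)
next
  case (Suc n)
  let ?p = "(z, g2, g3)"
  have "z / 2 / 2 ^ n \<in> sigma_ball g2 g3" using Suc.prems by (simp add: field_simps)
  note IH = Suc.IH[OF this]
  have h: "cdiff (\<lambda>v. fst v / 2) ?p" unfolding divide_inverse by (intro cdiff_mult cdiff_fst cdiff_const)
  have "cdiff (\<lambda>v. (\<lambda>(z, g2, g3). f (sigma_iter n g2 g3 z)) (fst v / 2, fst (snd v), snd (snd v))) ?p"
    if "cdiff (\<lambda>(z, g2, g3). f (sigma_iter n g2 g3 z)) (z / 2, g2, g3)" for f :: "_ \<Rightarrow> complex"
    by (rule cdiff_compose) (use that h in \<open>auto intro: cdiff_fst_snd cdiff_snd_snd\<close>)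
  note c = this[OF IH[THEN conjunct1]] this[OF IH[THEN conjunct2, THEN conjunct1]] this[OF IH[THEN conjunct2, THEN conjunct2]]
  show ?case
    using sigma_dup_cdiff[OF c[unfolded prod.case] cdiff_fst_snd]
    unfolding sigma_iter_Suc case_prod_beta' by simp
qed

text \<open>The number of halvings depends on all three variables, but membership in the ball is an
  open condition on \<open>(z, g2, g3)\<close>. One fixed \<open>n\<close> therefore serves a whole
  neighbourhood of \<open>p\<close>.\<close>

lemma sigma_global_cdiff:
  "cdiff (\<lambda>(z, g2, g3). fst (sigma_global g2 g3 z)) p"
  "cdiff (\<lambda>(z, g2, g3). snd (snd (sigma_global g2 g3 z))) p"
proof -
  obtain z g2 g3 where p: "p = (z, g2, g3)" using prod_cases3 by blast
  obtain n where n: "z / 2 ^ n \<in> sigma_ball g2 g3" using sigma_ball_exhaust by blast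
  let ?U = "{v :: complex \<times> complex \<times> complex. norm (fst v / 2 ^ n) ^ 2 * (1 + norm (fst (snd v)) + norm (snd (snd v))) < 1 / 2}"
  have "open ?U" by (intro open_Collect_less continuous_intros) auto
  moreover have "p \<in> ?U" using n by (simp add: p mem_sigma_ball)
  ultimately have ev: "\<forall>\<^sub>F v in nhds p. v \<in> ?U" by (rule eventually_nhds_in_open)
  have eq: "sigma_iter n g2 g3 z = sigma_global g2 g3 z" if "(z, g2, g3) \<in> ?U" for z g2 g3
    using that by (intro sigma_global_eq[symmetric]) (simp add: mem_sigma_ball)
  show "cdiff (\<lambda>(z, g2, g3). fst (sigma_global g2 g3 z)) p"
    by (rule cdiff_transform[OF sigma_iter_cdiff[OF n, THEN conjunct1, folded p]])
       (rule eventually_mono[OF ev], use eq in auto)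
  show "cdiff (\<lambda>(z, g2, g3). snd (snd (sigma_global g2 g3 z))) p"
    by (rule cdiff_transform[OF sigma_iter_cdiff[OF n, THEN conjunct2, THEN conjunct2, folded p]])
       (rule eventually_mono[OF ev], use eq in auto)
qed

section \<open>Identification with the function defined by
  \<open>is_weierstrass_sigma\<close>\<close>

lemma wp_from_sigma:
  assumes f: "f holomorphic_on UNIV" and z: "f z \<noteq> 0"
  defines "\<phi> \<equiv> \<lambda>z. (deriv f z)\<^sup>2 - f z * deriv (deriv f) z"
  defines "P \<equiv> \<lambda>z. - deriv (logderiv f) z"
  shows "P z = \<phi> z / f z ^ 2" "deriv P z = (f z * deriv \<phi> z - 2 * deriv f z * \<phi> z) / f z ^ 3"
proof -
  have d: "(f has_field_derivative deriv f z) (at z)" "(deriv f has_field_derivative deriv (deriv f) z) (at z)"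
    "(\<phi> has_field_derivative deriv \<phi> z) (at z)" for z
    unfolding \<phi>_def using f
    by (auto intro!: holomorphic_derivI[of _ UNIV] holomorphic_intros holomorphic_deriv)
  have P: "P z = \<phi> z / f z ^ 2" if "f z \<noteq> 0" for z
  proof -
    have "(logderiv f has_field_derivative (deriv (deriv f) z * f z - deriv f z * deriv f z) / (f z * f z)) (at z)"
      unfolding logderiv_def[abs_def] by (intro derivative_intros d that)
    then show ?thesis
      using that by (simp add: P_def \<phi>_def DERIV_imp_deriv power2_eq_square field_simps)
  qed
  show "P z = \<phi> z / f z ^ 2" by (rule P[OF z])
  have "continuous_on UNIV f" using f by (rule holomorphic_on_imp_continuous_on)
  then have U: "open {z. f z \<noteq> 0}" by (intro open_Collect_neq continuous_intros)
  have "((\<lambda>z. \<phi> z / f z ^ 2) has_field_derivative (deriv \<phi> z * f z ^ 2 - \<phi> z * (2 * f z * deriv f z)) / (f z ^ 2 * f z ^ 2)) (at z)"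
    by (rule derivative_eq_intros d refl | use z in simp)+
  then have "(P has_field_derivative (deriv \<phi> z * f z ^ 2 - \<phi> z * (2 * f z * deriv f z)) / (f z ^ 2 * f z ^ 2)) (at z)"
    by (rule has_field_derivative_transform_within_open[OF _ U]) (use z P in auto)
  then have "deriv P z = (deriv \<phi> z * f z ^ 2 - \<phi> z * (2 * f z * deriv f z)) / (f z ^ 2 * f z ^ 2)"
    by (rule DERIV_imp_deriv)
  also have "\<dots> = (f z * deriv \<phi> z - 2 * deriv f z * \<phi> z) / f z ^ 3"
    using z by (simp add: field_simps power2_eq_square power3_eq_cube)
  finally show "deriv P z = (f z * deriv \<phi> z - 2 * deriv f z * \<phi> z) / f z ^ 3" .
qed

lemma cubic_divide:
  fixes s p q g2 g3 :: complex
  assumes "s \<noteq> 0"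
  shows "(q / s ^ 3)\<^sup>2 = 4 * (p / s ^ 2) ^ 3 - g2 * (p / s ^ 2) - g3 \<longleftrightarrow> q\<^sup>2 = 4 * p ^ 3 - g2 * p * s ^ 4 - g3 * s ^ 6"
proof -
  have "(q / s ^ 3)\<^sup>2 = q\<^sup>2 / s ^ 6" by (simp add: power_divide flip: power_mult)
  moreover have "4 * (p / s ^ 2) ^ 3 - g2 * (p / s ^ 2) - g3 = (4 * p ^ 3 - g2 * p * s ^ 4 - g3 * s ^ 6) / s ^ 6"
  proof -
    have 6: "s ^ 6 = s ^ 2 * s ^ 4" by (simp flip: power_add)
    have "g2 * (p / s ^ 2) = g2 * p * s ^ 4 / s ^ 6" 
      unfolding 6 times_divide_eq_right
      by (rule mult_divide_mult_cancel_right[OF power_not_zero[OF assms], symmetric])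
    moreover have "(p / s ^ 2) ^ 3 = p ^ 3 / s ^ 6" by (simp add: power_divide flip: power_mult)
    moreover have "g3 = g3 * s ^ 6 / s ^ 6" using assms by simp
    ultimately show ?thesis by (simp only: diff_divide_distrib times_divide_eq_right)
  qed
  ultimately show ?thesis using assms by simp
qed

text \<open>The definition gives the cubic only off the zeros of \<open>f\<close>. Multiplied by
  \<open>f\<close> it holds everywhere, and then \<open>f\<close> cancels by the identity
  theorem.\<close>

lemma is_weierstrass_sigma_imp_triple:
  assumes W: "is_weierstrass_sigma g2 g3 f"
  defines "\<phi> \<equiv> \<lambda>z. (deriv f z)\<^sup>2 - f z * deriv (deriv f) z"
  defines "q \<equiv> \<lambda>z. f z * deriv \<phi> z - 2 * deriv f z * \<phi> z"
  shows "sigma_triple g2 g3 UNIV f \<phi> q"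
proof -
  have f: "f holomorphic_on UNIV" and f1: "deriv f 0 = 1"
    using W by (auto simp: is_weierstrass_sigma_def)
  have \<phi>: "\<phi> holomorphic_on UNIV"
    unfolding \<phi>_def using f by (auto intro!: holomorphic_intros holomorphic_deriv)
  have q: "q holomorphic_on UNIV"
    unfolding q_def using f \<phi> by (auto intro!: holomorphic_intros holomorphic_deriv)
  obtain a where a: "f a \<noteq> 0"
  proof -
    have "\<exists>a. f a \<noteq> 0"
    proof (rule ccontr)
      assume "\<not> (\<exists>a. f a \<noteq> 0)"
      then have "f = (\<lambda>_. 0)" by auto
      with f1 show False by simp
    qed
    then show ?thesis using that by blast
  qed
  have "(q z)\<^sup>2 - (4 * \<phi> z ^ 3 - g2 * \<phi> z * f z ^ 4 - g3 * f z ^ 6) = 0" for z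
  proof (rule holomorphic_mult_eq_0[where f = f and S = UNIV and a = a and z = z
          and g = "\<lambda>z. (q z)\<^sup>2 - (4 * \<phi> z ^ 3 - g2 * \<phi> z * f z ^ 4 - g3 * f z ^ 6)"])
    show "(\<lambda>z. (q z)\<^sup>2 - (4 * \<phi> z ^ 3 - g2 * \<phi> z * f z ^ 4 - g3 * f z ^ 6)) holomorphic_on UNIV"
      using f \<phi> q by (intro holomorphic_intros)
    fix z
    show "f z * ((q z)\<^sup>2 - (4 * \<phi> z ^ 3 - g2 * \<phi> z * f z ^ 4 - g3 * f z ^ 6)) = 0"
    proof (cases "f z = 0")
      case False
      then have "(deriv (\<lambda>z. - deriv (logderiv f) z) z)\<^sup>2
          = 4 * (- deriv (logderiv f) z) ^ 3 - g2 * - deriv (logderiv f) z - g3"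
        using W unfolding is_weierstrass_sigma_def Let_def by blast
      then have "(q z / f z ^ 3)\<^sup>2 = 4 * (\<phi> z / f z ^ 2) ^ 3 - g2 * (\<phi> z / f z ^ 2) - g3"
        unfolding wp_from_sigma[OF f False, folded \<phi>_def] by (simp only: q_def \<phi>_def)
      then show ?thesis using cubic_divide[OF False] by simp
    qed simp
  qed (use f a in auto)
  then show ?thesis
    using f \<phi> q unfolding sigma_triple_def by (simp add: \<phi>_def q_def)
qed

text \<open>The constructed function has the defining property, and any other candidate agrees with
  it on each ball about 0. The radius \<open>norm z + 1\<close> reaches the given
  \<open>z\<close>.\<close>

lemma weierstrass_sigma_eq: "weierstrass_sigma z g2 g3 = fst (sigma_global g2 g3 z)"
proof -
  define f where "f z = fst (sigma_global g2 g3 z)" for z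
  define \<phi> where "\<phi> z = fst (snd (sigma_global g2 g3 z))" for z
  define q where "q z = snd (snd (sigma_global g2 g3 z))" for z
  have T: "sigma_triple g2 g3 UNIV f \<phi> q"
    using sigma_global_triple[of g2 g3] unfolding f_def \<phi>_def q_def .
  have odd: "f (- z) = - f z" for z
    using sigma_global_minus[of g2 g3 z] by (simp add: f_def case_prod_beta)
  have f1: "deriv f 0 = 1" using deriv_sigma_global[of g2 g3] unfolding f_def .
  have hol: "f holomorphic_on UNIV" using T by (simp add: sigma_triple_def)
  have \<phi>: "\<phi> = (\<lambda>z. (deriv f z)\<^sup>2 - f z * deriv (deriv f) z)"
    using T by (auto simp: sigma_triple_def)
  have "is_weierstrass_sigma g2 g3 f"
    unfolding is_weierstrass_sigma_def Let_def
  proof (intro conjI allI impI hol f1 odd)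
    fix z assume z: "f z \<noteq> 0"
    show "(deriv (\<lambda>z. - deriv (logderiv f) z) z)\<^sup>2
        = 4 * (- deriv (logderiv f) z) ^ 3 - g2 * - deriv (logderiv f) z - g3"
      unfolding wp_from_sigma[OF hol z, folded \<phi>] cubic_divide[OF z]
      using T unfolding sigma_triple_def by (metis UNIV_I)
  qed
  moreover have "f' = f" if W: "is_weierstrass_sigma g2 g3 f'" for f'
  proof
    fix z
    show "f' z = f z"
      by (rule sigma_triple_unique[OF sigma_triple_subset[OF is_weierstrass_sigma_imp_triple[OF W] subset_UNIV]
              sigma_triple_subset[OF T subset_UNIV], of "norm z + 1"])
         (use W f1 odd in \<open>auto simp: is_weierstrass_sigma_def add_nonneg_pos\<close>)
  qed
  ultimately have "(THE f. is_weierstrass_sigma g2 g3 f) = f"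
    by (rule the_equality)
  then show ?thesis by (simp add: weierstrass_sigma_def f_def)
qed

section \<open>The bilinear addition formula\<close>

text \<open>Let \<open>G(u, v)\<close> be the right-hand side at \<open>a = (u + v) / 2\<close>, \<open>b = (u - v) / 2\<close>. The differential
  equation gives \<open>\<partial>\<^sub>v (\<partial>\<^sub>u log G) = 0\<close>, so \<open>G\<close> separates; by symmetry and \<open>G(u, u) = f(u)\<^sup>2\<close> its square
  is \<open>f(u)\<^sup>2 f(v)\<^sup>2\<close>.\<close>

lemma sigma_triple_bilinear:
  fixes f \<phi> q :: "complex \<Rightarrow> complex"
  assumes T: "sigma_triple g2 g3 UNIV f \<phi> q" and f0: "f 0 = 0" "deriv f 0 = 1"
    and odd: "\<And>z. f (- z) = - f z" and even: "\<And>z. \<phi> (- z) = \<phi> z"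
  shows "f (a + b) * f (a - b) = f a ^ 2 * \<phi> b - \<phi> a * f b ^ 2"
proof -
  note d = sigma_triple_derivs[OF T open_UNIV UNIV_I]
  note e = sigma_triple_eqs[OF T UNIV_I]
  have at0: "\<phi> 0 = 1" "q 0 = -2" using sigma_triple_at_0[OF T _ f0] by auto
  have eq: "f z * deriv q z = 3 * deriv f z * q z + 6 * \<phi> z ^ 2 - g2 / 2 * f z ^ 4" for z
    by (rule sigma_triple_deriv_q[OF T, of 0]) (use at0 in auto)
  have cont: "continuous_on S f" "continuous_on S \<phi>" "continuous_on S q" for S
  proof -
    have "f holomorphic_on UNIV" "\<phi> holomorphic_on UNIV" "q holomorphic_on UNIV"
      using T unfolding sigma_triple_def by blast+
    then show "continuous_on S f" "continuous_on S \<phi>" "continuous_on S q"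
      by (auto intro: continuous_on_subset[OF holomorphic_on_imp_continuous_on])
  qed
  have hol: "f holomorphic_on S" "\<phi> holomorphic_on S" for S
  proof -
    have "f holomorphic_on UNIV" "\<phi> holomorphic_on UNIV"
      using T unfolding sigma_triple_def by blast+
    then show "f holomorphic_on S" "\<phi> holomorphic_on S"
      by (auto intro: holomorphic_on_subset)
  qed
  define P where "P z = \<phi> z / f z ^ 2" for z
  define P1 where "P1 z = q z / f z ^ 3" for z
  define Z where "Z z = deriv f z / f z" for z
  have dP: "(P has_field_derivative P1 z) (at z)" "(P1 has_field_derivative 6 * P z ^ 2 - g2 / 2) (at z)"
    "(Z has_field_derivative - P z) (at z)" "(f has_field_derivative f z * Z z) (at z)"
    "P1 z ^ 2 = 4 * P z ^ 3 - g2 * P z - g3" if z: "f z \<noteq> 0" for z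
  proof -
    have "(P has_field_derivative (deriv \<phi> z * f z ^ 2 - \<phi> z * (2 * f z * deriv f z)) / (f z ^ 2 * f z ^ 2)) (at z)"
      unfolding P_def[abs_def] by (rule derivative_eq_intros d refl | use z in simp)+
    also have "deriv \<phi> z * f z ^ 2 - \<phi> z * (2 * f z * deriv f z) = f z * q z"
      using e(2)[of z] by algebra
    finally show "(P has_field_derivative P1 z) (at z)"
      using z by (simp add: P1_def power2_eq_square power3_eq_cube mult.assoc)
    have "(P1 has_field_derivative (deriv q z * f z ^ 3 - q z * (3 * f z ^ 2 * deriv f z)) / (f z ^ 3 * f z ^ 3)) (at z)"
      unfolding P1_def[abs_def] by (rule derivative_eq_intros d refl | use z in simp)+
    also have "deriv q z * f z ^ 3 - q z * (3 * f z ^ 2 * deriv f z) = f z ^ 2 * (6 * \<phi> z ^ 2 - g2 / 2 * f z ^ 4)"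
      using eq[of z] by algebra
    also have "\<dots> / (f z ^ 3 * f z ^ 3) = 6 * P z ^ 2 - g2 / 2"
      using z by (simp add: P_def field_simps eval_nat_numeral)
    finally show "(P1 has_field_derivative 6 * P z ^ 2 - g2 / 2) (at z)" .
    have "(Z has_field_derivative (deriv (deriv f) z * f z - deriv f z * deriv f z) / (f z * f z)) (at z)"
      unfolding Z_def[abs_def] by (intro derivative_intros d z)
    also have "deriv (deriv f) z * f z - deriv f z * deriv f z = - \<phi> z"
      using e(1)[of z] by algebra
    finally show "(Z has_field_derivative - P z) (at z)" by (simp add: P_def power2_eq_square)
    show "(f has_field_derivative f z * Z z) (at z)" using d(1)[of z] z by (simp add: Z_def)
    show "P1 z ^ 2 = 4 * P z ^ 3 - g2 * P z - g3"
      unfolding P_def P1_def using cubic_divide[OF z] e(3) by blast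
  qed
  define G where "G u v = f ((u + v) / 2) ^ 2 * \<phi> ((u - v) / 2) - \<phi> ((u + v) / 2) * f ((u - v) / 2) ^ 2" for u v
  have G_sym: "G u v = G v u" for u v
  proof -
    have h: "(v - u) / 2 = - ((u - v) / 2)" by (simp add: field_simps)
    show ?thesis unfolding G_def h odd even add.commute[of v u] by simp
  qed
  have G_diag: "G u u = f u ^ 2" for u by (simp add: G_def f0 at0)
  have holG: "(\<lambda>u. G u v) holomorphic_on S" "(\<lambda>v. G u v) holomorphic_on S" for u v S
  proof -
    have c: "(\<lambda>u. g (h u)) holomorphic_on S" if "g holomorphic_on UNIV" "h holomorphic_on S" for g h :: "complex \<Rightarrow> complex"
      using holomorphic_on_compose_gen[OF that(2,1)] by (simp add: o_def)
    show "(\<lambda>u. G u v) holomorphic_on S" "(\<lambda>v. G u v) holomorphic_on S"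
      unfolding G_def by (intro holomorphic_intros c[OF hol(1)] c[OF hol(2)]; simp)+
  qed
  have ev0: "\<forall>\<^sub>F z in at 0. f z \<noteq> 0"
  proof -
    have "((\<lambda>y. (f y - f 0) / (y - 0)) \<longlongrightarrow> 1) (at 0)"
      using d(1)[of 0] f0 unfolding has_field_derivative_iff by simp
    then have "\<forall>\<^sub>F y in at 0. (f y - f 0) / (y - 0) \<noteq> 0" by (rule tendsto_imp_eventually_ne) simp
    then show ?thesis by eventually_elim (use f0 in auto)
  qed
  then obtain a0 where a0: "f a0 \<noteq> 0" using eventually_happens'[OF at_neq_bot] by blast
  \<comment> \<open>At \<open>b = 0\<close> the right-hand side is \<open>f a0 ^ 2\<close>, which is
    nonzero, so it stays nonzero for small \<open>b\<close>. This provides a base point where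
    logarithms make sense.\<close>
  have "((\<lambda>b. f a0 ^ 2 * \<phi> b - \<phi> a0 * f b ^ 2) \<longlongrightarrow> f a0 ^ 2 * \<phi> 0 - \<phi> a0 * f 0 ^ 2) (at 0)"
    using cont[of UNIV] by (intro tendsto_intros) (auto simp: continuous_on_def)
  then have "\<forall>\<^sub>F b in at 0. f a0 ^ 2 * \<phi> b - \<phi> a0 * f b ^ 2 \<noteq> 0"
    by (rule tendsto_imp_eventually_ne) (simp add: f0 at0 a0)
  from eventually_happens'[OF at_neq_bot eventually_conj[OF this ev0]]
  obtain b0 where b0: "f a0 ^ 2 * \<phi> b0 - \<phi> a0 * f b0 ^ 2 \<noteq> 0" "f b0 \<noteq> 0" by blast
  define u0 v0 where "u0 = a0 + b0" and "v0 = a0 - b0"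
  have uv0: "(u0 + v0) / 2 = a0" "(u0 - v0) / 2 = b0" by (simp_all add: u0_def v0_def)
  \<comment> \<open>Separation needs \<open>u\<close> and \<open>v\<close> to vary independently,
    hence a product neighbourhood. The product \<open>H\<close> is nonzero exactly where all three
    denominators below are.\<close>
  define H where "H = (\<lambda>p. f ((fst p + snd p) / 2) * f ((fst p - snd p) / 2) * G (fst p) (snd p))"
  have "continuous_on UNIV H"
    unfolding H_def G_def
    by (intro continuous_intros continuous_on_compose2[OF cont(1)[of UNIV]] continuous_on_compose2[OF cont(2)[of UNIV]]) auto
  then have "open {p. H p \<noteq> 0}" by (intro open_Collect_neq continuous_intros)
  moreover have "(u0, v0) \<in> {p. H p \<noteq> 0}" using a0 b0 by (simp add: H_def uv0 G_def)
  ultimately obtain A B where AB: "open A" "open B" "(u0, v0) \<in> A \<times> B" "A \<times> B \<subseteq> {p. H p \<noteq> 0}"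
    by (rule open_prod_elim)
  then have "u0 \<in> A" "v0 \<in> B" by auto
  obtain r where "r > 0" "ball u0 r \<subseteq> A" using openE[OF AB(1) \<open>u0 \<in> A\<close>] .
  moreover obtain s where "s > 0" "ball v0 s \<subseteq> B" using openE[OF AB(2) \<open>v0 \<in> B\<close>] .
  ultimately have rs: "r > 0" "ball u0 r \<subseteq> A" "s > 0" "ball v0 s \<subseteq> B" .
  have nz: "f ((u + v) / 2) \<noteq> 0" "f ((u - v) / 2) \<noteq> 0" "G u v \<noteq> 0" if "u \<in> ball u0 r" "v \<in> ball v0 s" for u v
  proof -
    have "(u, v) \<in> {p. H p \<noteq> 0}" using that rs AB(4) by blast
    then show "f ((u + v) / 2) \<noteq> 0" "f ((u - v) / 2) \<noteq> 0" "G u v \<noteq> 0" by (auto simp: H_def)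
  qed
  have G_eq: "G u v = f ((u + v) / 2) ^ 2 * f ((u - v) / 2) ^ 2 * (P ((u - v) / 2) - P ((u + v) / 2))"
    if "f ((u + v) / 2) \<noteq> 0" "f ((u - v) / 2) \<noteq> 0" for u v
    using that by (simp add: G_def P_def field_simps)
  have c1: "((\<lambda>u. F ((u + v) / 2)) has_field_derivative F' / 2) (at u)"
    "((\<lambda>v. F ((u + v) / 2)) has_field_derivative F' / 2) (at v)"
    if "(F has_field_derivative F') (at ((u + v) / 2))" for F :: "complex \<Rightarrow> complex" and F' u v
  proof -
    have "((\<lambda>u. (u + v) / 2) has_field_derivative 1 / 2) (at u)" "((\<lambda>v. (u + v) / 2) has_field_derivative 1 / 2) (at v)"
      by (auto intro!: derivative_eq_intros)
    from DERIV_chain2[where f = F, OF that this(1)] DERIV_chain2[where f = F, OF that this(2)]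
    show "((\<lambda>u. F ((u + v) / 2)) has_field_derivative F' / 2) (at u)"
      "((\<lambda>v. F ((u + v) / 2)) has_field_derivative F' / 2) (at v)" by simp_all
  qed
  have c2: "((\<lambda>u. F ((u - v) / 2)) has_field_derivative F' / 2) (at u)"
    "((\<lambda>v. F ((u - v) / 2)) has_field_derivative - F' / 2) (at v)"
    if "(F has_field_derivative F') (at ((u - v) / 2))" for F :: "complex \<Rightarrow> complex" and F' u v
  proof -
    have "((\<lambda>u. (u - v) / 2) has_field_derivative 1 / 2) (at u)" "((\<lambda>v. (u - v) / 2) has_field_derivative - 1 / 2) (at v)"
      by (auto intro!: derivative_eq_intros)
    from DERIV_chain2[where f = F, OF that this(1)] DERIV_chain2[where f = F, OF that this(2)]
    show "((\<lambda>u. F ((u - v) / 2)) has_field_derivative F' / 2) (at u)"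
      "((\<lambda>v. F ((u - v) / 2)) has_field_derivative - F' / 2) (at v)" by simp_all
  qed
  \<comment> \<open>This is the \<open>u\<close>-derivative of \<open>log G\<close>, read off from
    \<open>G = f(x)\<^sup>2 f(y)\<^sup>2 (P(y) - P(x))\<close> with \<open>x = (u + v) / 2\<close>
    and \<open>y = (u - v) / 2\<close>.\<close>
  define \<Lambda> where "\<Lambda> u v = Z ((u + v) / 2) + Z ((u - v) / 2)
      + (P1 ((u - v) / 2) - P1 ((u + v) / 2)) / (2 * (P ((u - v) / 2) - P ((u + v) / 2)))" for u v
  have dG: "((\<lambda>u. G u v) has_field_derivative G u v * \<Lambda> u v) (at u)"
    and d\<Lambda>: "((\<lambda>v. \<Lambda> u v) has_field_derivative 0) (at v)"
    if uv: "u \<in> ball u0 r" "v \<in> ball v0 s" for u v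
  proof -
    note n = nz[OF uv]
    note D1 = c1[OF dP(1)[OF n(1)]] c1[OF dP(2)[OF n(1)]] c1[OF dP(3)[OF n(1)]] c1[OF dP(4)[OF n(1)]]
    note D2 = c2[OF dP(1)[OF n(2)]] c2[OF dP(2)[OF n(2)]] c2[OF dP(3)[OF n(2)]] c2[OF dP(4)[OF n(2)]]
    define x y where "x = (u + v) / 2" and "y = (u - v) / 2"
    have Pne: "P y - P x \<noteq> 0" using n(3) G_eq[OF n(1,2)] unfolding x_def y_def by auto
    have "((\<lambda>u. f ((u + v) / 2) ^ 2 * f ((u - v) / 2) ^ 2 * (P ((u - v) / 2) - P ((u + v) / 2)))
        has_field_derivative (f x ^ 2 * Z x * f y ^ 2 + f x ^ 2 * (f y ^ 2 * Z y)) * (P y - P x)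
          + f x ^ 2 * f y ^ 2 * ((P1 y - P1 x) / 2)) (at u)"
      unfolding x_def y_def
      by (rule derivative_eq_intros D1 D2 refl)+ (simp add: field_simps power2_eq_square)
    also have "(f x ^ 2 * Z x * f y ^ 2 + f x ^ 2 * (f y ^ 2 * Z y)) * (P y - P x)
          + f x ^ 2 * f y ^ 2 * ((P1 y - P1 x) / 2) = G u v * \<Lambda> u v"
    proof -
      have "(P1 y - P1 x) / 2 = (P y - P x) * ((P1 y - P1 x) / (2 * (P y - P x)))"
      proof -
        have "D / 2 = E * (D / (2 * E))" if "E \<noteq> 0" for D E :: complex using that by simp
        then show ?thesis using Pne by blast
      qed
      then show ?thesis unfolding G_eq[OF n(1,2)] \<Lambda>_def x_def[symmetric] y_def[symmetric] by algebra
    qed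
    finally show "((\<lambda>u. G u v) has_field_derivative G u v * \<Lambda> u v) (at u)"
      by (rule has_field_derivative_transform_within_open[of _ _ _ "ball u0 r"])
         (use uv G_eq nz in auto)
    have "((\<lambda>v. \<Lambda> u v) has_field_derivative - P x / 2 + - (- P y) / 2
        + ((- (6 * P y ^ 2 - g2 / 2) / 2 - (6 * P x ^ 2 - g2 / 2) / 2) * (2 * (P y - P x))
           - (P1 y - P1 x) * (2 * (- P1 y / 2 - P1 x / 2))) / (2 * (P y - P x) * (2 * (P y - P x)))) (at v)"
    proof -
      have ne: "2 * (P y - P x) \<noteq> 0" using Pne by simp
      show ?thesis
        using ne unfolding \<Lambda>_def x_def y_def
        by (intro DERIV_add DERIV_diff DERIV_divide DERIV_cmult D1 D2)
    qed
    \<comment> \<open>The decisive cancellation: the cubic eliminates the squares of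
      \<open>P1\<close>, and both \<open>g2\<close> and \<open>g3\<close> disappear, leaving
      \<open>2 * (P x - P y) ^ 3\<close>. After division this offsets the contribution of the two
      terms \<open>Z\<close>.\<close>
    also have "(- (6 * P y ^ 2 - g2 / 2) / 2 - (6 * P x ^ 2 - g2 / 2) / 2) * (2 * (P y - P x))
           - (P1 y - P1 x) * (2 * (- P1 y / 2 - P1 x / 2)) = (P x - P y) / 2 * (2 * (P y - P x) * (2 * (P y - P x)))"
    proof -
      have "P1 x ^ 2 = 4 * P x ^ 3 - g2 * P x - g3" "P1 y ^ 2 = 4 * P y ^ 3 - g2 * P y - g3"
        unfolding x_def y_def using dP(5) n(1,2) by auto
      note p1 = this
      have "(- (6 * P y ^ 2 - g2 / 2) / 2 - (6 * P x ^ 2 - g2 / 2) / 2) * (2 * (P y - P x))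
           - (P1 y - P1 x) * (2 * (- P1 y / 2 - P1 x / 2))
          = (P1 y ^ 2 - P1 x ^ 2) - (6 * P x ^ 2 + 6 * P y ^ 2 - g2) * (P y - P x)"
        by (simp add: field_simps power2_eq_square)
      also have "\<dots> = 2 * (P x - P y) ^ 3" unfolding p1 by algebra
      also have "\<dots> = (P x - P y) / 2 * (2 * (P y - P x) * (2 * (P y - P x)))"
        by (simp add: field_simps power3_eq_cube)
      finally show ?thesis .
    qed
    also have "- P x / 2 + - (- P y) / 2 + (P x - P y) / 2 * (2 * (P y - P x) * (2 * (P y - P x)))
        / (2 * (P y - P x) * (2 * (P y - P x))) = 0"
    proof -
      have "- X / 2 + - (- Y) / 2 + (X - Y) / 2 * (E * E) / (E * E) = 0" if "E \<noteq> 0" for X Y E :: complex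
        using that by (simp add: field_simps)
      from this[of "2 * (P y - P x)"] show ?thesis using Pne by fastforce
    qed
    finally show "((\<lambda>v. \<Lambda> u v) has_field_derivative 0) (at v)" .
  qed
  have \<Lambda>_const: "\<Lambda> u v = \<Lambda> u v0" if uv: "u \<in> ball u0 r" "v \<in> ball v0 s" for u v
  proof -
    have "(\<lambda>v. \<Lambda> u v) constant_on ball v0 s"
      using d\<Lambda> uv(1) by (intro has_field_derivative_0_imp_constant_on) auto
    then show ?thesis using uv(2) rs(3) unfolding constant_on_def by (metis centre_in_ball)
  qed
  \<comment> \<open>Since \<open>\<Lambda>\<close> does not depend on \<open>v\<close>, the ratio
    \<open>G u v / G u v0\<close> does not depend on \<open>u\<close>. The multiplied-out form also
    makes sense at zeros of \<open>G\<close>.\<close>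
  have box: "G u v * G u0 v0 = G u v0 * G u0 v" if uv: "u \<in> ball u0 r" "v \<in> ball v0 s" for u v
  proof -
    have v0: "v0 \<in> ball v0 s" "u0 \<in> ball u0 r" using rs by auto
    have "((\<lambda>u. G u v / G u v0) has_field_derivative 0) (at u)" if u: "u \<in> ball u0 r" for u
    proof -
      have "((\<lambda>u. G u v / G u v0) has_field_derivative
          (G u v * \<Lambda> u v * G u v0 - G u v * (G u v0 * \<Lambda> u v0)) / (G u v0 * G u v0)) (at u)"
        by (intro derivative_intros dG u uv v0 nz)
      then show ?thesis using \<Lambda>_const[OF u uv(2)] by (simp add: mult_ac)
    qed
    then have "(\<lambda>u. G u v / G u v0) constant_on ball u0 r"
      by (intro has_field_derivative_0_imp_constant_on) auto
    then have "G u v / G u v0 = G u0 v / G u0 v0" using uv v0 unfolding constant_on_def by metis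
    then show ?thesis using nz(3)[OF uv(1) v0(1)] nz(3)[OF v0(2,1)] by (simp add: field_simps)
  qed
  \<comment> \<open>Analytic continuation in one variable at a time: here in \<open>u\<close>, and
    next in \<open>v\<close>.\<close>
  have box': "G u v * G u0 v0 = G u v0 * G u0 v" if v: "v \<in> ball v0 s" for u v
    by (rule analytic_continuation_open[where s = "ball u0 r" and s' = UNIV and z = u])
       (use rs v in \<open>auto intro!: holomorphic_intros holG box\<close>)
  have sep: "G u v * G u0 v0 = G u v0 * G u0 v" for u v
    by (rule analytic_continuation_open[where s = "ball v0 s" and s' = UNIV and z = v])
       (use rs in \<open>auto intro!: holomorphic_intros holG box'\<close>)
  have "G u0 v0 \<noteq> 0" using nz rs by simp
  \<comment> \<open>Separation gives \<open>G u v * G v u = G u u * G v v\<close>; symmetry and the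
    diagonal values do the rest.\<close>
  have sq: "G u v ^ 2 = f u ^ 2 * f v ^ 2" for u v
  proof -
    have "(G u v * G u0 v0) * (G v u * G u0 v0) = (G u u * G u0 v0) * (G v v * G u0 v0)"
      unfolding sep by (simp add: mult_ac)
    then show ?thesis using \<open>G u0 v0 \<noteq> 0\<close> by (simp add: G_diag G_sym[of v u] power2_eq_square)
  qed
  have "G u v = f u * f v" for u v
  proof (cases "f u = 0")
    case True
    then show ?thesis using sq[of u v] by simp
  next
    case False
    \<comment> \<open>The sign of the square root is settled on the diagonal: at
      \<open>v = u\<close> the factor \<open>G u v + f u * f v\<close> equals
      \<open>2 * f u ^ 2\<close>, so the other factor vanishes identically in
      \<open>v\<close>.\<close>
    have "G u v - f u * f v = 0"
    proof (rule holomorphic_mult_eq_0[where f = "\<lambda>v. G u v + f u * f v" and g = "\<lambda>v. G u v - f u * f v"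
            and S = UNIV and a = u and z = v])
      show "(G u v + f u * f v) * (G u v - f u * f v) = 0" for v
        using sq[of u v] by algebra
      show "G u u + f u * f u \<noteq> 0" using False by (simp add: G_diag power2_eq_square)
    qed (auto intro!: holomorphic_intros holG hol)
    then show ?thesis by simp
  qed
  from this[of "a + b" "a - b"] show ?thesis by (simp add: G_def)
qed

section \<open>The Somos-5 relation over the complex numbers\<close>

lemma weierstrass_sigma_holomorphic: "(\<lambda>z. weierstrass_sigma z g2 g3) holomorphic_on UNIV"
  using sigma_global_triple[of g2 g3] by (simp add: weierstrass_sigma_eq sigma_triple_def)

lemma deriv_weierstrass_sigma_0: "deriv (\<lambda>z. weierstrass_sigma z g2 g3) 0 = 1"
  using deriv_sigma_global by (simp add: weierstrass_sigma_eq)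

lemma weierstrass_sigma_nontrivial: "\<exists>z. weierstrass_sigma (2 * z) g2 g3 \<noteq> 0"
proof (rule ccontr)
  assume "\<not> (\<exists>z. weierstrass_sigma (2 * z) g2 g3 \<noteq> 0)"
  then have "weierstrass_sigma (2 * (z / 2)) g2 g3 = 0" for z by blast
  then have "(\<lambda>z. weierstrass_sigma z g2 g3) = (\<lambda>z. 0)" by simp
  with deriv_weierstrass_sigma_0[of g2 g3] show False by simp
qed

lemma weierstrass_sigma_compose_holomorphic:
  "h holomorphic_on UNIV \<Longrightarrow> (\<lambda>z. weierstrass_sigma (h z) g2 g3) holomorphic_on UNIV"
  using holomorphic_on_compose_gen[OF _ weierstrass_sigma_holomorphic, of h UNIV] by (simp add: o_def)

lemma weierstrass_sigma_cdiff: "cdiff (\<lambda>(z, g2, g3). weierstrass_sigma z g2 g3) p"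
  using sigma_global_cdiff(1) by (simp add: weierstrass_sigma_eq)

lemma weierstrass_sigma_bilinear:
  "weierstrass_sigma (a + b) g2 g3 * weierstrass_sigma (a - b) g2 g3 =
    weierstrass_sigma a g2 g3 ^ 2 * fst (snd (sigma_global g2 g3 b))
    - fst (snd (sigma_global g2 g3 a)) * weierstrass_sigma b g2 g3 ^ 2"
  unfolding weierstrass_sigma_eq
  by (rule sigma_triple_bilinear[OF sigma_global_triple])
     (simp_all add: sigma_global_at_0 deriv_sigma_global sigma_global_minus case_prod_beta)

lemma weierstrass_sigma_double:
  "weierstrass_sigma (2 * z) g2 g3 = - weierstrass_sigma z g2 g3 * snd (snd (sigma_global g2 g3 z))"
  unfolding weierstrass_sigma_eq sigma_global_dup by (simp add: sigma_dup_def Let_def case_prod_beta)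

lemma weierstrass_sigma_minus: "weierstrass_sigma (- z) g2 g3 = - weierstrass_sigma z g2 g3"
  unfolding weierstrass_sigma_eq sigma_global_minus by (simp add: case_prod_beta)

text \<open>Duplication at \<open>2 * w\<close> makes the quotient \<open>- q (2 * w)\<close>
  wherever \<open>\<sigma>(2 * w)\<close> is nonzero, which holds on a punctured neighbourhood of
  every point. Continuity of \<open>q\<close> then gives the value that \<open>remove_sings\<close>
  assigns.\<close>

lemma sigma_quotient_eq: "sigma_quotient z g2 g3 = - snd (snd (sigma_global g2 g3 (2 * z)))"
proof -
  define q where "q z = snd (snd (sigma_global g2 g3 z))" for z
  obtain b where b: "weierstrass_sigma (2 * b) g2 g3 \<noteq> 0" using weierstrass_sigma_nontrivial by blast
  have "(\<lambda>w. weierstrass_sigma (2 * w) g2 g3) holomorphic_on UNIV"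
    by (intro weierstrass_sigma_compose_holomorphic holomorphic_intros)
  from non_zero_neighbour_alt[OF this open_UNIV connected_UNIV UNIV_I UNIV_I b]
  have "\<forall>\<^sub>F w in at z. weierstrass_sigma (2 * w) g2 g3 \<noteq> 0" by (rule eventually_mono) simp
  then have "\<forall>\<^sub>F w in at z. - q (2 * w) = weierstrass_sigma (4 * w) g2 g3 / weierstrass_sigma (2 * w) g2 g3"
  proof eventually_elim
    case (elim w)
    then show ?case using weierstrass_sigma_double[of "2 * w" g2 g3] by (simp add: q_def)
  qed
  moreover have "((\<lambda>w. - q (2 * w)) \<longlongrightarrow> - q (2 * z)) (at z)"
  proof -
    have "q holomorphic_on UNIV"
      using sigma_global_triple[of g2 g3] unfolding q_def[abs_def] sigma_triple_def by blast
    then have "continuous_on UNIV q" by (rule holomorphic_on_imp_continuous_on)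
    then have "isCont q (2 * z)" by (simp add: continuous_on_eq_continuous_at)
    moreover have "((\<lambda>w. 2 * w) \<longlongrightarrow> 2 * z) (at z)" by (intro tendsto_intros)
    ultimately show ?thesis by (intro tendsto_minus isCont_tendsto_compose[of _ q])
  qed
  ultimately have "((\<lambda>w. weierstrass_sigma (4 * w) g2 g3 / weierstrass_sigma (2 * w) g2 g3) \<longlongrightarrow> - q (2 * z)) (at z)"
    by (rule Lim_transform_eventually[rotated])
  then show ?thesis unfolding sigma_quotient_def q_def by (rule remove_sings_eqI)
qed

lemma sigma_quotient_cdiff: "cdiff (\<lambda>(z, g2, g3). sigma_quotient z g2 g3) p"
proof -
  have "cdiff (\<lambda>v. (\<lambda>(z, g2, g3). snd (snd (sigma_global g2 g3 z))) (2 * fst v, fst (snd v), snd (snd v))) p"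
    by (rule cdiff_compose[OF sigma_global_cdiff(2)]) (intro cdiff_mult cdiff_const cdiff_fst cdiff_fst_snd cdiff_snd_snd)+
  from cdiff_uminus[OF this] show ?thesis by (simp add: sigma_quotient_eq case_prod_beta')
qed

lemma sigma_quotient_holomorphic: "(\<lambda>z. sigma_quotient z g2 g3) holomorphic_on UNIV"
proof -
  have "(\<lambda>z. snd (snd (sigma_global g2 g3 z))) holomorphic_on UNIV"
    using sigma_global_triple[of g2 g3] unfolding sigma_triple_def by blast
  from holomorphic_on_compose_gen[OF _ this, of "\<lambda>z. 2 * z" UNIV]
  show ?thesis unfolding sigma_quotient_eq o_def by (auto intro!: holomorphic_intros)
qed

lemma weierstrass_sigma_quadruple:
  "weierstrass_sigma (4 * z) g2 g3 = weierstrass_sigma (2 * z) g2 g3 * sigma_quotient z g2 g3"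
  using weierstrass_sigma_double[of "2 * z" g2 g3] by (simp add: sigma_quotient_eq)

text \<open>The six indices are symmetric about \<open>z + 5 * k / 2\<close>, which explains the
  half steps: \<open>w\<close> plus or minus \<open>5 h\<close>, \<open>3 h\<close>,
  \<open>h\<close> are the arguments \<open>z + j * k\<close>. Each term of the resulting three-term
  relation contains \<open>\<sigma>(2 * k)\<close>, after factoring \<open>\<sigma>(4 * k)\<close>.
  As this may vanish at the given \<open>k\<close>, it is cancelled with \<open>k\<close> as a
  variable.\<close>

lemma somos5_sigma:
  fixes z k g2 g3 :: complex
  defines "s \<equiv> \<lambda>w. weierstrass_sigma w g2 g3"
  shows "s k * s z * s (z + 5 * k) = s (3 * k) * s (z + k) * s (z + 4 * k)
     - sigma_quotient k g2 g3 * s k * s (z + 2 * k) * s (z + 3 * k)"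
proof -
  define q where "q k = sigma_quotient k g2 g3" for k
  define \<phi> where "\<phi> w = fst (snd (sigma_global g2 g3 w))" for w
  have B: "s (a + b) * s (a - b) = s a ^ 2 * \<phi> b - \<phi> a * s b ^ 2" for a b
    unfolding s_def \<phi>_def by (rule weierstrass_sigma_bilinear)
  define D where "D k = s k * s z * s (z + 5 * k) - (s (3 * k) * s (z + k) * s (z + 4 * k)
     - q k * s k * s (z + 2 * k) * s (z + 3 * k))" for k
  obtain b where b: "s (2 * b) \<noteq> 0" using weierstrass_sigma_nontrivial unfolding s_def by blast
  have "D k = 0"
  proof (rule holomorphic_mult_eq_0[where f = "\<lambda>k. s (2 * k)" and g = D and z = k and S = UNIV and a = b])
    show "(\<lambda>k. s (2 * k)) holomorphic_on UNIV" "D holomorphic_on UNIV"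
      unfolding D_def[abs_def] s_def q_def
      by (intro holomorphic_intros weierstrass_sigma_compose_holomorphic sigma_quotient_holomorphic)+
    fix k
    \<comment> \<open>Pluecker relation for the values at \<open>w, 5 h, 3 h, h\<close> of the vector \<open>(\<sigma>\<^sup>2, \<phi>)\<close>\<close>
    define w h where "w = z + 5 * (k / 2)" and "h = k / 2"
    have sums: "w + 5 * h = z + 5 * k" "w - 5 * h = z" "3 * h + h = 2 * k" "3 * h - h = k"
      "w + 3 * h = z + 4 * k" "w - 3 * h = z + k" "h + 5 * h = 3 * k" "h - 5 * h = - (2 * k)"
      "w + h = z + 3 * k" "w - h = z + 2 * k" "5 * h + 3 * h = 4 * k" "5 * h - 3 * h = k"
      by (simp_all add: w_def h_def field_simps)
    have "s (z + 5 * k) * s z * (s (2 * k) * s k) + s (z + 4 * k) * s (z + k) * (s (3 * k) * s (- (2 * k)))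
        + s (z + 3 * k) * s (z + 2 * k) * (s (4 * k) * s k) = 0"
      unfolding B[of w "5 * h", unfolded sums] B[of "3 * h" h, unfolded sums] B[of w "3 * h", unfolded sums]
        B[of h "5 * h", unfolded sums] B[of w h, unfolded sums] B[of "5 * h" "3 * h", unfolded sums]
      by algebra
    moreover have "s (- (2 * k)) = - s (2 * k)" unfolding s_def by (rule weierstrass_sigma_minus)
    moreover have "s (4 * k) = s (2 * k) * q k"
      unfolding s_def q_def by (rule weierstrass_sigma_quadruple)
    ultimately show "s (2 * k) * D k = 0" unfolding D_def by algebra
  qed (use b in auto)
  then show ?thesis by (simp add: D_def q_def)
qed

section \<open>From \<sigma> to the gauged sequence\<close>

lemma power_int_shift:
  fixes x :: complex
  assumes "x \<noteq> 0"
  shows "x powi (m + 1) = x powi m * x" "x powi (m + 2) = x powi m * x ^ 2" "x powi (m + 3) = x powi m * x ^ 3"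
  using assms by (simp_all add: power_int_add power2_eq_square power3_eq_cube)

lemma power_int_square_shift:
  fixes x :: complex
  assumes "x \<noteq> 0"
  shows "x powi ((m + 1) ^ 2) = x powi (m ^ 2) * (x powi m) ^ 2 * x"
    "x powi ((m + 2) ^ 2) = x powi (m ^ 2) * (x powi m) ^ 4 * x ^ 4"
    "x powi ((m + 3) ^ 2) = x powi (m ^ 2) * (x powi m) ^ 6 * x ^ 9"
proof -
  have p: "x powi (m ^ 2 + of_nat j * m + of_nat l) = x powi (m ^ 2) * (x powi m) ^ j * x ^ l" for j l :: nat
  proof -
    have "x powi (of_nat j * m) = (x powi m) ^ j"
      by (simp add: power_int_mult mult.commute[of _ m])
    then show ?thesis using assms by (simp add: power_int_add)
  qed
  have "(m + 1) ^ 2 = m ^ 2 + of_nat 2 * m + of_nat 1" "(m + 2) ^ 2 = m ^ 2 + of_nat 4 * m + of_nat 4"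
    "(m + 3) ^ 2 = m ^ 2 + of_nat 6 * m + of_nat 9"
    by (simp_all add: power2_eq_square algebra_simps)
  then show "x powi ((m + 1) ^ 2) = x powi (m ^ 2) * (x powi m) ^ 2 * x"
    "x powi ((m + 2) ^ 2) = x powi (m ^ 2) * (x powi m) ^ 4 * x ^ 4"
    "x powi ((m + 3) ^ 2) = x powi (m ^ 2) * (x powi m) ^ 6 * x ^ 9"
    by (simp_all only: p) simp_all
qed

text \<open>The condition on \<open>bp\<close> amounts to \<open>bp = bm * s ^ 4\<close>. With it
  the powers of \<open>bp\<close>, \<open>bm\<close>, \<open>\<mu>\<close> left over after removing
  the common factors agree for even and odd \<open>n\<close>: both cases become the relation for
  \<sigma> divided by \<open>s\<close>.\<close>

lemma somos5_gauge:
  fixes ap am bp bm \<mu> s s3 q :: complex and \<sigma> x :: "int \<Rightarrow> complex"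
  assumes s: "s \<noteq> 0" and bm: "bm \<noteq> 0"
    and \<mu>: "\<mu> = - (s powi (-4))" and bp: "bp = - inverse \<mu> * bm"
    and \<sigma>: "\<And>n. s * \<sigma> n * \<sigma> (n + 5) = s3 * \<sigma> (n + 1) * \<sigma> (n + 4) - q * s * \<sigma> (n + 2) * \<sigma> (n + 3)"
    and x: "\<And>n. x n = pm ap am n * pm bp bm n powi (n div 2) * \<mu> powi ((n div 2)\<^sup>2) * \<sigma> n"
  shows "x n * x (n + 5) = s3 / s ^ 9 * x (n + 1) * x (n + 4) + - (q / s ^ 12) * x (n + 2) * x (n + 3)"
proof -
  \<comment> \<open>With \<open>i * s = 1\<close> as the only relation, all negative powers of
    \<open>s\<close> become polynomial and \<open>algebra\<close> applies.\<close>
  define i where "i = inverse s"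
  have i: "i * s = 1" using s by (simp add: i_def)
  have \<mu>i: "\<mu> = - (i ^ 4)" unfolding \<mu> i_def by (simp add: power_int_minus power_inverse)
  have \<mu>0: "\<mu> \<noteq> 0" using s by (simp add: \<mu>i i_def)
  have bps: "bp = bm * s ^ 4" unfolding bp \<mu>i i_def by (simp add: power_inverse)
  have bp0: "bp \<noteq> 0" using s bm by (simp add: bps)
  have \<alpha>: "s3 / s ^ 9 = s3 * i ^ 9" "- (q / s ^ 12) = - q * i ^ 12"
    by (simp_all add: i_def power_inverse divide_inverse)
  note sh = power_int_shift[OF bp0] power_int_shift[OF bm] power_int_square_shift[OF \<mu>0]
  have i4: "i ^ 4 * s ^ 4 = 1" using i by (simp flip: power_mult_distrib)
  define m where "m = n div 2"
  show ?thesis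
  proof (cases "even n")
    case True
    then have n: "n = 2 * m" by (simp add: m_def)
    have d: "n div 2 = m" "(n + 1) div 2 = m" "(n + 2) div 2 = m + 1" "(n + 3) div 2 = m + 1"
      "(n + 4) div 2 = m + 2" "(n + 5) div 2 = m + 2" unfolding n by simp_all
    define p r A B where "p = bp powi m" and "r = bm powi m" and "A = \<mu> powi (m\<^sup>2)" and "B = \<mu> powi m"
    have X: "x n = ap * p * A * \<sigma> n" "x (n + 1) = am * r * A * \<sigma> (n + 1)"
      "x (n + 2) = ap * (p * bp) * (A * B ^ 2 * \<mu>) * \<sigma> (n + 2)"
      "x (n + 3) = am * (r * bm) * (A * B ^ 2 * \<mu>) * \<sigma> (n + 3)"
      "x (n + 4) = ap * (p * bp ^ 2) * (A * B ^ 4 * \<mu> ^ 4) * \<sigma> (n + 4)"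
      "x (n + 5) = am * (r * bm ^ 2) * (A * B ^ 4 * \<mu> ^ 4) * \<sigma> (n + 5)"
      using True by (simp_all add: x d pm_def sh p_def r_def A_def B_def)
    have key: "bm ^ 2 * \<mu> ^ 4 * (\<sigma> n * \<sigma> (n + 5)) = s3 * i ^ 9 * bp ^ 2 * \<mu> ^ 4 * (\<sigma> (n + 1) * \<sigma> (n + 4))
        - q * i ^ 12 * bp * bm * \<mu> ^ 2 * (\<sigma> (n + 2) * \<sigma> (n + 3))"
      using \<sigma>[of n] i unfolding bps \<mu>i by algebra
    show ?thesis unfolding X \<alpha> using key by algebra
  next
    case False
    then have n: "n = 2 * m + 1" by (simp add: m_def)
    have d: "n div 2 = m" "(n + 1) div 2 = m + 1" "(n + 2) div 2 = m + 1" "(n + 3) div 2 = m + 2"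
      "(n + 4) div 2 = m + 2" "(n + 5) div 2 = m + 3" unfolding n by simp_all
    define p r A B where "p = bp powi m" and "r = bm powi m" and "A = \<mu> powi (m\<^sup>2)" and "B = \<mu> powi m"
    have X: "x n = am * r * A * \<sigma> n" "x (n + 1) = ap * (p * bp) * (A * B ^ 2 * \<mu>) * \<sigma> (n + 1)"
      "x (n + 2) = am * (r * bm) * (A * B ^ 2 * \<mu>) * \<sigma> (n + 2)"
      "x (n + 3) = ap * (p * bp ^ 2) * (A * B ^ 4 * \<mu> ^ 4) * \<sigma> (n + 3)"
      "x (n + 4) = am * (r * bm ^ 2) * (A * B ^ 4 * \<mu> ^ 4) * \<sigma> (n + 4)"
      "x (n + 5) = ap * (p * bp ^ 3) * (A * B ^ 6 * \<mu> ^ 9) * \<sigma> (n + 5)"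
      using False by (simp_all add: x d pm_def sh p_def r_def A_def B_def)
    have key: "bp ^ 2 * \<mu> ^ 4 * (\<sigma> n * \<sigma> (n + 5)) = s3 * i ^ 9 * bm ^ 2 * (\<sigma> (n + 1) * \<sigma> (n + 4))
        - q * i ^ 12 * bp * bm * (\<sigma> (n + 2) * \<sigma> (n + 3))"
      using \<sigma>[of n] i unfolding bps \<mu>i by algebra
    show ?thesis unfolding X \<alpha> using key by algebra
  qed
qed

section \<open>Dual numbers as jets\<close>

text \<open>A dual number \<open>u\<close> is the first-order jet at \<open>0\<close> of a curve in the complex plane.\<close>

definition has_jet :: "(complex \<Rightarrow> complex) \<Rightarrow> dual_num \<Rightarrow> bool" where
  "has_jet f u \<longleftrightarrow> f 0 = ev u \<and> (f has_field_derivative od u) (at 0)"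

lemma ev_od_simps [simp]:
  "ev (u + v) = ev u + ev v" "od (u + v) = od u + od v" "ev (u - v) = ev u - ev v" "od (u - v) = od u - od v"
  "ev (- u) = - ev u" "od (- u) = - od u" "ev (u * v) = ev u * ev v" "od (u * v) = ev u * od v + od u * ev v"
  "ev (inverse u) = inverse (ev u)" "od (inverse u) = - od u / (ev u)\<^sup>2"
  "ev 0 = 0" "od 0 = 0" "ev 1 = 1" "od 1 = 0"
  by (simp_all add: plus_dual_num_def minus_dual_num_def uminus_dual_num_def times_dual_num_def
      inverse_dual_num_def zero_dual_num_def one_dual_num_def)

lemma ev_od_of_int: "ev (of_int n) = of_int n" "od (of_int n) = 0"
proof -
  have nat: "ev (of_nat k) = of_nat k \<and> od (of_nat k) = 0" for k
    by (induction k) auto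
  then show "ev (of_int n) = of_int n" "od (of_int n) = 0"
    by (cases n; simp)+
qed

lemma has_jet_line: "has_jet (\<lambda>t. ev u + t * od u) u"
  unfolding has_jet_def by (auto intro!: derivative_eq_intros)

lemma has_jet_mult: "has_jet f u \<Longrightarrow> has_jet g v \<Longrightarrow> has_jet (\<lambda>t. f t * g t) (u * v)"
  unfolding has_jet_def by (auto intro!: derivative_eq_intros simp: algebra_simps)

lemma has_jet_add: "has_jet f u \<Longrightarrow> has_jet g v \<Longrightarrow> has_jet (\<lambda>t. f t + g t) (u + v)"
  unfolding has_jet_def by (auto intro!: derivative_eq_intros)

lemma has_jet_uminus: "has_jet f u \<Longrightarrow> has_jet (\<lambda>t. - f t) (- u)"
  unfolding has_jet_def by (auto intro!: derivative_eq_intros)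

lemma has_jet_of_int: "has_jet (\<lambda>t. of_int n) (of_int n)"
  unfolding has_jet_def by (simp add: ev_od_of_int)

lemma has_jet_inverse: "has_jet f u \<Longrightarrow> ev u \<noteq> 0 \<Longrightarrow> has_jet (\<lambda>t. inverse (f t)) (inverse u)"
  unfolding has_jet_def by (auto intro!: derivative_eq_intros simp: field_simps power2_eq_square)

lemma has_jet_divide: "has_jet f u \<Longrightarrow> has_jet g v \<Longrightarrow> ev v \<noteq> 0 \<Longrightarrow> has_jet (\<lambda>t. f t / g t) (u / v)"
  unfolding divide_inverse divide_dual_num_def by (intro has_jet_mult has_jet_inverse)

lemma has_jet_power: "has_jet f u \<Longrightarrow> has_jet (\<lambda>t. f t ^ n) (u ^ n)"
proof (induction n)
  case 0
  then show ?case using has_jet_of_int[of 1] by simp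
next
  case (Suc n)
  then show ?case by (simp add: has_jet_mult)
qed

lemma has_jet_power_int: "has_jet f u \<Longrightarrow> ev u \<noteq> 0 \<Longrightarrow> has_jet (\<lambda>t. f t powi n) (u powi n)"
  unfolding power_int_def by (auto intro!: has_jet_power has_jet_inverse)

lemma has_jet_pm: "has_jet f u \<Longrightarrow> has_jet g v \<Longrightarrow> has_jet (\<lambda>t. pm (f t) (g t) n) (pm u v n)"
  by (simp add: pm_def)

text \<open>The odd part of \<open>dual_ext\<close> is the chain rule for a curve with velocity
  \<open>(od u, od v, od w)\<close>.\<close>

lemma has_jet_dual_ext:
  assumes "\<And>p. cdiff (\<lambda>(x, y, z). \<Phi> x y z) p" "has_jet f u" "has_jet g v" "has_jet h w"
  shows "has_jet (\<lambda>t. \<Phi> (f t) (g t) (h t)) (dual_ext \<Phi> u v w)"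
proof -
  have "((\<lambda>s. (\<lambda>(x, y, z). \<Phi> x y z) (f s, g s, h s)) has_field_derivative
      od u * deriv (\<lambda>s. (\<lambda>(x, y, z). \<Phi> x y z) (s, g 0, h 0)) (f 0)
      + od v * deriv (\<lambda>s. (\<lambda>(x, y, z). \<Phi> x y z) (f 0, s, h 0)) (g 0)
      + od w * deriv (\<lambda>s. (\<lambda>(x, y, z). \<Phi> x y z) (f 0, g 0, s)) (h 0)) (at 0)"
    by (rule cdiff_chain) (use assms in \<open>auto simp: has_jet_def\<close>)
  then show ?thesis using assms(2-4) by (simp add: has_jet_def dual_ext_def)
qed

text \<open>The transfer principle: an identity between complex functions along a curve becomes one
  between dual numbers. Agreement near 0 is enough, which matters because denominators are known to
  be nonzero only there.\<close>

lemma has_jet_unique: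
  assumes "has_jet f u" "has_jet g v" "\<forall>\<^sub>F t in nhds 0. f t = g t"
  shows "u = v"
proof -
  have "f 0 = g 0" using assms(3) by (rule eventually_nhds_x_imp_x)
  moreover have "(g has_field_derivative od u) (at 0)"
    using assms(1) DERIV_cong_ev[OF refl assms(3) refl] unfolding has_jet_def by blast
  ultimately show ?thesis
    using assms(1,2) DERIV_unique unfolding has_jet_def dual_num_eq_iff by fastforce
qed

lemma mu_power_int_cdiff:
  assumes "weierstrass_sigma k g2 g3 \<noteq> 0"
  shows "cdiff (\<lambda>(k, g2, g3). mu k g2 g3 powi m) (k, g2, g3)"
proof -
  have "cdiff (\<lambda>v. (- ((case v of (k, g2, g3) \<Rightarrow> weierstrass_sigma k g2 g3) powi (-4))) powi m) (k, g2, g3)"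
    by (intro cdiff_power_int cdiff_uminus weierstrass_sigma_cdiff) (use assms in auto)
  then show ?thesis by (simp add: mu_def case_prod_beta')
qed

lemma has_jet_eventually_nonzero:
  assumes "has_jet f u" "ev u \<noteq> 0"
  shows "\<forall>\<^sub>F t in nhds 0. f t \<noteq> 0"
proof -
  have "isCont f 0" using assms(1) unfolding has_jet_def by (auto intro: DERIV_isCont)
  then have "(f \<longlongrightarrow> f 0) (nhds 0)" unfolding isCont_def tendsto_at_iff_tendsto_nhds .
  then show ?thesis by (rule tendsto_imp_eventually_ne) (use assms in \<open>simp add: has_jet_def\<close>)
qed

lemma has_jet_dual_sigma:
  "has_jet f u \<Longrightarrow> has_jet g v \<Longrightarrow> has_jet h w \<Longrightarrow>
    has_jet (\<lambda>t. weierstrass_sigma (f t) (g t) (h t)) (dual_sigma u v w)"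
  unfolding dual_sigma_def by (rule has_jet_dual_ext[OF weierstrass_sigma_cdiff])

lemma has_jet_dual_mu:
  assumes "has_jet k K" "has_jet g G" "has_jet h H" "ev (dual_sigma K G H) \<noteq> 0"
  shows "has_jet (\<lambda>t. mu (k t) (g t) (h t)) (dual_mu K G H)"
  unfolding mu_def dual_mu_def by (intro has_jet_uminus has_jet_power_int has_jet_dual_sigma assms)

lemma ev_power_int: "ev u \<noteq> 0 \<Longrightarrow> ev (u powi n) = ev u powi n"
  using has_jet_power_int[OF has_jet_line, of u n] by (simp add: has_jet_def)

lemma ev_dual_mu_nonzero:
  assumes "ev (dual_sigma K g2 g3) \<noteq> 0"
  shows "ev (dual_mu K g2 g3) \<noteq> 0"
  using assms by (simp add: dual_mu_def ev_power_int)

text \<open>The curve \<open>bp\<close> is arbitrary, which serves two purposes: a straight line for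
  the component formula, and \<open>- inverse \<mu> * bm\<close> along the curve for the
  recurrence.\<close>

lemma has_jet_dual_X:
  assumes "has_jet ap Ap" "has_jet am Am" "has_jet bp Bp" "has_jet bm Bm" "has_jet z Z" "has_jet k K"
    "has_jet g G" "has_jet h H" and nz: "ev (dual_sigma K G H) \<noteq> 0" "ev Bp \<noteq> 0" "ev Bm \<noteq> 0"
  shows "has_jet (\<lambda>t. even_x (ap t) (am t) (bp t) (bm t) (z t) (k t) (g t) (h t) n) (dual_X Ap Am Bp Bm Z K G H n)"
  unfolding even_x_def dual_X_def
  by (intro has_jet_mult has_jet_pm has_jet_power_int has_jet_dual_mu has_jet_dual_sigma has_jet_add has_jet_of_int assms)
     (use nz in \<open>auto simp: pm_def ev_dual_mu_nonzero\<close>)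

text \<open>Along straight lines in all parameters the odd component is an ordinary total
  derivative, which the product rule splits into the stated terms. As \<open>Bp\<close> moves on its
  own line, the derivatives in \<kappa>, \<open>g2\<close>, \<open>g3\<close> act on
  \<open>\<mu>\<close> but not on \<open>Bp\<close>. Plain derivatives keep the formula valid at
  zeros; where the value is nonzero, the derivative in \<open>z\<close> is turned into
  \<zeta>.\<close>

lemma dual_X_eq:
  fixes n :: int
  assumes nz: "ev (dual_sigma K g2 g3) \<noteq> 0" "ev Ap \<noteq> 0" "ev Am \<noteq> 0" "ev Bp \<noteq> 0" "ev Bm \<noteq> 0"
  defines "a \<equiv> pm (ev Ap) (ev Am) n" and "b \<equiv> pm (ev Bp) (ev Bm) n"
  defines "\<xi> \<equiv> \<lambda>z k g h. even_x (ev Ap) (ev Am) (ev Bp) (ev Bm) z k g h n"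
  shows "dual_X Ap Am Bp Bm Z0 K g2 g3 n = Dual (\<xi> (ev Z0) (ev K) (ev g2) (ev g3))
      (\<xi> (ev Z0) (ev K) (ev g2) (ev g3)
          * (pm (od Ap) (od Am) n / a + of_int (n div 2) * (pm (od Bp) (od Bm) n / b))
        + od Z0 * deriv (\<lambda>t. \<xi> t (ev K) (ev g2) (ev g3)) (ev Z0)
        + od K * deriv (\<lambda>t. \<xi> (ev Z0) t (ev g2) (ev g3)) (ev K)
        + od g2 * deriv (\<lambda>t. \<xi> (ev Z0) (ev K) t (ev g3)) (ev g2)
        + od g3 * deriv (\<lambda>t. \<xi> (ev Z0) (ev K) (ev g2) t) (ev g3))" (is ?eq)
    and "\<xi> (ev Z0) (ev K) (ev g2) (ev g3) \<noteq> 0 \<Longrightarrow>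
      deriv (\<lambda>t. \<xi> t (ev K) (ev g2) (ev g3)) (ev Z0)
        = \<xi> (ev Z0) (ev K) (ev g2) (ev g3) * weierstrass_zeta (ev Z0 + of_int n * ev K) (ev g2) (ev g3)"
proof -
  define m where "m = n div 2"
  define l where "l u t = ev u + t * od u" for u t
  define a' b' c where "a' = pm (od Ap) (od Am) n" and "b' = pm (od Bp) (od Bm) n" and "c = a * b powi m"
  define z k g h where "z = ev Z0" and "k = ev K" and "g = ev g2" and "h = ev g3"
  define w where "w = of_int n * k + z"
  define S where "S = (\<lambda>(x, y, z). mu x y z powi (m\<^sup>2))"
  define V where "V = (\<lambda>(x, y, z). weierstrass_sigma x y z)"
  have ab: "a \<noteq> 0" "b \<noteq> 0" using nz by (auto simp: a_def b_def pm_def)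
  have \<xi>: "\<xi> z k g h = c * S (k, g, h) * V (of_int n * k + z, g, h)" for z k g h
    by (simp add: \<xi>_def even_x_def c_def a_def b_def S_def V_def m_def)
  have "weierstrass_sigma k g h \<noteq> 0"
    using nz(1) by (simp add: dual_sigma_def dual_ext_def k_def g_def h_def)
  then have cS: "cdiff S (k, g, h)" unfolding S_def by (rule mu_power_int_cdiff)
  have cV: "cdiff V (w, g, h)" unfolding V_def by (rule weierstrass_sigma_cdiff)
  define S1 S2 S3 where "S1 = deriv (\<lambda>s. S (s, g, h)) k" and "S2 = deriv (\<lambda>s. S (k, s, h)) g"
    and "S3 = deriv (\<lambda>s. S (k, g, s)) h"
  define V1 V2 V3 where "V1 = deriv (\<lambda>s. V (s, g, h)) w" and "V2 = deriv (\<lambda>s. V (w, s, h)) g"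
    and "V3 = deriv (\<lambda>s. V (w, g, s)) h"
  note pS = cdiff_partials[OF cS, folded S1_def S2_def S3_def]
  note pV = cdiff_partials[OF cV, folded V1_def V2_def V3_def]
  have w1: "((\<lambda>t. of_int n * t + z) has_field_derivative of_int n) (at k)"
    "((\<lambda>t. of_int n * k + t) has_field_derivative 1) (at z)"
    by (auto intro!: derivative_eq_intros)
  have V_k: "((\<lambda>t. V (of_int n * t + z, g, h)) has_field_derivative V1 * of_int n) (at k)"
    by (rule DERIV_chain2[where f = "\<lambda>s. V (s, g, h)", OF pV(1)[unfolded w_def] w1(1)])
  have V_z: "((\<lambda>t. V (of_int n * k + t, g, h)) has_field_derivative V1 * 1) (at z)"
    by (rule DERIV_chain2[where f = "\<lambda>s. V (s, g, h)", OF pV(1)[unfolded w_def] w1(2)])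
  have Dz: "deriv (\<lambda>t. \<xi> t k g h) z = c * S (k, g, h) * V1"
    unfolding \<xi> by (rule DERIV_imp_deriv, rule DERIV_cong, rule DERIV_cmult, rule V_z) simp
  have Dk: "deriv (\<lambda>t. \<xi> z t g h) k = c * (S1 * V (w, g, h) + S (k, g, h) * (of_int n * V1))"
    unfolding \<xi> w_def
    by (rule DERIV_imp_deriv, rule DERIV_cong, rule DERIV_mult, rule DERIV_cmult, rule pS(1), rule V_k)
       (simp add: algebra_simps)
  have Dg: "deriv (\<lambda>t. \<xi> z k t h) g = c * (S2 * V (w, g, h) + S (k, g, h) * V2)"
    unfolding \<xi> w_def[symmetric]
    by (rule DERIV_imp_deriv, rule DERIV_cong, rule DERIV_mult, rule DERIV_cmult, rule pS(2), rule pV(2))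
       (simp add: algebra_simps)
  have Dh: "deriv (\<lambda>t. \<xi> z k g t) h = c * (S3 * V (w, g, h) + S (k, g, h) * V3)"
    unfolding \<xi> w_def[symmetric]
    by (rule DERIV_imp_deriv, rule DERIV_cong, rule DERIV_mult, rule DERIV_cmult, rule pS(3), rule pV(3))
       (simp add: algebra_simps)
  have dl: "((\<lambda>t. l u t) has_field_derivative od u) (at 0)" "l u 0 = ev u" for u
    unfolding l_def by (auto intro!: derivative_eq_intros)
  have Stot: "((\<lambda>t. S (l K t, l g2 t, l g3 t)) has_field_derivative od K * S1 + od g2 * S2 + od g3 * S3) (at 0)"
    unfolding S1_def S2_def S3_def k_def g_def h_def dl(2)[symmetric]
    by (rule cdiff_chain[where x = "l K" and y = "l g2" and z = "l g3" and t = 0])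
       (use cS dl in \<open>auto simp: k_def g_def h_def\<close>)
  define wt where "wt t = of_int n * l K t + l Z0 t" for t
  have wt: "(wt has_field_derivative of_int n * od K + od Z0) (at 0)" "wt 0 = w"
    unfolding wt_def[abs_def] by (auto intro!: derivative_eq_intros dl simp: dl(2) w_def k_def z_def)
  have Vtot: "((\<lambda>t. V (wt t, l g2 t, l g3 t)) has_field_derivative
      (of_int n * od K + od Z0) * V1 + od g2 * V2 + od g3 * V3) (at 0)"
    unfolding V1_def V2_def V3_def g_def h_def dl(2)[symmetric] wt(2)[symmetric]
    by (rule cdiff_chain[where x = wt and y = "l g2" and z = "l g3" and t = 0])
       (use cV dl wt in \<open>auto simp: g_def h_def\<close>)
  have at: "((\<lambda>t. a + t * a') has_field_derivative a') (at 0)" "((\<lambda>t. b + t * b') has_field_derivative b') (at 0)"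
    by (auto intro!: derivative_eq_intros)
  have "((\<lambda>t. (b + t * b') powi m) has_field_derivative of_int m * (b + 0 * b') powi (m - 1) * b') (at 0)"
    by (rule DERIV_power_int[OF at(2)]) (use ab in simp)
  also have "of_int m * (b + 0 * b') powi (m - 1) * b' = of_int m * (b' / b) * b powi m"
    using ab by (simp add: power_int_diff)
  finally have bt: "((\<lambda>t. (b + t * b') powi m) has_field_derivative of_int m * (b' / b) * b powi m) (at 0)" .
  have tot: "((\<lambda>t. (a + t * a') * (b + t * b') powi m * S (l K t, l g2 t, l g3 t) * V (wt t, l g2 t, l g3 t))
      has_field_derivative ((a' * b powi m + (of_int m * (b' / b) * b powi m) * a) * S (k, g, h)
        + (od K * S1 + od g2 * S2 + od g3 * S3) * (a * b powi m)) * V (w, g, h)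
        + ((of_int n * od K + od Z0) * V1 + od g2 * V2 + od g3 * V3) * (a * b powi m * S (k, g, h))) (at 0)"
    by (rule DERIV_cong[OF DERIV_mult[OF DERIV_mult[OF DERIV_mult[OF at(1) bt] Stot] Vtot]])
       (simp add: dl(2) wt(2) k_def g_def h_def)
  have "has_jet (\<lambda>t. even_x (l Ap t) (l Am t) (l Bp t) (l Bm t) (l Z0 t) (l K t) (l g2 t) (l g3 t) n)
      (dual_X Ap Am Bp Bm Z0 K g2 g3 n)"
    unfolding l_def by (intro has_jet_dual_X has_jet_line nz)
  moreover have "(\<lambda>t. even_x (l Ap t) (l Am t) (l Bp t) (l Bm t) (l Z0 t) (l K t) (l g2 t) (l g3 t) n)
      = (\<lambda>t. (a + t * a') * (b + t * b') powi m * S (l K t, l g2 t, l g3 t) * V (wt t, l g2 t, l g3 t))"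
    by (auto simp: fun_eq_iff even_x_def S_def V_def wt_def m_def a_def b_def a'_def b'_def pm_def l_def)
  ultimately have J: "has_jet (\<lambda>t. (a + t * a') * (b + t * b') powi m * S (l K t, l g2 t, l g3 t) * V (wt t, l g2 t, l g3 t))
      (dual_X Ap Am Bp Bm Z0 K g2 g3 n)" by simp
  have ev: "ev (dual_X Ap Am Bp Bm Z0 K g2 g3 n) = \<xi> z k g h"
    using J unfolding has_jet_def \<xi> by (simp add: dl(2) wt(2) c_def k_def g_def h_def z_def w_def)
  have "od (dual_X Ap Am Bp Bm Z0 K g2 g3 n) = ((a' * b powi m + (of_int m * (b' / b) * b powi m) * a) * S (k, g, h)
        + (od K * S1 + od g2 * S2 + od g3 * S3) * (a * b powi m)) * V (w, g, h)
        + ((of_int n * od K + od Z0) * V1 + od g2 * V2 + od g3 * V3) * (a * b powi m * S (k, g, h))"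
    using J tot unfolding has_jet_def by (blast intro: DERIV_unique)
  also have "a' * b powi m = c * (a' / a)" using ab by (simp add: c_def)
  also have "a * b powi m = c" by (simp add: c_def)
  also have "of_int m * (b' / b) * b powi m * a = c * (of_int m * (b' / b))" by (simp add: c_def)
  also have "((c * (a' / a) + c * (of_int m * (b' / b))) * S (k, g, h)
        + (od K * S1 + od g2 * S2 + od g3 * S3) * c) * V (w, g, h)
        + ((of_int n * od K + od Z0) * V1 + od g2 * V2 + od g3 * V3) * (c * S (k, g, h))
      = \<xi> z k g h * (a' / a + of_int m * (b' / b)) + od Z0 * deriv (\<lambda>t. \<xi> t k g h) z
        + od K * deriv (\<lambda>t. \<xi> z t g h) k + od g2 * deriv (\<lambda>t. \<xi> z k t h) g + od g3 * deriv (\<lambda>t. \<xi> z k g t) h"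
    unfolding Dz Dk Dg Dh unfolding \<xi> w_def[symmetric] by algebra
  finally show ?eq
    using ev unfolding dual_num_eq_iff by (simp add: a'_def b'_def m_def z_def k_def g_def h_def)
  show "deriv (\<lambda>t. \<xi> t (ev K) (ev g2) (ev g3)) (ev Z0)
        = \<xi> (ev Z0) (ev K) (ev g2) (ev g3) * weierstrass_zeta (ev Z0 + of_int n * ev K) (ev g2) (ev g3)"
    if "\<xi> (ev Z0) (ev K) (ev g2) (ev g3) \<noteq> 0"
  proof -
    have "V (w, g, h) \<noteq> 0" using that by (auto simp: \<xi> w_def z_def k_def g_def h_def)
    moreover have "weierstrass_zeta (ev Z0 + of_int n * ev K) (ev g2) (ev g3) = V1 / V (w, g, h)"
      by (simp add: weierstrass_zeta_def logderiv_def V1_def V_def w_def z_def k_def g_def h_def add.commute)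
    ultimately show ?thesis
      using Dz by (simp add: \<xi> w_def z_def k_def g_def h_def)
  qed
qed

text \<open>The component formula is split by cases to spell out the convention for zeros:
  logarithmic derivatives and \<zeta> where \<open>x n\<close> is nonzero, plain partial derivatives
  where it is 0.\<close>

theorem proposition3p2:
  fixes Ap Am Bp Bm Z0 K g2 g3 \<mu> \<alpha> \<beta> :: dual_num
    and a\<^sub>p a\<^sub>m b\<^sub>p b\<^sub>m z\<^sub>0 \<kappa> h\<^sub>2 h\<^sub>3 :: complex
    and X :: "int \<Rightarrow> dual_num" and x :: "int \<Rightarrow> complex"
  assumes units: "Ap \<in> dual_units" "Am \<in> dual_units" "Bm \<in> dual_units"
      "dual_sigma K g2 g3 \<in> dual_units"
    and mu: "\<mu> = dual_mu K g2 g3"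
    and Bp: "Bp = - inverse \<mu> * Bm"
    and X: "X = dual_X Ap Am Bp Bm Z0 K g2 g3"
    and alpha: "\<alpha> = dual_sigma (3 * K) g2 g3 / dual_sigma K g2 g3 ^ 9"
    and beta: "\<beta> = - (dual_sigma_quotient K g2 g3 / dual_sigma K g2 g3 ^ 12)"
    and even_parts: "a\<^sub>p = ev Ap" "a\<^sub>m = ev Am" "b\<^sub>p = ev Bp" "b\<^sub>m = ev Bm"
      "z\<^sub>0 = ev Z0" "\<kappa> = ev K" "h\<^sub>2 = ev g2" "h\<^sub>3 = ev g3"
    and x: "x = even_x a\<^sub>p a\<^sub>m b\<^sub>p b\<^sub>m z\<^sub>0 \<kappa> h\<^sub>2 h\<^sub>3"
  shows "(\<forall>n. X n * X (n + 5) = \<alpha> * X (n + 1) * X (n + 4) + \<beta> * X (n + 2) * X (n + 3)) \<and>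
    (\<forall>n. x n \<noteq> 0 \<longrightarrow> X n = Dual (x n)
      (x n * (pm (od Ap) (od Am) n / pm a\<^sub>p a\<^sub>m n
        + of_int (n div 2) * (pm (od Bp) (od Bm) n / pm b\<^sub>p b\<^sub>m n)
        + od Z0 * weierstrass_zeta (z\<^sub>0 + of_int n * \<kappa>) h\<^sub>2 h\<^sub>3
        + od K * logderiv (\<lambda>t. even_x a\<^sub>p a\<^sub>m b\<^sub>p b\<^sub>m z\<^sub>0 t h\<^sub>2 h\<^sub>3 n) \<kappa>
        + od g2 * logderiv (\<lambda>t. even_x a\<^sub>p a\<^sub>m b\<^sub>p b\<^sub>m z\<^sub>0 \<kappa> t h\<^sub>3 n) h\<^sub>2
        + od g3 * logderiv (\<lambda>t. even_x a\<^sub>p a\<^sub>m b\<^sub>p b\<^sub>m z\<^sub>0 \<kappa> h\<^sub>2 t n) h\<^sub>3))) \<and>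
    (\<forall>n. x n = 0 \<longrightarrow> X n = Dual (x n)
      (x n * (pm (od Ap) (od Am) n / pm a\<^sub>p a\<^sub>m n
        + of_int (n div 2) * (pm (od Bp) (od Bm) n / pm b\<^sub>p b\<^sub>m n))
        + od Z0 * deriv (\<lambda>t. even_x a\<^sub>p a\<^sub>m b\<^sub>p b\<^sub>m t \<kappa> h\<^sub>2 h\<^sub>3 n) z\<^sub>0
        + od K * deriv (\<lambda>t. even_x a\<^sub>p a\<^sub>m b\<^sub>p b\<^sub>m z\<^sub>0 t h\<^sub>2 h\<^sub>3 n) \<kappa>
        + od g2 * deriv (\<lambda>t. even_x a\<^sub>p a\<^sub>m b\<^sub>p b\<^sub>m z\<^sub>0 \<kappa> t h\<^sub>3 n) h\<^sub>2
        + od g3 * deriv (\<lambda>t. even_x a\<^sub>p a\<^sub>m b\<^sub>p b\<^sub>m z\<^sub>0 \<kappa> h\<^sub>2 t n) h\<^sub>3))"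
proof -
  have nz: "ev (dual_sigma K g2 g3) \<noteq> 0" "ev Ap \<noteq> 0" "ev Am \<noteq> 0" "ev Bm \<noteq> 0"
    using units by (auto simp: dual_units_def)
  have nzB: "ev Bp \<noteq> 0"
    using ev_dual_mu_nonzero[OF nz(1)] nz(4) by (simp add: Bp mu)
  note nz' = nz(1-3) nzB nz(4)
  have X_eq: "X n = Dual (x n)
      (x n * (pm (od Ap) (od Am) n / pm a\<^sub>p a\<^sub>m n
        + of_int (n div 2) * (pm (od Bp) (od Bm) n / pm b\<^sub>p b\<^sub>m n))
        + od Z0 * deriv (\<lambda>t. even_x a\<^sub>p a\<^sub>m b\<^sub>p b\<^sub>m t \<kappa> h\<^sub>2 h\<^sub>3 n) z\<^sub>0
        + od K * deriv (\<lambda>t. even_x a\<^sub>p a\<^sub>m b\<^sub>p b\<^sub>m z\<^sub>0 t h\<^sub>2 h\<^sub>3 n) \<kappa>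
        + od g2 * deriv (\<lambda>t. even_x a\<^sub>p a\<^sub>m b\<^sub>p b\<^sub>m z\<^sub>0 \<kappa> t h\<^sub>3 n) h\<^sub>2
        + od g3 * deriv (\<lambda>t. even_x a\<^sub>p a\<^sub>m b\<^sub>p b\<^sub>m z\<^sub>0 \<kappa> h\<^sub>2 t n) h\<^sub>3)" for n
    unfolding X x even_parts by (rule dual_X_eq(1)[OF nz'])
  have log_form: "X n = Dual (x n)
      (x n * (pm (od Ap) (od Am) n / pm a\<^sub>p a\<^sub>m n
        + of_int (n div 2) * (pm (od Bp) (od Bm) n / pm b\<^sub>p b\<^sub>m n)
        + od Z0 * weierstrass_zeta (z\<^sub>0 + of_int n * \<kappa>) h\<^sub>2 h\<^sub>3
        + od K * logderiv (\<lambda>t. even_x a\<^sub>p a\<^sub>m b\<^sub>p b\<^sub>m z\<^sub>0 t h\<^sub>2 h\<^sub>3 n) \<kappa>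
        + od g2 * logderiv (\<lambda>t. even_x a\<^sub>p a\<^sub>m b\<^sub>p b\<^sub>m z\<^sub>0 \<kappa> t h\<^sub>3 n) h\<^sub>2
        + od g3 * logderiv (\<lambda>t. even_x a\<^sub>p a\<^sub>m b\<^sub>p b\<^sub>m z\<^sub>0 \<kappa> h\<^sub>2 t n) h\<^sub>3))" if xn: "x n \<noteq> 0" for n
  proof -
    have zeta: "deriv (\<lambda>t. even_x a\<^sub>p a\<^sub>m b\<^sub>p b\<^sub>m t \<kappa> h\<^sub>2 h\<^sub>3 n) z\<^sub>0
        = x n * weierstrass_zeta (z\<^sub>0 + of_int n * \<kappa>) h\<^sub>2 h\<^sub>3"
      using dual_X_eq(2)[OF nz', of Z0 n] xn unfolding x even_parts by blast
    have ld: "deriv f t = x n * logderiv f t" if "f t = x n" for f t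
      using that xn by (simp add: logderiv_def)
    have "deriv (\<lambda>t. even_x a\<^sub>p a\<^sub>m b\<^sub>p b\<^sub>m z\<^sub>0 t h\<^sub>2 h\<^sub>3 n) \<kappa>
        = x n * logderiv (\<lambda>t. even_x a\<^sub>p a\<^sub>m b\<^sub>p b\<^sub>m z\<^sub>0 t h\<^sub>2 h\<^sub>3 n) \<kappa>"
      "deriv (\<lambda>t. even_x a\<^sub>p a\<^sub>m b\<^sub>p b\<^sub>m z\<^sub>0 \<kappa> t h\<^sub>3 n) h\<^sub>2
        = x n * logderiv (\<lambda>t. even_x a\<^sub>p a\<^sub>m b\<^sub>p b\<^sub>m z\<^sub>0 \<kappa> t h\<^sub>3 n) h\<^sub>2"
      "deriv (\<lambda>t. even_x a\<^sub>p a\<^sub>m b\<^sub>p b\<^sub>m z\<^sub>0 \<kappa> h\<^sub>2 t n) h\<^sub>3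
        = x n * logderiv (\<lambda>t. even_x a\<^sub>p a\<^sub>m b\<^sub>p b\<^sub>m z\<^sub>0 \<kappa> h\<^sub>2 t n) h\<^sub>3"
      by (rule ld, simp add: x)+
    then show ?thesis unfolding X_eq zeta by (simp add: algebra_simps)
  qed
  define l where "l u t = ev u + t * od u" for u t
  have jl: "has_jet (l u) u" for u using has_jet_line[of u] by (simp add: l_def[abs_def])
  define s where "s t = weierstrass_sigma (l K t) (l g2 t) (l g3 t)" for t
  define s3 where "s3 t = weierstrass_sigma (3 * l K t) (l g2 t) (l g3 t)" for t
  define q where "q t = sigma_quotient (l K t) (l g2 t) (l g3 t)" for t
  define m where "m t = mu (l K t) (l g2 t) (l g3 t)" for t
  \<comment> \<open>Recomputed from \<open>m t\<close> at every \<open>t\<close>, so that the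
    complex recurrence holds along the whole curve near 0; a straight line through \<open>Bp\<close>
    would satisfy the constraint only to first order. The jet is still \<open>Bp\<close>.\<close>
  define bp where "bp t = - inverse (m t) * l Bm t" for t
  define y where "y n t = even_x (l Ap t) (l Am t) (bp t) (l Bm t) (l Z0 t) (l K t) (l g2 t) (l g3 t) n" for n t
  have js: "has_jet s (dual_sigma K g2 g3)"
    unfolding s_def[abs_def] by (intro has_jet_dual_sigma jl)
  have "has_jet (\<lambda>t. of_int 3 * l K t) (of_int 3 * K)" by (intro has_jet_mult has_jet_of_int jl)
  then have js3: "has_jet s3 (dual_sigma (3 * K) g2 g3)"
    unfolding s3_def[abs_def] by (intro has_jet_dual_sigma jl) simp
  have jq: "has_jet q (dual_sigma_quotient K g2 g3)"
    unfolding q_def[abs_def] dual_sigma_quotient_def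
    by (intro has_jet_dual_ext[OF sigma_quotient_cdiff] jl)
  have jm: "has_jet m \<mu>"
    unfolding m_def[abs_def] mu by (intro has_jet_dual_mu jl nz)
  have jbp: "has_jet bp Bp"
    unfolding bp_def[abs_def] Bp
    by (intro has_jet_mult has_jet_uminus has_jet_inverse jm jl) (simp add: mu ev_dual_mu_nonzero nz)
  have jy: "has_jet (y n) (X n)" for n
    unfolding y_def[abs_def] X by (intro has_jet_dual_X jl jbp nz nzB)
  have ev_pow: "ev (dual_sigma K g2 g3 ^ j) \<noteq> 0" for j
    using has_jet_power[OF js, of j] js nz(1) unfolding has_jet_def by (metis power_not_zero)
  have j\<alpha>: "has_jet (\<lambda>t. s3 t / s t ^ 9) \<alpha>"
    unfolding alpha by (intro has_jet_divide has_jet_power js js3 ev_pow)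
  have j\<beta>: "has_jet (\<lambda>t. - (q t / s t ^ 12)) \<beta>"
    unfolding beta by (intro has_jet_uminus has_jet_divide has_jet_power js jq ev_pow)
  have somos: "X n * X (n + 5) = \<alpha> * X (n + 1) * X (n + 4) + \<beta> * X (n + 2) * X (n + 3)" for n
  proof -
    have jL: "has_jet (\<lambda>t. y n t * y (n + 5) t) (X n * X (n + 5))"
      by (intro has_jet_mult jy)
    have jR: "has_jet (\<lambda>t. s3 t / s t ^ 9 * y (n + 1) t * y (n + 4) t + - (q t / s t ^ 12) * y (n + 2) t * y (n + 3) t)
        (\<alpha> * X (n + 1) * X (n + 4) + \<beta> * X (n + 2) * X (n + 3))"
      by (intro has_jet_mult has_jet_add jy j\<alpha> j\<beta>)
    have "\<forall>\<^sub>F t in nhds 0. s t \<noteq> 0 \<and> l Bm t \<noteq> 0"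
      by (intro eventually_conj has_jet_eventually_nonzero[OF js] has_jet_eventually_nonzero[OF jl] nz)
    then have "\<forall>\<^sub>F t in nhds 0. y n t * y (n + 5) t
        = s3 t / s t ^ 9 * y (n + 1) t * y (n + 4) t + - (q t / s t ^ 12) * y (n + 2) t * y (n + 3) t"
    proof eventually_elim
      case (elim t)
      define \<sigma> where "\<sigma> n = weierstrass_sigma (of_int n * l K t + l Z0 t) (l g2 t) (l g3 t)" for n :: int
      show ?case
      proof (rule somos5_gauge[where \<sigma> = \<sigma> and ap = "l Ap t" and am = "l Am t" and bp = "bp t" and bm = "l Bm t" and \<mu> = "m t"])
        show "m t = - (s t powi - 4)" by (simp add: m_def mu_def s_def)
        show "bp t = - inverse (m t) * l Bm t" by (simp add: bp_def)
        show "y n t = pm (l Ap t) (l Am t) n * pm (bp t) (l Bm t) n powi (n div 2) * m t powi ((n div 2)\<^sup>2) * \<sigma> n" for n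
          by (simp add: y_def even_x_def m_def \<sigma>_def)
        show "s t * \<sigma> n * \<sigma> (n + 5) = s3 t * \<sigma> (n + 1) * \<sigma> (n + 4) - q t * s t * \<sigma> (n + 2) * \<sigma> (n + 3)" for n
        proof -
          have e: "of_int (n + i) * l K t + l Z0 t = (of_int n * l K t + l Z0 t) + of_int i * l K t" for i
            by (simp add: algebra_simps)
          show ?thesis
            using somos5_sigma[of "l K t" "l g2 t" "l g3 t" "of_int n * l K t + l Z0 t"]
            unfolding \<sigma>_def e s_def s3_def q_def by simp
        qed
      qed (use elim in auto)
    qed
    then show ?thesis
      by (rule has_jet_unique[OF jL jR])
  qed
  show ?thesis
    by (intro conjI allI impI somos log_form X_eq)
qed

end
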